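(* Let $p$ be an odd prime and $n\ge p$. Let $\mathfrak s,\mathfrak a\in[\mathfrak t_n]$ be of the same shape and let $i\in\{1,\dots,n_2-1\}$. Put $\mathfrak t:=\mathfrak s\cdot S_i$. Suppose first that $\mathfrak t$ is a standard tableau. If $\mathfrak s\rhd\mathfrak t$ set $\mathfrak s_u:=\mathfrak s$, otherwise set $\mathfrak s_u:=\mathfrak t$; let $\mathfrak s_d:=\mathfrak s_u\cdot S_i$. Define $\varrho:=c_{f(\mathfrak s_u)}(i)-c_{f(\mathfrak s_u)}(i+1)$ and $$X:=\frac{\bigl((\varrho+1)p-1\bigr)\bigl((\varrho+1)p-2\bigr)\cdots\bigl(\varrho p+1\bigr)}{\bigl(\varrho p-1\bigr)\bigl(\varrho p-2\bigr)\cdots\bigl((\varrho-1)p+1\bigr)}\in\mathbb Q,$$ with $p-1$ factors in decreasing order in both numerator and denominator. Then the left action of $\mathbb U_i$ satisfies (a) $\mathbb U_i f_{\mathfrak s_d\mathfrak a}=\dfrac{\varrho+1}{\varrho}f_{\mathfrak s_d\mathfrak a}+\dfrac{\varrho^2-1}{X\varrho^2}f_{\mathfrak s_u\mathfrak a}$; (b) $\mathbb U_i f_{\mathfrak s_u\mathfrak a}=\dfrac{\varrho-1}{\varrho}f_{\mathfrak s_u\mathfrak a}+Xf_{\mathfrak s_d\mathfrak a}$. Suppose next that $\mathfrak t$ is not standard. Then (c) $\mathbb U_if_{\mathfrak s\mathfrak a}=0$ if $i,i+1$ are in the same column of $f(\mathfrak s)$; (d) $\mathbb U_if_{\mathfrak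 s\mathfrak a}=2f_{\mathfrak s\mathfrak a}$ if $i,i+1$ are in the same row of $f(\mathfrak s)$.
   Context: **Algebra and tableaux.** $\mathsf{TL}_n^{\Bbbk}$ is the unital $\Bbbk$-algebra on $u_1,\dots,u_{n-1}$ with $u_i^2=2u_i$, $u_iu_ju_i=u_i$ for $|i-j|=1$, $u_iu_j=u_ju_i$ for $|i-j|>1$; equivalently, the algebra with basis non-crossing matchings of $n$ top and $n$ bottom points, $D_1D_2$ being $D_1$ on top of $D_2$ with loops replaced by $2$. $\mathrm{Par}_n^{\le2}$: partitions of $n$ with at most two columns; $\mathrm{Std}(\lambda)$: standard $\lambda$-tableaux; $\mathrm{Std}(\mathrm{Par}_n^{\le2})=\bigcup_\lambda\mathrm{Std}(\lambda)$. Content: $c_{\mathfrak t}(i)=c-r$ if $i$ is in row $r$, column $c$ of $\mathfrak t$. $\mathfrak s\trianglelefteq\mathfrak t$ means that for each $m$ the shape of $\mathfrak s$ restricted to entries $\le m$ is dominated by that of $\mathfrak t$ restricted to entries $\le m$. $\mathfrak S_n$ acts on tableaux by permuting entries; $s_k=(k,k+1)$. **Idempotents.** $\Phi:\mathbb Q\mathfrak S_n\to\mathsf{TL}_n^{\mathbb Q}$ is the homomorphism $s_i\mapsto u_i-1$; $L_1=0$, $L_i=\sum_{j<i}(j,i)$, $\mathbf L_i=\Phi(L_i)$. With $\mathcal C$ the set of all contents $c_{\mathfrak s}(i)$ ($\mathfrak s\in\mathrm{Std}(\mathrm{Par}_n^{\le2})$, $1\le i\le n$), $\mathbb E_{\mathfrak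 t}=\prod_{c\in\mathcal C}\prod_{i:\,c\ne c_{\mathfrak t}(i)}\frac{\mathbf L_i-c}{c_{\mathfrak t}(i)-c}\in\mathsf{TL}_n^{\mathbb Q}$; these form a complete set of orthogonal primitive idempotents. **Basis $f_{\mathfrak s\mathfrak t}$.** For $\mathfrak t\in\mathrm{Std}(\lambda)$, $\lambda\in\mathrm{Par}_n^{\le2}$, the half-diagram $C_{\mathfrak t}$ has $n$ bottom points: going through $1,\dots,n$ in increasing order, raise a vertical line from $i$ if $i$ is in the first column of $\mathfrak t$, and join $i$ to the nearest still vacant line to its left if $i$ is in the second column. For $\mathfrak s,\mathfrak t\in\mathrm{Std}(\lambda)$, $C_{\mathfrak s\mathfrak t}$ is the diagram obtained by placing the horizontal reflection of $C_{\mathfrak s}$ on top of $C_{\mathfrak t}$. Put $f_{\mathfrak s\mathfrak t}:=\mathbb E_{\mathfrak s}C_{\mathfrak s\mathfrak t}\mathbb E_{\mathfrak t}$; these form a $\mathbb Q$-basis of $\mathsf{TL}_n^{\mathbb Q}$. **Classes.** $p$ is an odd prime, $n\ge p$, and $n=(p-1)+n_1$, $n_1=pn_2+r_0$ with $0\le r_0<p$. $\mathfrak t_n$ is the one-column standard tableau with $n$ boxes; $[\mathfrak t_n]=\{\mathfrak s\in\mathrm{Std}(\mathrm{Par}_n^{\le2})\mid c_{\mathfrak s}(i)\equiv c_{\mathfrak t_n}(i)\bmod p\ \forall i\}$; $\mathbf e:=\sum_{\mathfrak s\in[\mathfrak t_n]}\mathbb E_{\mathfrak s}$, which lies in $\mathsf{TL}_n^{\mathbb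 Z_{(p)}}$ ($\mathbb Z_{(p)}$ is the localization of $\mathbb Z$ at $p$). **Blocks and $f$.** For $1\le j\le n_2$, $B_j=\{jp,jp+1,\dots,(j+1)p-1\}$. For $\mathfrak s\in[\mathfrak t_n]$ the numbers of each $B_j$ all lie in one column of $\mathfrak s$, and $f(\mathfrak s)\in\mathrm{Std}(\mathrm{Par}_{n_2}^{\le2})$ is the tableau having $j$ in the first column iff $B_j$ lies in the first column of $\mathfrak s$. $S_i\in\mathfrak S_n$ ($1\le i<n_2$) interchanges $B_i$ and $B_{i+1}$, preserving the order inside each block, and fixes all other numbers. **KLR elements.** For $1\le k<n$, $\psi_k\in\mathsf{TL}_n^{\mathbb Z_{(p)}}$ is the image under $\Phi$ of the KLR generator $\psi_k$ of $\mathbb Z_{(p)}\mathfrak S_n$ given by the Hu–Mathas isomorphism; it is the unique element of $\mathsf{TL}_n^{\mathbb Q}$ whose left multiplication is as follows. For $\mathfrak s,\mathfrak a\in\mathrm{Std}(\lambda)$, $\lambda\in\mathrm{Par}_n^{\le2}$, put $\mathfrak t=\mathfrak ss_k$, $r=c_{\mathfrak s}(k)-c_{\mathfrak s}(k+1)$, and let $\alpha=1$ if $\mathfrak t$ is standard with $\mathfrak t\lhd\mathfrak s$, $\alpha=(r^2-1)/r^2$ if $\mathfrak t$ is standard with $\mathfrak t\rhd\mathfrak s$. Let $\beta=0$ if $\mathfrak t$ is not standard; otherwise $\beta=\frac{\alpha}{1-r}$ if $r\equiv0$, $\beta=\alpha r$ if $r\equiv1$, $\beta=\frac{\alpha r}{1-r}$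 otherwise (congruences mod $p$). Then $\psi_kf_{\mathfrak s\mathfrak a}=\beta f_{\mathfrak t\mathfrak a}-\delta\frac1rf_{\mathfrak s\mathfrak a}$, where $\delta=1$ if $r\equiv0\bmod p$ and $\delta=0$ otherwise (the term $\beta f_{\mathfrak t\mathfrak a}$ is $0$ if $\mathfrak t$ is not standard). **$\mathbb U_i$.** For $1\le i<n_2$ let $I=(i+1)p-1$, $\Psi_j=\psi_{I-j+1}\psi_{I-j+3}\cdots\psi_{I+j-3}\psi_{I+j-1}$ ($j$ factors) for $1\le j\le p$, and $\mathbb U_i=\mathbf e\,\Psi_1\Psi_2\cdots\Psi_{p-1}\Psi_p\Psi_{p-1}\cdots\Psi_2\Psi_1\,\mathbf e$. *)

theory Defs
  imports
    Complex_Main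
    "HOL-Combinatorics.Permutations"
    "HOL-Library.Disjoint_Sets"
    "HOL-Library.FuncSet"
    "HOL-Library.Function_Algebras"
    "HOL-Number_Theory.Cong"
begin

section \<open>Linear combinations\<close>

text \<open>
  An element of a \<open>\<rat>\<close>-algebra with a distinguished basis is its coefficient function.  Sums and
  differences are the pointwise ones; the pointwise product is never used, each algebra below
  having its own multiplication.
\<close>

definition scale :: "rat \<Rightarrow> ('b \<Rightarrow> rat) \<Rightarrow> 'b \<Rightarrow> rat" where
  "scale c x = (\<lambda>b. c * x b)"

definition basis_elem :: "'b \<Rightarrow> 'b \<Rightarrow> rat" where
  "basis_elem b = (\<lambda>b'. if b' = b then 1 else 0)"


section \<open>The Temperley--Lieb algebra with loop parameter 2\<close>

text \<open>The level \<open>Mid\<close> does not occur in diagrams; it is used only for stacking two of them.\<close>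

datatype level = Top | Mid | Bot

type_synonym point = "level \<times> nat"
type_synonym diagram = "point set set"
type_synonym tl = "diagram \<Rightarrow> rat"

definition points :: "nat \<Rightarrow> point set" where
  "points n = {Top, Bot} \<times> {1..n}"

text \<open>
  Position on the boundary of the rectangle, read clockwise from the top left corner.  Two chords
  cross iff their end points alternate in this order.
\<close>

fun boundary_pos :: "nat \<Rightarrow> point \<Rightarrow> nat" where
  "boundary_pos n (Top, i) = i"
| "boundary_pos n (Bot, i) = 2 * n + 1 - i"
| "boundary_pos n (Mid, i) = 0"

definition noncrossing :: "nat \<Rightarrow> diagram \<Rightarrow> bool" where
  "noncrossing n D \<longleftrightarrow>
     \<not> (\<exists>a b c d. {a, c} \<in> D \<and> {b, d} \<in> D \<and>
           boundary_pos n a < boundary_pos n b \<and> boundary_pos n b < boundary_pos n c \<and>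
           boundary_pos n c < boundary_pos n d)"

definition diagrams :: "nat \<Rightarrow> diagram set" where
  "diagrams n = {D. partition_on (points n) D \<and> (\<forall>b\<in>D. card b = 2) \<and> noncrossing n D}"

text \<open>
  \<open>D1\<close> on top of \<open>D2\<close>: the bottom points of \<open>D1\<close> and the top points of \<open>D2\<close> are identified and
  become the points of level \<open>Mid\<close>.
\<close>

definition stack_edges :: "diagram \<Rightarrow> diagram \<Rightarrow> diagram" where
  "stack_edges D1 D2 =
     (\<lambda>b. (\<lambda>(l, i). (if l = Bot then Mid else l, i)) ` b) ` D1 \<union>
     (\<lambda>b. (\<lambda>(l, i). (if l = Top then Mid else l, i)) ` b) ` D2"

definition stack_components :: "nat \<Rightarrow> diagram \<Rightarrow> diagram \<Rightarrow> diagram" where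
  "stack_components n D1 D2 =
     (UNIV \<times> {1..n}) // {(x, y). \<exists>b \<in> stack_edges D1 D2. x \<in> b \<and> y \<in> b}\<^sup>*"

definition stack_diagram :: "nat \<Rightarrow> diagram \<Rightarrow> diagram \<Rightarrow> diagram" where
  "stack_diagram n D1 D2 = (\<lambda>K. K - {Mid} \<times> UNIV) ` stack_components n D1 D2 - {{}}"

definition stack_loops :: "nat \<Rightarrow> diagram \<Rightarrow> diagram \<Rightarrow> nat" where
  "stack_loops n D1 D2 = card {K \<in> stack_components n D1 D2. K \<subseteq> {Mid} \<times> UNIV}"

definition TL :: "nat \<Rightarrow> tl set" where
  "TL n = {x. \<forall>D. D \<notin> diagrams n \<longrightarrow> x D = 0}"

definition tl_mult :: "nat \<Rightarrow> tl \<Rightarrow> tl \<Rightarrow> tl" where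
  "tl_mult n x y = (\<lambda>D.
     \<Sum>(D1, D2) \<in> {(D1, D2). D1 \<in> diagrams n \<and> D2 \<in> diagrams n \<and> stack_diagram n D1 D2 = D}.
       2 ^ stack_loops n D1 D2 * x D1 * y D2)"

definition tl_one :: "nat \<Rightarrow> tl" where
  "tl_one n = basis_elem ((\<lambda>j. {(Top, j), (Bot, j)}) ` {1..n})"

definition tl_u :: "nat \<Rightarrow> nat \<Rightarrow> tl" where
  "tl_u n i = basis_elem
     ({{(Top, i), (Top, i + 1)}, {(Bot, i), (Bot, i + 1)}} \<union>
      (\<lambda>j. {(Top, j), (Bot, j)}) ` ({1..n} - {i, i + 1}))"

definition tl_prod :: "nat \<Rightarrow> tl list \<Rightarrow> tl" where
  "tl_prod n xs = foldr (tl_mult n) xs (tl_one n)"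


section \<open>The group algebra and the homomorphism to the Temperley--Lieb algebra\<close>

type_synonym ga = "(nat \<Rightarrow> nat) \<Rightarrow> rat"

definition GA :: "nat \<Rightarrow> ga set" where
  "GA n = {x. \<forall>w. \<not> w permutes {1..n} \<longrightarrow> x w = 0}"

text \<open>
  Permutations act on the right, so the group product \<open>v w\<close> is the composition \<open>w \<circ> v\<close>.
\<close>

definition ga_mult :: "nat \<Rightarrow> ga \<Rightarrow> ga \<Rightarrow> ga" where
  "ga_mult n x y = (\<lambda>z.
     \<Sum>(v, w) \<in> {(v, w). v permutes {1..n} \<and> w permutes {1..n} \<and> w \<circ> v = z}. x v * y w)"

definition is_TL_hom :: "nat \<Rightarrow> (ga \<Rightarrow> tl) \<Rightarrow> bool" where
  "is_TL_hom n \<Phi> \<longleftrightarrow>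
     \<Phi> \<in> GA n \<rightarrow> TL n \<and>
     (\<forall>x \<in> GA n. \<forall>y \<in> GA n. \<Phi> (x + y) = \<Phi> x + \<Phi> y) \<and>
     (\<forall>c. \<forall>x \<in> GA n. \<Phi> (scale c x) = scale c (\<Phi> x)) \<and>
     (\<forall>x \<in> GA n. \<forall>y \<in> GA n. \<Phi> (ga_mult n x y) = tl_mult n (\<Phi> x) (\<Phi> y)) \<and>
     \<Phi> (basis_elem id) = tl_one n \<and>
     (\<forall>i. 1 \<le> i \<and> i < n \<longrightarrow>
        \<Phi> (basis_elem (transpose i (i + 1))) = tl_u n i - tl_one n)"

definition jucys_murphy :: "nat \<Rightarrow> ga" where
  "jucys_murphy i = (\<Sum>j \<in> {1..<i}. basis_elem (transpose j i))"


section \<open>Tableaux\<close>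

text \<open>
  A partition is its Young diagram, a box being a pair (row, column), both counted from 1.
\<close>

type_synonym box = "nat \<times> nat"

definition young :: "box set \<Rightarrow> bool" where
  "young lam \<longleftrightarrow> finite lam \<and> lam \<subseteq> {1..} \<times> {1..} \<and>
     (\<forall>r c r' c'. (r, c) \<in> lam \<and> 1 \<le> r' \<and> r' \<le> r \<and> 1 \<le> c' \<and> c' \<le> c \<longrightarrow> (r', c') \<in> lam)"

definition Par2 :: "nat \<Rightarrow> box set set" where
  "Par2 n = {lam. young lam \<and> card lam = n \<and> lam \<subseteq> UNIV \<times> {1..2}}"

text \<open>
  A tableau is encoded by the map sending each entry to the box containing it (and extended by
  \<open>undefined\<close> outside the set of entries, so that equality is equality of tableaux).  Thus
  \<open>t ` {1..m}\<close> is the shape of \<open>t\<close> restricted to the entries \<open>\<le> m\<close>.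
\<close>

type_synonym tableau = "nat \<Rightarrow> box"

abbreviation row :: "tableau \<Rightarrow> nat \<Rightarrow> nat" where
  "row t i \<equiv> fst (t i)"

abbreviation column :: "tableau \<Rightarrow> nat \<Rightarrow> nat" where
  "column t i \<equiv> snd (t i)"

definition Std :: "box set \<Rightarrow> tableau set" where
  "Std lam = {t \<in> extensional {1..card lam}. bij_betw t {1..card lam} lam \<and>
     (\<forall>i \<in> {1..card lam}. \<forall>j \<in> {1..card lam}.
        (row t i = row t j \<and> column t i < column t j \<longrightarrow> i < j) \<and>
        (column t i = column t j \<and> row t i < row t j \<longrightarrow> i < j))}"

definition StdPar2 :: "nat \<Rightarrow> tableau set" where
  "StdPar2 n = (\<Union>lam \<in> Par2 n. Std lam)"

definition shape :: "nat \<Rightarrow> tableau \<Rightarrow> box set" where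
  "shape n t = t ` {1..n}"

definition content :: "tableau \<Rightarrow> nat \<Rightarrow> int" where
  "content t i = int (column t i) - int (row t i)"

text \<open>Dominance order: compare the numbers of boxes in the first \<open>k\<close> rows.\<close>

definition dominated :: "box set \<Rightarrow> box set \<Rightarrow> bool" where
  "dominated mu lam \<longleftrightarrow> (\<forall>k. card {x \<in> mu. fst x \<le> k} \<le> card {x \<in> lam. fst x \<le> k})"

definition tab_le :: "nat \<Rightarrow> tableau \<Rightarrow> tableau \<Rightarrow> bool" where
  "tab_le n s t \<longleftrightarrow> (\<forall>m \<in> {1..n}. dominated (shape m s) (shape m t))"

definition tab_less :: "nat \<Rightarrow> tableau \<Rightarrow> tableau \<Rightarrow> bool" where
  "tab_less n s t \<longleftrightarrow> tab_le n s t \<and> s \<noteq> t"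

text \<open>
  Each entry \<open>i\<close> of \<open>t\<close> is replaced by \<open>w i\<close>: the box of \<open>t\<close> that contained \<open>inv w i\<close> now contains
  \<open>i\<close>.
\<close>

definition act :: "tableau \<Rightarrow> (nat \<Rightarrow> nat) \<Rightarrow> tableau" where
  "act t w = (\<lambda>i. t (inv w i))"


section \<open>Idempotents and the seminormal basis\<close>

definition contents :: "nat \<Rightarrow> int set" where
  "contents n = {content s i | s i. s \<in> StdPar2 n \<and> i \<in> {1..n}}"

text \<open>
  The factors of the product are polynomials in the commuting elements \<open>\<Phi> (jucys_murphy i)\<close>,
  so the order chosen here is immaterial.
\<close>

definition idem :: "nat \<Rightarrow> (ga \<Rightarrow> tl) \<Rightarrow> tableau \<Rightarrow> tl" where
  "idem n \<Phi> t = tl_prod n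
     [scale (1 / of_int (content t i - c)) (\<Phi> (jucys_murphy i) - scale (of_int c) (tl_one n)).
        c \<leftarrow> sorted_list_of_set (contents n), i \<leftarrow> [1..<n + 1], c \<noteq> content t i]"

text \<open>
  \<open>half t m\<close> is the pair (still vacant lines, arcs) after the points \<open>1, \<dots>, m\<close> have been treated.
  The vacant lines are listed from right to left, so the head is the nearest one to the left of
  the next point.
\<close>

primrec half :: "tableau \<Rightarrow> nat \<Rightarrow> nat list \<times> nat set set" where
  "half t 0 = ([], {})"
| "half t (Suc m) = (case half t m of (vacant, arcs) \<Rightarrow>
     if column t (Suc m) = 1 then (Suc m # vacant, arcs)
     else (tl vacant, insert {hd vacant, Suc m} arcs))"

text \<open>Gluing the two half-diagrams joins their vertical lines in order.\<close>

definition C_diagram :: "nat \<Rightarrow> tableau \<Rightarrow> tableau \<Rightarrow> diagram" where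
  "C_diagram n s t =
     (\<lambda>b. Pair Top ` b) ` snd (half s n) \<union>
     (\<lambda>b. Pair Bot ` b) ` snd (half t n) \<union>
     (\<lambda>(i, j). {(Top, i), (Bot, j)}) ` set (zip (fst (half s n)) (fst (half t n)))"

definition f_elem :: "nat \<Rightarrow> (ga \<Rightarrow> tl) \<Rightarrow> tableau \<Rightarrow> tableau \<Rightarrow> tl" where
  "f_elem n \<Phi> s t = tl_prod n [idem n \<Phi> s, basis_elem (C_diagram n s t), idem n \<Phi> t]"


section \<open>The class of the one-column tableau, and blocks\<close>

definition one_column :: "nat \<Rightarrow> tableau" where
  "one_column n = (\<lambda>i \<in> {1..n}. (i, 1))"

definition t_class :: "nat \<Rightarrow> nat \<Rightarrow> tableau set" where
  "t_class p n = {s \<in> StdPar2 n.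
     \<forall>i \<in> {1..n}. [content s i = content (one_column n) i] (mod int p)}"

definition e_elem :: "nat \<Rightarrow> nat \<Rightarrow> (ga \<Rightarrow> tl) \<Rightarrow> tl" where
  "e_elem p n \<Phi> = (\<Sum>s \<in> t_class p n. idem n \<Phi> s)"

definition block :: "nat \<Rightarrow> nat \<Rightarrow> nat set" where
  "block p j = {j * p..<(j + 1) * p}"

definition in_first :: "nat \<Rightarrow> tableau \<Rightarrow> nat \<Rightarrow> bool" where
  "in_first p s j \<longleftrightarrow> (\<forall>x \<in> block p j. column s x = 1)"

text \<open>
  A two-column tableau with increasing columns is determined by the entries of its first column:
  the row of \<open>j\<close> is the number of entries \<open>\<le> j\<close> in the column of \<open>j\<close>.
\<close>

definition f_tab :: "nat \<Rightarrow> nat \<Rightarrow> tableau \<Rightarrow> tableau" where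
  "f_tab p n2 s = (\<lambda>j \<in> {1..n2}.
     (card {k \<in> {1..j}. in_first p s k = in_first p s j}, if in_first p s j then 1 else 2))"

definition block_swap :: "nat \<Rightarrow> nat \<Rightarrow> nat \<Rightarrow> nat" where
  "block_swap p i x =
     (if x \<in> block p i then x + p else if x \<in> block p (i + 1) then x - p else x)"


section \<open>KLR elements\<close>

definition psi_alpha :: "nat \<Rightarrow> nat \<Rightarrow> tableau \<Rightarrow> rat" where
  "psi_alpha n k s =
     (let t = act s (transpose k (k + 1)); r = of_int (content s k - content s (k + 1))
      in if tab_less n t s then 1 else (r\<^sup>2 - 1) / r\<^sup>2)"

definition psi_beta :: "nat \<Rightarrow> nat \<Rightarrow> nat \<Rightarrow> tableau \<Rightarrow> rat" where
  "psi_beta p n k s =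
     (let t = act s (transpose k (k + 1)); r = content s k - content s (k + 1);
          \<alpha> = psi_alpha n k s
      in if t \<notin> StdPar2 n then 0
         else if [r = 0] (mod int p) then \<alpha> / (1 - of_int r)
         else if [r = 1] (mod int p) then \<alpha> * of_int r
         else \<alpha> * of_int r / (1 - of_int r))"

text \<open>
  Since the \<open>f_elem n \<Phi> s a\<close> form a basis, the element \<open>x\<close> is uniquely determined.  If \<open>t\<close> is not
  standard, \<open>psi_beta\<close> is 0 and the value of \<open>f_elem n \<Phi> t a\<close> is irrelevant.
\<close>

definition is_psi :: "nat \<Rightarrow> nat \<Rightarrow> (ga \<Rightarrow> tl) \<Rightarrow> nat \<Rightarrow> tl \<Rightarrow> bool" where
  "is_psi p n \<Phi> k x \<longleftrightarrow> x \<in> TL n \<and>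
     (\<forall>lam \<in> Par2 n. \<forall>s \<in> Std lam. \<forall>a \<in> Std lam.
        let t = act s (transpose k (k + 1)); r = content s k - content s (k + 1) in
        tl_mult n x (f_elem n \<Phi> s a) =
          scale (psi_beta p n k s) (f_elem n \<Phi> t a) -
          scale (if [r = 0] (mod int p) then 1 / of_int r else 0) (f_elem n \<Phi> s a))"

definition Psi :: "nat \<Rightarrow> nat \<Rightarrow> (nat \<Rightarrow> tl) \<Rightarrow> nat \<Rightarrow> nat \<Rightarrow> tl" where
  "Psi p n \<psi> i j =
     (let I = (i + 1) * p - 1 in tl_prod n (map (\<lambda>m. \<psi> (I + 1 + 2 * m - j)) [0..<j]))"

definition U_elem :: "nat \<Rightarrow> nat \<Rightarrow> (ga \<Rightarrow> tl) \<Rightarrow> (nat \<Rightarrow> tl) \<Rightarrow> nat \<Rightarrow> tl" where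
  "U_elem p n \<Phi> \<psi> i = tl_prod n
     ([e_elem p n \<Phi>] @ map (Psi p n \<psi> i) ([1..<p] @ [p] @ rev [1..<p]) @ [e_elem p n \<Phi>])"

end

(*
  The products in U_i are computed in the seminormal basis f_st, where everything reduces to
  lattice paths.

  The noncrossing diagrams are generated by the u_i, so the homomorphism from the group algebra is
  onto; hence the diagram product is associative.  In the Temperley-Lieb algebra the symmetrizer of
  any three points vanishes, and squaring the Jucys-Murphy element L_{m+1} therefore gives a
  quadratic equation over L_1, ..., L_m.  On a joint eigenvector whose columns have lengths a and b
  it reads (L + a)(L + b - 1) = 0, so the joint spectrum is that of the standard two-column
  tableaux and the E_t are orthogonal idempotents.

  A tableau is the lattice path that goes up for an entry in the first column and down for one in
  the second.  Then psi_k flips the peak or valley at k, and can also keep it when its height is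
  divisible by p.  In the window of two adjacent blocks the path goes from one such wall to the next
  and back.  Psi_1, ..., Psi_{p-1} flip whole layers; Psi_p acts at the height of the wall and gives
  a sum over all subsets of its p peaks, of which Psi_{p-1} kills all but the empty and the full
  one.  So U_i has just two matrix entries per path, each a product of p^2 coefficients.
*)
theory Submission
  imports Defs
begin

section \<open>Generation of the diagrams\<close>

text \<open>The part on eigenvectors serves one identity: U_i begins and ends with e, so e f_sa =
  f_sa must be known for s in the class. The constant X has its origin in the layers. Let H = p rho
  be the height of the wall where the window starts. On either side of it, at distance g, a path
  makes p - g flips with one common coefficient. For valleys this coefficient is, up to sign and one
  exceptional g, a quotient of neighbouring heights, so the product of the powers telescopes to
  products of H + g or H - g, and their quotient is X. The opposite matrix entry is found by another
  route: flipping a peak and flipping the resulting valley back have product 1 unless the height is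
  0, 1 or -1 mod p, which gives the product of the two off-diagonal entries. The boundary case is
  rho = 1. There the falling path is not admissible, but the last flip towards it is that of a peak
  at height 1 and has coefficient 0; so (d) is (a) without its second term.\<close>

text \<open>Components of a graph are found by guessing a complete invariant \<open>g\<close>: edges
  preserve it, and points with equal values are connected. The components of stacked diagrams are
  computed this way.\<close>

lemma quotient_rtrancl_eq_fibers:
  assumes "sym R" and "\<And>x y. (x, y) \<in> R \<Longrightarrow> y \<in> A \<and> g x = g y"
    and "\<And>x y. x \<in> A \<Longrightarrow> y \<in> A \<Longrightarrow> g x = g y \<Longrightarrow> (x, y) \<in> R\<^sup>*"
  shows "A // R\<^sup>* = (\<lambda>x. {y \<in> A. g y = g x}) ` A"
proof -
  have "R\<^sup>* `` {x} = {y \<in> A. g y = g x}" if x: "x \<in> A" for x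
  proof -
    have "y \<in> A \<and> g y = g x" if "(x, y) \<in> R\<^sup>*" for y
      using that
    proof (induction rule: rtrancl_induct)
      case (step y z)
      then show ?case using assms(2)[of y z] by simp
    qed (use x in simp)
    moreover have "(x, y) \<in> R\<^sup>*" if "y \<in> A" "g y = g x" for y
      using assms(3)[OF x that(1)] that(2) by simp
    ultimately show ?thesis by blast
  qed
  then show ?thesis by (auto simp: quotient_def)
qed

section \<open>Matchings and the product with a generator\<close>

definition u_diagram :: "nat \<Rightarrow> nat \<Rightarrow> diagram" where
  "u_diagram n i = {{(Top, i), (Top, i + 1)}, {(Bot, i), (Bot, i + 1)}} \<union>
      (\<lambda>j. {(Top, j), (Bot, j)}) ` ({1..n} - {i, i + 1})"

lemma tl_u_eq: "tl_u n i = basis_elem (u_diagram n i)"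
  by (simp add: tl_u_def u_diagram_def)

text \<open>Planarity is kept apart: gluing and exchanging chords makes sense for every perfect
  matching, and noncrossing is checked afterwards on boundary positions.\<close>

definition matching :: "'a set \<Rightarrow> 'a set set \<Rightarrow> bool" where
  "matching A D \<longleftrightarrow> partition_on A D \<and> (\<forall>b\<in>D. card b = 2)"

lemma matching_unique: "matching A D \<Longrightarrow> b \<in> D \<Longrightarrow> b' \<in> D \<Longrightarrow> z \<in> b \<Longrightarrow> z \<in> b' \<Longrightarrow> b = b'"
  by (auto simp: matching_def partition_on_def disjoint_def)

lemma matching_subset: "matching A D \<Longrightarrow> b \<in> D \<Longrightarrow> b \<subseteq> A"
  by (auto simp: matching_def partition_on_def)

lemma matching_partner:
  assumes "matching A D" "z \<in> A"
  obtains z' where "{z, z'} \<in> D" "z' \<noteq> z" "z' \<in> A"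
proof -
  obtain b where b: "b \<in> D" "z \<in> b" using assms by (auto simp: matching_def partition_on_def)
  then have "card b = 2" using assms by (auto simp: matching_def)
  then obtain z' where "b = {z, z'}" "z' \<noteq> z" using b by (metis card_2_iff doubleton_eq_iff insertE singletonD)
  then show ?thesis using that b matching_subset[OF assms(1)] by (metis insert_subset)
qed

lemma matching_pair: "matching A D \<Longrightarrow> b \<in> D \<Longrightarrow> \<exists>x y. b = {x, y} \<and> x \<noteq> y"
  by (metis card_2_iff matching_def)

lemma matching_exchange:
  assumes M: "matching A D" and "{x, x'} \<in> D" "{y, y'} \<in> D" "{x, x'} \<noteq> {y, y'}"
  shows "matching A (D - {{x, x'}, {y, y'}} \<union> {{x, y}, {x', y'}})"
proof -
  have ne: "x \<noteq> x'" "y \<noteq> y'"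
    using M assms(2,3) by (auto simp: matching_def)
  have dj: "{x, x'} \<inter> {y, y'} = {}" using matching_unique[OF M] assms by blast
  then have "card {x, y} = 2" "card {x', y'} = 2" by (auto simp: card_2_iff)
  moreover have "\<Union>(D - {{x, x'}, {y, y'}} \<union> {{x, y}, {x', y'}}) = \<Union>D" using assms by blast
  moreover have "b \<inter> {x, x', y, y'} = {}" if "b \<in> D - {{x, x'}, {y, y'}}" for b
    using that matching_unique[OF M _ assms(2)] matching_unique[OF M _ assms(3)] by blast
  moreover have "{} \<notin> D" "\<Union>D = A" "disjoint D" using M by (auto simp: matching_def partition_on_def)
  ultimately show ?thesis using M dj ne unfolding matching_def partition_on_def disjoint_def by auto
qed

lemma diagrams_iff: "D \<in> diagrams n \<longleftrightarrow> matching (points n) D \<and> noncrossing n D"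
  by (auto simp: diagrams_def matching_def)

lemma finite_diagrams: "finite (diagrams n)"
proof -
  have "diagrams n \<subseteq> Pow (Pow (points n))"
    by (auto simp: diagrams_def partition_on_def)
  moreover have "finite (points n)" by (auto simp: points_def)
  ultimately show ?thesis by (meson finite_Pow_iff finite_subset)
qed

text \<open>The lower arc of \<open>u_i\<close> links the middle points \<open>i\<close> and
  \<open>i + 1\<close>, so the chords of \<open>D'\<close> that start there merge into one chord
  from \<open>x\<close> to \<open>y\<close>; the other chords of \<open>D'\<close> are only
  prolonged along vertical lines.\<close>

lemma stack_u_diagram:
  assumes i: "1 \<le> i" "i < n" and M: "matching (points n) D'"
    and x: "{(Top, i), x} \<in> D'" and y: "{(Top, i + 1), y} \<in> D'"
    and ne: "{(Top, i), x} \<noteq> {(Top, i + 1), y}"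
  shows "stack_diagram n (u_diagram n i) D' =
    D' - {{(Top, i), x}, {(Top, i + 1), y}} \<union> {{(Top, i), (Top, i + 1)}, {x, y}}" (is "_ = ?D")
proof -
  define D where "D = ?D"
  define A :: "point set" where "A = UNIV \<times> {1..n}"
  define up :: "point \<Rightarrow> point" where "up = (\<lambda>(l, i). (if l = Bot then Mid else l, i))"
  define dn :: "point \<Rightarrow> point" where "dn = (\<lambda>(l, i). (if l = Top then Mid else l, i))"
  define E where "E = stack_edges (u_diagram n i) D'"
  define R where "R = {(x, y). \<exists>b \<in> E. x \<in> b \<and> y \<in> b}"
  define blk where "blk z = (THE b. b \<in> D \<and> z \<in> b)" for z
  \<comment> \<open>The invariant of a point is the block of the expected result to which its
    component belongs: a middle point is read off at the top end of its vertical line, and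
    \<open>i\<close>, \<open>i + 1\<close> belong to the merged chord.\<close>
  define g where "g = (\<lambda>(l, j). if l = Mid then (if j = i \<or> j = i + 1 then {x, y} else blk (Top, j)) else blk (l, j))"
  have M': "matching (points n) D" unfolding D_def by (rule matching_exchange[OF M x y ne])
  have D_new: "{(Top, i), (Top, i + 1)} \<in> D" "{x, y} \<in> D" by (auto simp: D_def)
  have D_old: "b \<in> D" if "b \<in> D'" "b \<noteq> {(Top, i), x}" "b \<noteq> {(Top, i + 1), y}" for b
    using that by (auto simp: D_def)
  have dj: "{(Top, i), x} \<inter> {(Top, i + 1), y} = {}" using matching_unique[OF M x y] ne by blast
  have card2: "(Top, i) \<noteq> x" "(Top, i + 1) \<noteq> y"
  proof -
    have "card {(Top, i), x} = 2" "card {(Top, i + 1), y} = 2" using M x y by (simp_all add: matching_def)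
    then show "(Top, i) \<noteq> x" "(Top, i + 1) \<noteq> y" by auto
  qed
  have blkI: "blk z = b" if "b \<in> D" "z \<in> b" for z b
    unfolding blk_def by (rule the_equality) (use that matching_unique[OF M'] in metis)+
  have xyA: "x \<in> points n" "y \<in> points n" using matching_subset[OF M x] matching_subset[OF M y] by auto
  have E: "E = (`) up ` u_diagram n i \<union> (`) dn ` D'" by (simp add: E_def stack_edges_def up_def dn_def)
  have up_edge: "{(Top, j), (Mid, j)} \<in> E" if "1 \<le> j" "j \<le> n" "j \<noteq> i" "j \<noteq> i + 1" for j
  proof -
    have "{(Top, j), (Bot, j)} \<in> u_diagram n i" using that by (auto simp: u_diagram_def)
    then have "up ` {(Top, j), (Bot, j)} \<in> E" unfolding E by blast
    then show ?thesis by (simp add: up_def)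
  qed
  have u_edges: "{(Top, i), (Top, i + 1)} \<in> E" "{(Mid, i), (Mid, i + 1)} \<in> E"
  proof -
    have "up ` {(Top, i), (Top, i + 1)} \<in> E" "up ` {(Bot, i), (Bot, i + 1)} \<in> E"
      unfolding E u_diagram_def by blast+
    then show "{(Top, i), (Top, i + 1)} \<in> E" "{(Mid, i), (Mid, i + 1)} \<in> E" by (simp_all add: up_def)
  qed
  have E_cases: "b = {(Top, i), (Top, i + 1)} \<or> b = {(Mid, i), (Mid, i + 1)} \<or>
      (\<exists>j. 1 \<le> j \<and> j \<le> n \<and> j \<noteq> i \<and> j \<noteq> i + 1 \<and> b = {(Top, j), (Mid, j)}) \<or> (\<exists>b'\<in>D'. b = dn ` b')" if "b \<in> E" for b
  proof (cases "\<exists>b'\<in>D'. b = dn ` b'")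
    case False
    then have "b \<notin> (`) dn ` D'" by (auto simp only: image_iff)
    then have "b \<in> (`) up ` u_diagram n i" using that unfolding E by (simp only: Un_iff simp_thms)
    then obtain b'' where b'': "b'' \<in> u_diagram n i" "b = up ` b''" by (rule imageE)
    from b''(1) consider "b'' = {(Top, i), (Top, i + 1)}" | "b'' = {(Bot, i), (Bot, i + 1)}"
      | j where "j \<in> {1..n} - {i, i + 1}" "b'' = {(Top, j), (Bot, j)}" unfolding u_diagram_def by blast
    then show ?thesis
    proof cases
      case 3
      then have "b = {(Top, j), (Mid, j)}" using b'' by (simp add: up_def)
      then show ?thesis using 3 by (intro disjI2 disjI1 exI[of _ j]) simp
    qed (simp_all add: b'' up_def)
  qed blast
  have g_dn: "g (dn v) = blk v" if "v \<in> points n" "v \<noteq> (Top, i)" "v \<noteq> (Top, i + 1)" for v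
    using that by (cases v; cases "fst v") (auto simp: g_def dn_def points_def split: if_splits)
  have g_dn': "g (dn v) = {x, y}" if "v = (Top, i) \<or> v = (Top, i + 1)" for v
    using that by (auto simp: g_def dn_def)
  have xy_not: "x \<notin> {(Top, i), (Top, i + 1)}" "y \<notin> {(Top, i), (Top, i + 1)}" using dj card2 by blast+
  have blk_xy: "blk x = {x, y}" "blk y = {x, y}" by (intro blkI D_new; simp)+
  have two_points: "g v = g w \<and> w \<in> A" if "g a = g b" "a \<in> A" "b \<in> A" "v \<in> {a, b}" "w \<in> {a, b}" for a b v w
    using that by blast
  have gR: "g v = g w" and RA: "w \<in> A" if "(v, w) \<in> R" for v w
  proof -
    from that obtain b where b: "b \<in> E" "v \<in> b" "w \<in> b" by (auto simp: R_def)
    have "g v = g w \<and> w \<in> A"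
      using E_cases[OF b(1)]
    proof (elim disjE exE bexE conjE)
      assume b': "b = {(Top, i), (Top, i + 1)}"
      have "blk (Top, i) = {(Top, i), (Top, i + 1)}" "blk (Top, i + 1) = {(Top, i), (Top, i + 1)}"
        by (intro blkI D_new; simp)+
      then have "g (Top, i) = g (Top, i + 1)" by (simp add: g_def)
      moreover have "(Top, i) \<in> A" "(Top, i + 1) \<in> A" using i by (simp_all add: A_def)
      ultimately show ?thesis using b(2,3) unfolding b' by (rule two_points)
    next
      assume b': "b = {(Mid, i), (Mid, i + 1)}"
      have "g (Mid, i) = g (Mid, i + 1)" by (simp add: g_def)
      moreover have "(Mid, i) \<in> A" "(Mid, i + 1) \<in> A" using i by (simp_all add: A_def)
      ultimately show ?thesis using b(2,3) unfolding b' by (rule two_points)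
    next
      fix j assume j: "b = {(Top, j), (Mid, j)}" "1 \<le> j" "j \<le> n" "j \<noteq> i" "j \<noteq> i + 1"
      have "g (Top, j) = g (Mid, j)" using j by (simp add: g_def)
      moreover have "(Top, j) \<in> A" "(Mid, j) \<in> A" using j by (simp_all add: A_def)
      ultimately show ?thesis using b(2,3) unfolding j(1) by (rule two_points)
    next
      fix b' assume b': "b' \<in> D'" "b = dn ` b'"
      have "b' \<subseteq> points n" using matching_subset[OF M b'(1)] .
      then have wA: "w \<in> A" using b(3) unfolding b'(2) by (auto simp: A_def dn_def points_def)
      have "g v = g w"
      proof (cases "b' = {(Top, i), x} \<or> b' = {(Top, i + 1), y}")
        case True
        moreover have "g (dn x) = {x, y}" "g (dn y) = {x, y}"
          using g_dn[OF xyA(1)] g_dn[OF xyA(2)] blk_xy xy_not by simp_all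
        ultimately have "\<forall>v\<in>b'. g (dn v) = {x, y}" using g_dn' by blast
        then show ?thesis using b(2,3) unfolding b'(2) by (elim imageE) simp
      next
        case False
        then have "\<forall>v\<in>b'. v \<noteq> (Top, i) \<and> v \<noteq> (Top, i + 1)" using matching_unique[OF M b'(1)] x y by blast
        moreover have "b' \<in> D" using D_old[OF b'(1)] False by simp
        moreover have "g (dn v) = b'" if "v \<in> b'" "v \<noteq> (Top, i)" "v \<noteq> (Top, i + 1)" "b' \<in> D" for v
          using g_dn[OF subsetD[OF \<open>b' \<subseteq> points n\<close> that(1)] that(2,3)] blkI[OF that(4,1)] by simp
        ultimately have "\<forall>v\<in>b'. g (dn v) = b'" by blast
        then show ?thesis using b(2,3) unfolding b'(2) by (elim imageE) simp
      qed
      then show ?thesis using wA by simp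
    qed
    then show "g v = g w" "w \<in> A" by simp_all
  qed
  have RE: "(v, w) \<in> R\<^sup>*" if "{v, w} \<in> E" for v w
  proof (rule r_into_rtrancl)
    show "(v, w) \<in> R" unfolding R_def using that by blast
  qed
  have symR: "sym R" unfolding sym_def R_def by blast
  have symRs: "(w, v) \<in> R\<^sup>*" if "(v, w) \<in> R\<^sup>*" for v w
    using sym_rtrancl[OF symR] that by (rule symD)
  have v_dn: "(v, dn v) \<in> R\<^sup>*" if "v \<in> points n" "v \<noteq> (Top, i)" "v \<noteq> (Top, i + 1)" for v
  proof (cases "fst v = Bot")
    case True then show ?thesis by (cases v) (simp add: dn_def)
  next
    case False
    then have "v = (Top, snd v)" "1 \<le> snd v" "snd v \<le> n" using that(1) by (auto simp: points_def)
    moreover then have "(v, (Mid, snd v)) \<in> R\<^sup>*" using RE[OF up_edge[of "snd v"]] that(2,3) by metis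
    moreover have "dn (Top, snd v) = (Mid, snd v)" by (simp add: dn_def)
    ultimately show ?thesis by metis
  qed
  have dn_dn: "(dn v, dn w) \<in> R\<^sup>*" if "{v, w} \<in> D'" for v w
  proof (rule RE)
    have "dn ` {v, w} \<in> E" unfolding E using that by blast
    then show "{dn v, dn w} \<in> E" by simp
  qed
  have x_y: "(x, y) \<in> R\<^sup>*"
  proof -
    have "(x, dn x) \<in> R\<^sup>*" "(y, dn y) \<in> R\<^sup>*" using v_dn[OF xyA(1)] v_dn[OF xyA(2)] xy_not by blast+
    moreover note dn_dn[OF x] dn_dn[OF y]
    moreover have "(dn (Top, i), dn (Top, i + 1)) \<in> R\<^sup>*" using RE[OF u_edges(2)] by (simp add: dn_def)
    ultimately show ?thesis by (meson rtrancl_trans symRs)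
  qed
  have conn: "(v, w) \<in> R\<^sup>*" if vw: "b \<in> D" "v \<in> b" "w \<in> b" for v w b
  proof (cases "b \<in> D' - {{(Top, i), x}, {(Top, i + 1), y}}")
    case True
    then have no: "\<forall>v\<in>b. v \<noteq> (Top, i) \<and> v \<noteq> (Top, i + 1)" using matching_unique[OF M] x y by blast
    have sub: "b \<subseteq> points n" using True M matching_subset by auto
    have "v = w \<or> {v, w} = b" using matching_pair[OF M'] vw by fastforce
    then show ?thesis
    proof
      assume "{v, w} = b"
      then have "(dn v, dn w) \<in> R\<^sup>*" using dn_dn[of v w] True by blast
      moreover have "(v, dn v) \<in> R\<^sup>*" "(w, dn w) \<in> R\<^sup>*" using v_dn no sub vw by blast+
      ultimately show ?thesis by (meson rtrancl_trans symRs)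
    next
      assume "v = w"
      then show ?thesis by (simp only: rtrancl.rtrancl_refl)
    qed
  next
    case False
    then have "b = {(Top, i), (Top, i + 1)} \<or> b = {x, y}" using vw by (auto simp: D_def)
    then show ?thesis using vw(2,3) symRs[OF RE[OF u_edges(1)]] RE[OF u_edges(1)] x_y symRs[OF x_y]
      by (elim disjE) (simp_all, (elim disjE; simp)+)
  qed
  have points_blk: "blk z \<in> D \<and> z \<in> blk z" if z: "z \<in> points n" for z
  proof -
    obtain z' where "{z, z'} \<in> D" using matching_partner[OF M' z] by metis
    then show ?thesis using blkI[of "{z, z'}" z] by simp
  qed
  \<comment> \<open>As the two chords at \<open>i\<close> and \<open>i + 1\<close> differ, no
    component is a closed loop: each one reaches the boundary. So connectivity has to be checked
    only inside the blocks of \<open>D\<close>.\<close>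
  have to_point: "\<exists>w\<in>points n. (v, w) \<in> R\<^sup>* \<and> g v = blk w" if v: "v \<in> A" for v
  proof (cases "fst v = Mid")
    case False
    then have "g v = blk v" "v \<in> points n" using v by (cases v; cases "fst v"; auto simp: g_def A_def points_def)+
    then show ?thesis by blast
  next
    case True
    then obtain j where j: "v = (Mid, j)" "1 \<le> j" "j \<le> n" using v by (cases v) (auto simp: A_def)
    consider "j = i" | "j = i + 1" | "j \<noteq> i" "j \<noteq> i + 1" by blast
    then show ?thesis
    proof cases
      case 1
      have "(dn (Top, i), dn x) \<in> R\<^sup>*" using dn_dn x .
      moreover have "dn (Top, i) = v" using 1 j by (simp add: dn_def)
      moreover have "(x, dn x) \<in> R\<^sup>*" using v_dn[OF xyA(1)] xy_not by blast
      ultimately have "(v, x) \<in> R\<^sup>*" using symRs by (metis rtrancl_trans)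
      moreover have "g v = blk x" unfolding blk_xy using 1 j by (simp add: g_def)
      ultimately show ?thesis using xyA by blast
    next
      case 2
      have "(dn (Top, i + 1), dn y) \<in> R\<^sup>*" using dn_dn y .
      moreover have "dn (Top, i + 1) = v" using 2 j by (simp add: dn_def)
      moreover have "(y, dn y) \<in> R\<^sup>*" using v_dn[OF xyA(2)] xy_not by blast
      ultimately have "(v, y) \<in> R\<^sup>*" using symRs by (metis rtrancl_trans)
      moreover have "g v = blk y" unfolding blk_xy using 2 j by (simp add: g_def)
      ultimately show ?thesis using xyA by blast
    next
      case 3
      then have "(v, (Top, j)) \<in> R\<^sup>*" using j symRs[OF RE[OF up_edge[of j]]] by simp
      moreover have "g v = blk (Top, j)" using 3 j by (simp add: g_def)
      moreover have "(Top, j) \<in> points n" using j by (simp add: points_def)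
      ultimately show ?thesis by blast
    qed
  qed
  have gconn: "(v, w) \<in> R\<^sup>*" if vw: "v \<in> A" "w \<in> A" "g v = g w" for v w
  proof -
    obtain v' w' where v': "v' \<in> points n" "(v, v') \<in> R\<^sup>*" "g v = blk v'"
      and w': "w' \<in> points n" "(w, w') \<in> R\<^sup>*" "g w = blk w'" using to_point vw by meson
    then have "(v', w') \<in> R\<^sup>*" using conn[of "blk v'" v' w'] points_blk vw by metis
    then show ?thesis using v' w' by (meson rtrancl_trans symRs)
  qed
  have comps: "stack_components n (u_diagram n i) D' = (\<lambda>v. {w \<in> A. g w = g v}) ` A"
    unfolding stack_components_def E_def[symmetric] R_def[symmetric] A_def[symmetric]
    by (rule quotient_rtrancl_eq_fibers[OF symR _ gconn]) (use gR RA in auto)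
  have fib: "{w \<in> A. g w = g v} - {Mid} \<times> UNIV = g v \<and> g v \<in> D" if "v \<in> A" for v
  proof -
    obtain z where z: "z \<in> points n" "g v = blk z" using to_point \<open>v \<in> A\<close> by blast
    have 1: "{w \<in> A. g w = g v} - {Mid} \<times> UNIV = {w \<in> points n. blk w = blk z}"
    proof -
      have "w \<in> A \<and> w \<notin> {Mid} \<times> UNIV \<longleftrightarrow> w \<in> points n" for w
        by (cases w; cases "fst w") (auto simp: A_def points_def)
      moreover have "g w = blk w" if "w \<in> points n" for w using that by (cases w) (auto simp: g_def points_def)
      ultimately show ?thesis using z(2) by blast
    qed
    have "{w \<in> points n. blk w = blk z} = blk z"
    proof (intro set_eqI iffI)
      fix w assume "w \<in> blk z"
      moreover have "blk z \<in> D" using points_blk z(1) by simp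
      ultimately show "w \<in> {w \<in> points n. blk w = blk z}" using blkI matching_subset[OF M'] by blast
    qed (use points_blk in fastforce)
    then show ?thesis using 1 z points_blk by auto
  qed
  have "(\<lambda>K. K - {Mid} \<times> UNIV) ` stack_components n (u_diagram n i) D' = g ` A"
    unfolding comps image_image using fib by (intro image_cong) simp_all
  moreover have "g ` A = D"
  proof
    show "g ` A \<subseteq> D" using fib by blast
    show "D \<subseteq> g ` A"
    proof
      fix b assume b: "b \<in> D"
      obtain z z' where "b = {z, z'}" using matching_pair[OF M' b] by auto
      then have z: "z \<in> b" "z \<in> points n" using matching_subset[OF M' b] by auto
      have "b = blk z" using blkI[OF b z(1)] by simp
      moreover have "g z = blk z" "z \<in> A" using z(2) by (auto simp: g_def points_def A_def)
      ultimately show "b \<in> g ` A" by (metis imageI)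
    qed
  qed
  moreover have "{} \<notin> D" using M' by (auto simp: matching_def partition_on_def)
  ultimately show ?thesis unfolding stack_diagram_def by (simp add: D_def)
qed

section \<open>Planarity as a betweenness condition\<close>

definition strictly_between :: "nat \<Rightarrow> nat \<Rightarrow> nat \<Rightarrow> bool" where
  "strictly_between a c x \<longleftrightarrow> min a c < x \<and> x < max a c"

lemma inj_boundary_pos: "inj_on (boundary_pos n) (points n)"
proof (rule inj_onI)
  fix v w assume "v \<in> points n" "w \<in> points n" "boundary_pos n v = boundary_pos n w"
  then show "v = w"
    by (cases v; cases w; cases "fst v"; cases "fst w") (auto simp: points_def)
qed

text \<open>The eight excluded orders are all the ways in which the ends of two chords can alternate
  on a line.\<close>

lemma strictly_between_eqI:
  fixes a b c d :: nat
  assumes "a \<noteq> b" "a \<noteq> d" "c \<noteq> b" "c \<noteq> d"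
    and "\<not> (a < b \<and> b < c \<and> c < d)" "\<not> (c < b \<and> b < a \<and> a < d)"
    and "\<not> (a < d \<and> d < c \<and> c < b)" "\<not> (c < d \<and> d < a \<and> a < b)"
    and "\<not> (b < a \<and> a < d \<and> d < c)" "\<not> (d < a \<and> a < b \<and> b < c)"
    and "\<not> (b < c \<and> c < d \<and> d < a)" "\<not> (d < c \<and> c < b \<and> b < a)"
  shows "strictly_between a c b = strictly_between a c d"
  using assms unfolding strictly_between_def min_less_iff_disj less_max_iff_disj
  by (smt (verit) nat_neq_iff less_trans)

text \<open>Two chords do not cross iff both ends of one lie on the same side of the other. This
  form is symmetric in the ends of a chord, so chords can be handled without orienting them.\<close>

lemma noncrossing_iff_between:
  assumes "matching (points n) D"
  shows "noncrossing n D \<longleftrightarrow> (\<forall>a b c d. {a, c} \<in> D \<longrightarrow> {b, d} \<in> D \<longrightarrow>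
    strictly_between (boundary_pos n a) (boundary_pos n c) (boundary_pos n b) =
    strictly_between (boundary_pos n a) (boundary_pos n c) (boundary_pos n d))" (is "?l = ?r")
proof
  let ?p = "boundary_pos n"
  assume ?l
  then have no: "\<not> (?p a < ?p b \<and> ?p b < ?p c \<and> ?p c < ?p d)" if "{a, c} \<in> D" "{b, d} \<in> D" for a b c d
    using that unfolding noncrossing_def by blast
  show ?r
  proof (intro allI impI)
    fix a b c d assume ac: "{a, c} \<in> D" and bd: "{b, d} \<in> D"
    have *: "{c, a} \<in> D" "{d, b} \<in> D" using ac bd by (simp_all add: insert_commute)
    show "strictly_between (?p a) (?p c) (?p b) = strictly_between (?p a) (?p c) (?p d)"
    proof (cases "{a, c} = {b, d}")
      case True
      then have "a = b \<and> c = d \<or> a = d \<and> c = b" by (simp add: doubleton_eq_iff)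
      then show ?thesis by (auto simp: strictly_between_def)
    next
      case False
      have sub: "{a, b, c, d} \<subseteq> points n"
        using matching_subset[OF assms ac] matching_subset[OF assms bd] by simp
      have "{a, c} \<inter> {b, d} = {}" using matching_unique[OF assms ac bd] False by blast
      then have "a \<noteq> b" "a \<noteq> d" "c \<noteq> b" "c \<noteq> d" by auto
      then have ne: "?p a \<noteq> ?p b" "?p a \<noteq> ?p d" "?p c \<noteq> ?p b" "?p c \<noteq> ?p d"
        using sub inj_on_eq_iff[OF inj_boundary_pos] by simp_all
      show ?thesis
        by (rule strictly_between_eqI[OF ne no[OF ac bd] no[OF *(1) bd] no[OF ac *(2)] no[OF *]
            no[OF bd ac] no[OF *(2) ac] no[OF bd *(1)] no[OF *(2,1)]])
    qed
  qed
next
  assume r: ?r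
  show ?l unfolding noncrossing_def
  proof (intro notI, elim exE conjE)
    fix a b c d
    assume "{a, c} \<in> D" "{b, d} \<in> D" and lt: "boundary_pos n a < boundary_pos n b"
      "boundary_pos n b < boundary_pos n c" "boundary_pos n c < boundary_pos n d"
    then have "strictly_between (boundary_pos n a) (boundary_pos n c) (boundary_pos n b) =
      strictly_between (boundary_pos n a) (boundary_pos n c) (boundary_pos n d)" using r by blast
    then show False using lt by (simp add: strictly_between_def)
  qed
qed

section \<open>Undoing a product with a generator\<close>

text \<open>Cutting the cup and one further chord and reconnecting them yields a cofactor
  \<open>D'\<close> of \<open>D\<close>: in the product with \<open>u_i\<close> the cup reappears,
  and the two new chords are glued to the old one.\<close>

lemma stack_exchange:
  assumes M: "matching (points n) D" and i: "1 \<le> i" "i < n"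
    and cup: "{(Top, i), (Top, i + 1)} \<in> D" and qy: "{q, y} \<in> D"
    and ne: "{(Top, i), (Top, i + 1)} \<noteq> {q, y}"
    and D': "D' = D - {{(Top, i), (Top, i + 1)}, {q, y}} \<union> {{(Top, i), q}, {(Top, i + 1), y}}"
  shows "matching (points n) D'" "stack_diagram n (u_diagram n i) D' = D"
proof -
  show M': "matching (points n) D'" unfolding D' by (rule matching_exchange[OF M cup qy ne])
  have dj: "{(Top, i), (Top, i + 1)} \<inter> {q, y} = {}" using matching_unique[OF M cup qy] ne by blast
  have new: "{(Top, i), q} \<in> D'" "{(Top, i + 1), y} \<in> D'" unfolding D' by simp_all
  have new_ne: "{(Top, i), q} \<noteq> {(Top, i + 1), y}" using dj by (auto simp: doubleton_eq_iff)
  have "{(Top, i), q} \<notin> D"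
    using matching_unique[OF M cup, of "{(Top, i), q}" "(Top, i)"] dj by (auto simp: doubleton_eq_iff)
  moreover have "{(Top, i + 1), y} \<notin> D"
    using matching_unique[OF M cup, of "{(Top, i + 1), y}" "(Top, i + 1)"] dj by (auto simp: doubleton_eq_iff)
  ultimately have "D' - {{(Top, i), q}, {(Top, i + 1), y}} \<union> {{(Top, i), (Top, i + 1)}, {q, y}} = D"
    using cup qy unfolding D' by blast
  then show "stack_diagram n (u_diagram n i) D' = D"
    using stack_u_diagram[OF i M' new new_ne] by simp
qed

text \<open>Only the two new chords can cause a crossing. They are compared with each other
  (\<open>new\<close>) and with every untouched chord, seen from either of the two chords
  (\<open>old\<close>).\<close>

lemma noncrossing_exchange:
  assumes M: "matching (points n) D" and NC: "noncrossing n D" and i: "1 \<le> i" "i < n"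
    and cup: "{(Top, i), (Top, i + 1)} \<in> D" and qy: "{q, y} \<in> D"
    and ne: "{(Top, i), (Top, i + 1)} \<noteq> {q, y}"
    and D': "D' = D - {{(Top, i), (Top, i + 1)}, {q, y}} \<union> {{(Top, i), q}, {(Top, i + 1), y}}"
    and new: "strictly_between i (boundary_pos n q) (i + 1) = strictly_between i (boundary_pos n q) (boundary_pos n y)"
      "strictly_between (i + 1) (boundary_pos n y) i = strictly_between (i + 1) (boundary_pos n y) (boundary_pos n q)"
    and old: "\<And>v w. {v, w} \<in> D \<Longrightarrow> {boundary_pos n v, boundary_pos n w} \<inter> {i, i + 1, boundary_pos n q, boundary_pos n y} = {} \<Longrightarrow>
      strictly_between i (boundary_pos n q) (boundary_pos n v) = strictly_between i (boundary_pos n q) (boundary_pos n w) \<and>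
      strictly_between (i + 1) (boundary_pos n y) (boundary_pos n v) = strictly_between (i + 1) (boundary_pos n y) (boundary_pos n w) \<and>
      strictly_between (boundary_pos n v) (boundary_pos n w) i = strictly_between (boundary_pos n v) (boundary_pos n w) (boundary_pos n q) \<and>
      strictly_between (boundary_pos n v) (boundary_pos n w) (i + 1) = strictly_between (boundary_pos n v) (boundary_pos n w) (boundary_pos n y)"
  shows "noncrossing n D'"
proof -
  let ?p = "boundary_pos n"
  note M' = stack_exchange(1)[OF M i cup qy ne D']
  have D_old: "{v, w} \<in> D \<and> {?p v, ?p w} \<inter> {i, i + 1, ?p q, ?p y} = {}"
    if "{v, w} \<in> D - {{(Top, i), (Top, i + 1)}, {q, y}}" for v w
  proof -
    have vw: "{v, w} \<in> D" using that by blast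
    have "{v, w} \<inter> {(Top, i), (Top, i + 1), q, y} = {}"
      using matching_unique[OF M vw cup] matching_unique[OF M vw qy] that by blast
    moreover have "{v, w, (Top, i), (Top, i + 1), q, y} \<subseteq> points n"
      using matching_subset[OF M vw] matching_subset[OF M cup] matching_subset[OF M qy] by blast
    ultimately have "?p ` {v, w} \<inter> ?p ` {(Top, i), (Top, i + 1), q, y} = {}"
      using inj_on_image_Int[OF inj_boundary_pos, of "{v, w}" n "{(Top, i), (Top, i + 1), q, y}"] by simp
    then show ?thesis using vw by simp
  qed
  have cases: "{v, w} \<in> D - {{(Top, i), (Top, i + 1)}, {q, y}} \<or> (?p v = i \<and> ?p w = ?p q) \<or> (?p v = ?p q \<and> ?p w = i) \<or>
     (?p v = i + 1 \<and> ?p w = ?p y) \<or> (?p v = ?p y \<and> ?p w = i + 1)" if "{v, w} \<in> D'" for v w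
    using that unfolding D' by (auto simp: doubleton_eq_iff)
  have nc: "strictly_between (?p a) (?p c) (?p b) = strictly_between (?p a) (?p c) (?p d)"
    if "{a, c} \<in> D" "{b, d} \<in> D" for a b c d
    using NC that unfolding noncrossing_iff_between[OF M] by blast
  have sym: "strictly_between u v w = strictly_between v u w" for u v w
    by (auto simp: strictly_between_def)
  have triv: "\<not> strictly_between u v u" "\<not> strictly_between u v v" for u v
    by (auto simp: strictly_between_def)
  show ?thesis unfolding noncrossing_iff_between[OF M']
  proof (intro allI impI)
    fix a b c d assume ac: "{a, c} \<in> D'" and bd: "{b, d} \<in> D'"
    show "strictly_between (?p a) (?p c) (?p b) = strictly_between (?p a) (?p c) (?p d)"
    proof (cases "{a, c} \<in> D - {{(Top, i), (Top, i + 1)}, {q, y}}")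
      case True
      note ac' = D_old[OF True]
      show ?thesis
      proof (cases "{b, d} \<in> D - {{(Top, i), (Top, i + 1)}, {q, y}}")
        case True
        then show ?thesis using nc ac' by blast
      next
        case False
        then show ?thesis using cases[OF bd] old[OF conjunct1[OF ac'] conjunct2[OF ac']] by metis
      qed
    next
      case F: False
      show ?thesis
      proof (cases "{b, d} \<in> D - {{(Top, i), (Top, i + 1)}, {q, y}}")
        case True
        note bd' = D_old[OF True]
        show ?thesis using F cases[OF ac] old[OF conjunct1[OF bd'] conjunct2[OF bd']] sym by metis
      next
        case False
        have "(?p a = i \<and> ?p c = ?p q) \<or> (?p a = ?p q \<and> ?p c = i) \<or>
            (?p a = i + 1 \<and> ?p c = ?p y) \<or> (?p a = ?p y \<and> ?p c = i + 1)"
          using cases[OF ac] F by (simp only: simp_thms)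
        moreover have "(?p b = i \<and> ?p d = ?p q) \<or> (?p b = ?p q \<and> ?p d = i) \<or>
            (?p b = i + 1 \<and> ?p d = ?p y) \<or> (?p b = ?p y \<and> ?p d = i + 1)"
          using cases[OF bd] False by (simp only: simp_thms)
        moreover note new
        moreover have "strictly_between (?p q) i = strictly_between i (?p q)"
          "strictly_between (?p y) (i + 1) = strictly_between (i + 1) (?p y)" using sym by blast+
        ultimately show ?thesis by (elim disjE conjE) (simp_all only: triv)
      qed
    qed
  qed
qed

text \<open>The positions \<open>i - 1\<close>, \<open>i\<close>, \<open>i + 1\<close> are
  consecutive, so a chord that ends at none of them does not separate them.\<close>

lemma slide_arith:
  fixes i Y V W :: nat
  assumes "2 \<le> i" "Y \<notin> {i - 1, i, i + 1}" "V \<notin> {i - 1, i, i + 1, Y}" "W \<notin> {i - 1, i, i + 1, Y}"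
    and h: "strictly_between (i - 1) Y V = strictly_between (i - 1) Y W"
    and h2: "strictly_between V W (i - 1) = strictly_between V W Y"
  shows "strictly_between i (i - 1) V = strictly_between i (i - 1) W \<and>
      strictly_between (i + 1) Y V = strictly_between (i + 1) Y W \<and>
      strictly_between V W i = strictly_between V W (i - 1) \<and>
      strictly_between V W (i + 1) = strictly_between V W Y"
proof -
  obtain j where i: "i = Suc j" using assms(1) by (cases i) auto
  have e: "(Suc (Suc j) < X) = (j < X)" "(X < Suc (Suc j)) = (X < j)" "(Suc j < X) = (j < X)" "(X < Suc j) = (X < j)"
    if "X \<notin> {i - 1, i, i + 1}" for X
    using that unfolding i by (simp_all; linarith)+
  have V: "V \<notin> {i - 1, i, i + 1}" and W: "W \<notin> {i - 1, i, i + 1}" using assms(3,4) by simp_all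
  note unf = strictly_between_def min_less_iff_disj less_max_iff_disj
  have "strictly_between i (i - 1) X = False" "strictly_between (i + 1) Y X = strictly_between (i - 1) Y X"
    if "X \<notin> {i - 1, i, i + 1}" for X
    unfolding unf i using e[OF that] e[OF assms(2)] by (simp_all only: Suc_eq_plus1[symmetric] diff_Suc_1) auto
  moreover have "strictly_between V W i = strictly_between V W (i - 1)" "strictly_between V W (i + 1) = strictly_between V W (i - 1)"
    unfolding unf i using e[OF V] e[OF W] by (simp_all only: Suc_eq_plus1[symmetric] diff_Suc_1)
  ultimately show ?thesis using V W h h2 by simp
qed

text \<open>\<open>r\<close> stands for the boundary position of the bottom point
  \<open>m + 1\<close>. To the right of \<open>m\<close> vertical lines, \<open>m + 1\<close> and
  \<open>r\<close> are the extreme positions, and a chord joining them separates nothing from the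
  rest.\<close>

lemma jump_arith:
  fixes m Y V W r :: nat
  assumes Y: "m + 2 < Y" "Y < r" "V \<noteq> Y" "W \<noteq> Y"
    and c: "(m + 2 < V \<and> V < r \<and> m + 2 < W \<and> W < r) \<or> (V \<le> m \<and> r < W) \<or> (W \<le> m \<and> r < V)"
    and h: "strictly_between r Y V = strictly_between r Y W"
    and h2: "strictly_between V W r = strictly_between V W Y"
  shows "strictly_between (m + 1) r V = strictly_between (m + 1) r W \<and>
      strictly_between (m + 1 + 1) Y V = strictly_between (m + 1 + 1) Y W \<and>
      strictly_between V W (m + 1) = strictly_between V W r \<and>
      strictly_between V W (m + 1 + 1) = strictly_between V W Y"
  using c
proof (elim disjE conjE)
  assume V: "m + 2 < V" "V < r" and W: "m + 2 < W" "W < r"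
  have "strictly_between (m + 1 + 1) Y X = (\<not> strictly_between r Y X)" if "m + 2 < X" "X < r" "X \<noteq> Y" for X
    using that Y by (cases "X < Y") (simp_all add: strictly_between_def)
  then have "strictly_between (m + 1 + 1) Y V = strictly_between (m + 1 + 1) Y W" using V W Y h by simp
  moreover have "\<not> strictly_between V W r" "\<not> strictly_between V W (m + 1)" "\<not> strictly_between V W (m + 1 + 1)"
     "strictly_between (m + 1) r V" "strictly_between (m + 1) r W"
    using V W by (simp_all add: strictly_between_def min_less_iff_disj)
  ultimately show ?thesis using h2 by simp
qed (use Y in \<open>simp_all add: strictly_between_def min_less_iff_disj less_max_iff_disj\<close>)

lemma noncrossing_slide:
  assumes D: "D \<in> diagrams n" and i: "2 \<le> i" "i < n"
    and cup: "{(Top, i), (Top, i + 1)} \<in> D" and qy: "{(Top, i - 1), y} \<in> D"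
    and D': "D' = D - {{(Top, i), (Top, i + 1)}, {(Top, i - 1), y}} \<union> {{(Top, i), (Top, i - 1)}, {(Top, i + 1), y}}"
  shows "D' \<in> diagrams n" and "stack_diagram n (u_diagram n i) D' = D"
proof -
  let ?p = "boundary_pos n"
  have M: "matching (points n) D" and NC: "noncrossing n D" using D by (auto simp: diagrams_iff)
  have i1: "1 \<le> i" using i by simp
  have neq: "{(Top, i), (Top, i + 1)} \<noteq> {(Top, i - 1), y}" using i by (auto simp: doubleton_eq_iff)
  have dj: "{(Top, i), (Top, i + 1)} \<inter> {(Top, i - 1), y} = {}" using matching_unique[OF M cup qy] neq by blast
  have "card {(Top, i - 1), y} = 2" using M qy by (simp add: matching_def)
  then have "y \<noteq> (Top, i - 1)" by auto
  then have "y \<notin> {(Top, i - 1), (Top, i), (Top, i + 1)}" using dj by blast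
  moreover have "insert y {(Top, i - 1), (Top, i), (Top, i + 1)} \<subseteq> points n"
    using matching_subset[OF M qy] matching_subset[OF M cup] by simp
  ultimately have "?p y \<notin> ?p ` {(Top, i - 1), (Top, i), (Top, i + 1)}"
    using inj_on_image_mem_iff[OF inj_boundary_pos, of y n] by blast
  then have Y: "?p y \<notin> {i - 1, i, i + 1}" by simp
  have nc: "strictly_between (?p a) (?p c) (?p b) = strictly_between (?p a) (?p c) (?p d)"
    if "{a, c} \<in> D" "{b, d} \<in> D" for a b c d
    using NC that unfolding noncrossing_iff_between[OF M] by blast
  show "stack_diagram n (u_diagram n i) D' = D" by (rule stack_exchange(2)[OF M i1 i(2) cup qy neq D'])
  have "noncrossing n D'"
  proof (rule noncrossing_exchange[OF M NC i1 i(2) cup qy neq D'])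
    fix v w assume vw: "{v, w} \<in> D" and "{?p v, ?p w} \<inter> {i, i + 1, ?p (Top, i - 1), ?p y} = {}"
    then have "?p v \<notin> {i - 1, i, i + 1, ?p y}" "?p w \<notin> {i - 1, i, i + 1, ?p y}" by simp_all
    from slide_arith[OF i(1) Y this]
    show "strictly_between i (?p (Top, i - 1)) (?p v) = strictly_between i (?p (Top, i - 1)) (?p w) \<and>
      strictly_between (i + 1) (?p y) (?p v) = strictly_between (i + 1) (?p y) (?p w) \<and>
      strictly_between (?p v) (?p w) i = strictly_between (?p v) (?p w) (?p (Top, i - 1)) \<and>
      strictly_between (?p v) (?p w) (i + 1) = strictly_between (?p v) (?p w) (?p y)"
      using nc[OF qy vw] nc[OF vw qy] by simp
  next
    show "strictly_between i (?p (Top, i - 1)) (i + 1) = strictly_between i (?p (Top, i - 1)) (?p y)"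
      using Y i by (auto simp: strictly_between_def)
    show "strictly_between (i + 1) (?p y) i = strictly_between (i + 1) (?p y) (?p (Top, i - 1))"
      using Y i by (auto simp: strictly_between_def)
  qed
  then show "D' \<in> diagrams n" using stack_exchange(1)[OF M i1 i(2) cup qy neq D'] by (simp add: diagrams_iff)
qed

lemma noncrossing_jump:
  assumes D: "D \<in> diagrams n" and m: "m + 1 < n" and vert: "\<And>k. 1 \<le> k \<Longrightarrow> k \<le> m \<Longrightarrow> {(Top, k), (Bot, k)} \<in> D"
    and cup: "{(Top, m + 1), (Top, m + 1 + 1)} \<in> D" and qy: "{(Bot, m + 1), y} \<in> D"
    and D': "D' = D - {{(Top, m + 1), (Top, m + 1 + 1)}, {(Bot, m + 1), y}} \<union> {{(Top, m + 1), (Bot, m + 1)}, {(Top, m + 1 + 1), y}}"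
  shows "D' \<in> diagrams n" and "stack_diagram n (u_diagram n (m + 1)) D' = D"
proof -
  let ?p = "boundary_pos n" and ?r = "2 * n - m"
  have M: "matching (points n) D" and NC: "noncrossing n D" using D by (auto simp: diagrams_iff)
  have i1: "1 \<le> m + 1" by simp
  have neq: "{(Top, m + 1), (Top, m + 1 + 1)} \<noteq> {(Bot, m + 1), y}" by (auto simp: doubleton_eq_iff)
  have nc: "strictly_between (?p a) (?p c) (?p b) = strictly_between (?p a) (?p c) (?p d)"
    if "{a, c} \<in> D" "{b, d} \<in> D" for a b c d
    using NC that unfolding noncrossing_iff_between[OF M] by blast
  have pq: "?p (Bot, m + 1) = ?r" by simp
  have outside: "w = (Bot, k) \<or> w = (Top, k)" if "{v, w} \<in> D" "v = (Top, k) \<or> v = (Bot, k)" "1 \<le> k" "k \<le> m" for v w k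
  proof -
    have "{v, w} = {(Top, k), (Bot, k)}"
      using matching_unique[OF M that(1) vert[OF that(3,4)], of v] that(2) by auto
    then show ?thesis by (auto simp: doubleton_eq_iff)
  qed
  \<comment> \<open>A point outside the interval lies on one of the first \<open>m\<close> vertical
    lines, and the ends of such a line are on different sides of the interval.\<close>
  have range: "(m < ?p v \<and> ?p v \<le> ?r \<and> m < ?p w \<and> ?p w \<le> ?r) \<or> (?p v \<le> m \<and> ?r < ?p w) \<or> (?p w \<le> m \<and> ?r < ?p v)"
    if vw: "{v, w} \<in> D" for v w
  proof -
    have wv: "{w, v} \<in> D" using vw by (simp add: insert_commute)
    have pts: "v \<in> points n" "w \<in> points n" using matching_subset[OF M vw] by simp_all
    have out: "\<exists>k. (z = (Top, k) \<or> z = (Bot, k)) \<and> 1 \<le> k \<and> k \<le> m" if "z \<in> points n" "\<not> (m < ?p z \<and> ?p z \<le> ?r)" for z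
      using that m by (cases z; cases "fst z") (auto simp: points_def)
    have "card {v, w} = 2" using M vw by (simp add: matching_def)
    then have "v \<noteq> w" by auto
    show ?thesis
    proof (cases "(m < ?p v \<and> ?p v \<le> ?r) \<and> (m < ?p w \<and> ?p w \<le> ?r)")
      case False
      then obtain k where k: "1 \<le> k" "k \<le> m" "v = (Top, k) \<or> v = (Bot, k)" "w = (Top, k) \<or> w = (Bot, k)"
        using out[OF pts(1)] out[OF pts(2)] outside[OF vw] outside[OF wv] by metis
      then show ?thesis using \<open>v \<noteq> w\<close> m by auto
    qed simp
  qed
  have "{(Top, m + 1), (Top, m + 1 + 1)} \<inter> {(Bot, m + 1), y} = {}" using matching_unique[OF M cup qy] neq by blast
  moreover have "card {(Bot, m + 1), y} = 2" using M qy by (simp add: matching_def)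
  then have "y \<noteq> (Bot, m + 1)" by auto
  ultimately have "y \<notin> {(Bot, m + 1), (Top, m + 1), (Top, m + 1 + 1)}" by blast
  moreover have "insert y {(Bot, m + 1), (Top, m + 1), (Top, m + 1 + 1)} \<subseteq> points n"
    using matching_subset[OF M qy] matching_subset[OF M cup] by simp
  ultimately have "?p y \<notin> ?p ` {(Bot, m + 1), (Top, m + 1), (Top, m + 1 + 1)}"
    using inj_on_image_mem_iff[OF inj_boundary_pos, of y n] by blast
  then have Y0: "?p y \<noteq> m + 1" "?p y \<noteq> m + 2" "?p y \<noteq> ?r" by simp_all
  then have Y: "m + 2 < ?p y" "?p y < ?r" using range[OF qy] m unfolding pq by linarith+
  show "stack_diagram n (u_diagram n (m + 1)) D' = D" by (rule stack_exchange(2)[OF M i1 m cup qy neq D'])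
  have "noncrossing n D'"
  proof (rule noncrossing_exchange[OF M NC i1 m cup qy neq D'])
    fix v w assume vw: "{v, w} \<in> D" and dj: "{?p v, ?p w} \<inter> {m + 1, m + 1 + 1, ?p (Bot, m + 1), ?p y} = {}"
    then have ne: "?p v \<noteq> ?p y" "?p w \<noteq> ?p y" by simp_all
    have "(m + 2 < ?p v \<and> ?p v < ?r \<and> m + 2 < ?p w \<and> ?p w < ?r) \<or> (?p v \<le> m \<and> ?r < ?p w) \<or> (?p w \<le> m \<and> ?r < ?p v)"
    proof -
      have "?p v \<noteq> m + 1" "?p v \<noteq> m + 2" "?p v \<noteq> ?r" "?p w \<noteq> m + 1" "?p w \<noteq> m + 2" "?p w \<noteq> ?r"
        using dj unfolding pq by auto
      then have "m + 2 < ?p v \<and> ?p v < ?r \<and> m + 2 < ?p w \<and> ?p w < ?r"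
        if "m < ?p v \<and> ?p v \<le> ?r \<and> m < ?p w \<and> ?p w \<le> ?r" using that by linarith
      then show ?thesis using range[OF vw] by argo
    qed
    from jump_arith[OF Y ne this]
    show "strictly_between (m + 1) (?p (Bot, m + 1)) (?p v) = strictly_between (m + 1) (?p (Bot, m + 1)) (?p w) \<and>
      strictly_between (m + 1 + 1) (?p y) (?p v) = strictly_between (m + 1 + 1) (?p y) (?p w) \<and>
      strictly_between (?p v) (?p w) (m + 1) = strictly_between (?p v) (?p w) (?p (Bot, m + 1)) \<and>
      strictly_between (?p v) (?p w) (m + 1 + 1) = strictly_between (?p v) (?p w) (?p y)"
      using nc[OF qy vw] nc[OF vw qy] unfolding pq by blast
  next
    show "strictly_between (m + 1) (?p (Bot, m + 1)) (m + 1 + 1) = strictly_between (m + 1) (?p (Bot, m + 1)) (?p y)"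
      using Y m by (auto simp: strictly_between_def)
    show "strictly_between (m + 1 + 1) (?p y) (m + 1) = strictly_between (m + 1 + 1) (?p y) (?p (Bot, m + 1))"
      using Y m by (auto simp: strictly_between_def)
  qed
  then show "D' \<in> diagrams n" using stack_exchange(1)[OF M i1 m cup qy neq D'] by (simp add: diagrams_iff)
qed

text \<open>If no arc joined two top points, the chords would form a bijection from top to bottom
  that fixes \<open>1, ..., m\<close> but not \<open>m + 1\<close>. The chord at the top point
  \<open>m + 1\<close> and the chord at the bottom point \<open>m + 1\<close> would then both have
  their other end further right, and cross. So there is an arc at the top, and an innermost one
  joins neighbours.\<close>

lemma exists_cup:
  assumes D: "D \<in> diagrams n" and m: "m < n" and vert: "\<And>k. 1 \<le> k \<Longrightarrow> k \<le> m \<Longrightarrow> {(Top, k), (Bot, k)} \<in> D"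
    and not: "{(Top, m + 1), (Bot, m + 1)} \<notin> D"
  shows "\<exists>i. m < i \<and> i < n \<and> {(Top, i), (Top, i + 1)} \<in> D"
proof -
  have M: "matching (points n) D" and NC: "noncrossing n D" using D by (auto simp: diagrams_iff)
  have uniq: "x = y" if "{z, x} \<in> D" "{z, y} \<in> D" for x y z
    using matching_unique[OF M that, of z] by (auto simp: doubleton_eq_iff)
  have flip: "{z, x} \<in> D" if "{x, z} \<in> D" for x z using that by (simp add: insert_commute)
  have no: "\<not> (boundary_pos n a < boundary_pos n b \<and> boundary_pos n b < boundary_pos n c \<and> boundary_pos n c < boundary_pos n d)"
    if "{a, c} \<in> D" "{b, d} \<in> D" for a b c d
    using NC that unfolding noncrossing_def by blast
  define arc where "arc j k \<longleftrightarrow> j < k \<and> {(Top, j), (Top, k)} \<in> D" for j k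
  have "\<exists>j k. arc j k"
  proof (rule ccontr)
    assume "\<not> ?thesis"
    then have *: "{(Top, j), (Top, k)} \<notin> D" if "j \<noteq> k" for j k
      using that flip unfolding arc_def by (metis nat_neq_iff)
    have "\<exists>k\<in>{1..n}. {(Top, j), (Bot, k)} \<in> D" if j: "j \<in> {1..n}" for j
    proof -
      have "(Top, j) \<in> points n" using j by (simp add: points_def)
      then obtain z where z: "{(Top, j), z} \<in> D" "z \<noteq> (Top, j)" "z \<in> points n"
        using matching_partner[OF M] by blast
      then show ?thesis using *[of j "snd z"] by (cases z; cases "fst z") (auto simp: points_def)
    qed
    then obtain f where f: "\<And>j. j \<in> {1..n} \<Longrightarrow> f j \<in> {1..n} \<and> {(Top, j), (Bot, f j)} \<in> D" by metis
    have "inj_on f {1..n}"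
    proof (rule inj_onI)
      fix x y assume xy: "x \<in> {1..n}" "y \<in> {1..n}" "f x = f y"
      then have "{(Bot, f x), (Top, x)} \<in> D" "{(Bot, f x), (Top, y)} \<in> D" using f flip by metis+
      then show "x = y" using uniq by blast
    qed
    then have "f ` {1..n} = {1..n}" using f by (intro endo_inj_surj) auto
    moreover have "m + 1 \<in> {1..n}" using m by simp
    ultimately obtain l where l: "l \<in> {1..n}" "f l = m + 1" by (metis imageE)
    have fl: "{(Top, l), (Bot, m + 1)} \<in> D" using f[OF l(1)] l(2) by simp
    have fm: "{(Top, m + 1), (Bot, f (m + 1))} \<in> D" "f (m + 1) \<in> {1..n}" using f \<open>m + 1 \<in> {1..n}\<close> by blast+
    have "m + 1 < l"
    proof (rule ccontr)
      assume "\<not> m + 1 < l"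
      moreover have "l \<noteq> m + 1" using fl not by auto
      ultimately have "{(Top, l), (Bot, l)} \<in> D" using vert l(1) by simp
      then have "(Bot, l) = (Bot, m + 1)" using uniq fl by blast
      then show False using \<open>l \<noteq> m + 1\<close> by simp
    qed
    moreover have "m + 1 < f (m + 1)"
    proof (rule ccontr)
      assume "\<not> m + 1 < f (m + 1)"
      moreover have "f (m + 1) \<noteq> m + 1" using fm not by auto
      ultimately have "{(Top, f (m + 1)), (Bot, f (m + 1))} \<in> D" using vert fm(2) by simp
      then have "(Top, f (m + 1)) = (Top, m + 1)" using uniq flip fm(1) by blast
      then show False using \<open>f (m + 1) \<noteq> m + 1\<close> by simp
    qed
    ultimately show False using no[OF fm(1) fl] fm(2) l(1) by simp arith
  qed
  then obtain j k where jk: "arc j k" by blast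
  \<comment> \<open>Descent to an innermost arc: the partner of \<open>j + 1\<close> is caught
    strictly between \<open>j\<close> and \<open>k\<close>.\<close>
  have "\<exists>i. arc i (i + 1)"
    using jk
  proof (induction "k - j" arbitrary: j k rule: less_induct)
    case less
    show ?case
    proof (cases "k = j + 1")
      case False
      have jk: "j < k" "{(Top, j), (Top, k)} \<in> D" using less.prems by (auto simp: arc_def)
      have "(Top, k) \<in> points n" using matching_subset[OF M jk(2)] by simp
      then have k: "k \<le> n" by (simp add: points_def)
      then have "(Top, j + 1) \<in> points n" using jk by (simp add: points_def)
      then obtain z where z: "{(Top, j + 1), z} \<in> D" "z \<noteq> (Top, j + 1)" "z \<in> points n"
        using matching_partner[OF M] by blast
      have "z \<noteq> (Top, k)" using uniq[OF flip[OF jk(2)], of "(Top, j + 1)"] flip[OF z(1)] by auto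
      moreover have "z \<noteq> (Top, j)" using uniq[OF jk(2), of "(Top, j + 1)"] flip[OF z(1)] False by auto
      ultimately have z': "z \<noteq> (Top, k)" "z \<noteq> (Top, j)" .
      have lt: "j < boundary_pos n z" "boundary_pos n z < k"
      proof -
        have "(fst z = Top \<and> boundary_pos n z = snd z) \<or> n < boundary_pos n z"
          using z(3) by (cases z; cases "fst z") (auto simp: points_def)
        moreover have "snd z \<noteq> k" "snd z \<noteq> j" if "fst z = Top" using z' that by (metis prod.collapse)+
        ultimately have z_ne: "boundary_pos n z \<noteq> k" "boundary_pos n z \<noteq> j" using k jk(1) by linarith+
        show "boundary_pos n z < k" using no[OF jk(2) z(1)] z_ne False jk by simp
        have "\<not> boundary_pos n z < j" using no[OF flip[OF z(1)] jk(2)] False jk by simp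
        then show "j < boundary_pos n z" using z_ne by simp
      qed
      then obtain l where l: "z = (Top, l)" using z(3) k by (cases z; cases "fst z") (auto simp: points_def)
      then have "arc (j + 1) l" using z lt by (cases "j + 1 < l") (auto simp: arc_def)
      then show ?thesis using less.hyps[of l "j + 1"] lt l by simp
    qed (use less.prems in blast)
  qed
  then obtain i where i: "{(Top, i), (Top, i + 1)} \<in> D" by (auto simp: arc_def)
  have pts: "(Top, i) \<in> points n" "(Top, i + 1) \<in> points n" using matching_subset[OF M i] by simp_all
  have "m < i"
  proof (rule ccontr)
    assume "\<not> m < i"
    then have "{(Top, i), (Bot, i)} \<in> D" using vert pts by (simp add: points_def)
    then show False using uniq i by blast
  qed
  then show ?thesis using i pts by (auto simp: points_def)
qed

lemma all_vertical:
  assumes D: "D \<in> diagrams n" and vert: "\<And>k. 1 \<le> k \<Longrightarrow> k \<le> n \<Longrightarrow> {(Top, k), (Bot, k)} \<in> D"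
  shows "D = (\<lambda>j. {(Top, j), (Bot, j)}) ` {1..n}"
proof
  have M: "matching (points n) D" using D by (auto simp: diagrams_iff)
  show "(\<lambda>j. {(Top, j), (Bot, j)}) ` {1..n} \<subseteq> D" using vert by auto
  show "D \<subseteq> (\<lambda>j. {(Top, j), (Bot, j)}) ` {1..n}"
  proof
    fix b assume b: "b \<in> D"
    then obtain x y where xy: "b = {x, y}" using matching_pair[OF M b] by auto
    then have x: "x \<in> points n" "x \<in> b" using matching_subset[OF M b] by auto
    then have "snd x \<in> {1..n}" "x \<in> {(Top, snd x), (Bot, snd x)}"
      by (cases x; cases "fst x"; auto simp: points_def)+
    then show "b \<in> (\<lambda>j. {(Top, j), (Bot, j)}) ` {1..n}"
      using matching_unique[OF M b vert[of "snd x"] x(2)] by auto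
  qed
qed

section \<open>The Temperley--Lieb algebra as an algebra\<close>

text \<open>Elements are functions, but their sums are to be treated as sums in an algebra;
  pointwise evaluation happens only on request, through \<open>fun_apply\<close>.\<close>

declare zero_fun_apply [simp del] plus_fun_apply [simp del] minus_apply [simp del] uminus_apply [simp del]

lemmas fun_apply = zero_fun_apply plus_fun_apply minus_apply uminus_apply

lemma sum_fun_apply: "(\<Sum>i\<in>A. f i) x = (\<Sum>i\<in>A. f i x :: 'b :: comm_monoid_add)"
  using sum_comp_morphism[of "\<lambda>g. g x" f A] by (simp add: fun_apply o_def)

lemma scale_zero_left [simp]: "scale 0 x = 0"
  by (simp add: scale_def fun_eq_iff fun_apply)

lemma scale_zero_right [simp]: "scale c 0 = 0"
  by (simp add: scale_def fun_eq_iff fun_apply)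

lemma scale_one [simp]: "scale 1 x = x"
  by (simp add: scale_def)

lemma scale_scale [simp]: "scale c (scale d x) = scale (c * d) x"
  by (simp add: scale_def mult.assoc)

lemma scale_add_right: "scale c (x + y) = scale c x + scale c y"
  by (simp add: scale_def fun_eq_iff fun_apply algebra_simps)

lemma scale_diff_right: "scale c (x - y) = scale c x - scale c y"
  by (simp add: scale_def fun_eq_iff fun_apply algebra_simps)

lemma scale_add_left: "scale (c + d) x = scale c x + scale d x"
  by (simp add: scale_def fun_eq_iff fun_apply algebra_simps)

lemma scale_diff_left: "scale (c - d) x = scale c x - scale d x"
  by (simp add: scale_def fun_eq_iff fun_apply algebra_simps)

lemma scale_minus_left: "scale (- c) x = - scale c x"
  by (simp add: scale_def fun_eq_iff fun_apply)

lemma scale_sum: "scale c (\<Sum>i\<in>A. f i) = (\<Sum>i\<in>A. scale c (f i))"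
  by (induction A rule: infinite_finite_induct) (simp_all add: scale_add_right)

lemma scale_eq_0_iff: "scale c x = 0 \<longleftrightarrow> c = 0 \<or> x = 0"
  by (auto simp: scale_def fun_eq_iff fun_apply)

lemma tl_mult_add_left: "tl_mult n (x + y) z = tl_mult n x z + tl_mult n y z"
  by (rule ext) (simp add: tl_mult_def fun_apply sum.distrib[symmetric] split_def algebra_simps)

lemma tl_mult_add_right: "tl_mult n x (y + z) = tl_mult n x y + tl_mult n x z"
  by (rule ext) (simp add: tl_mult_def fun_apply sum.distrib[symmetric] split_def algebra_simps)

lemma tl_mult_scale_left [simp]: "tl_mult n (scale c x) y = scale c (tl_mult n x y)"
  by (rule ext) (simp add: tl_mult_def scale_def sum_distrib_left split_def algebra_simps)

lemma tl_mult_scale_right [simp]: "tl_mult n x (scale c y) = scale c (tl_mult n x y)"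
  by (rule ext) (simp add: tl_mult_def scale_def sum_distrib_left split_def algebra_simps)

lemma tl_mult_zero_left [simp]: "tl_mult n 0 y = 0"
  using tl_mult_scale_left[of n 0 0 y] by simp

lemma tl_mult_zero_right [simp]: "tl_mult n x 0 = 0"
  using tl_mult_scale_right[of n x 0 0] by simp

lemma tl_mult_diff_left: "tl_mult n (x - y) z = tl_mult n x z - tl_mult n y z"
  using tl_mult_add_left[of n "x - y" y z] by (simp add: algebra_simps)

lemma tl_mult_diff_right: "tl_mult n x (y - z) = tl_mult n x y - tl_mult n x z"
  using tl_mult_add_right[of n x "y - z" z] by (simp add: algebra_simps)

lemma tl_mult_sum_left: "tl_mult n (\<Sum>i\<in>A. f i) y = (\<Sum>i\<in>A. tl_mult n (f i) y)"
  by (induction A rule: infinite_finite_induct) (simp_all add: tl_mult_add_left)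

lemma tl_mult_sum_right: "tl_mult n x (\<Sum>i\<in>A. f i) = (\<Sum>i\<in>A. tl_mult n x (f i))"
  by (induction A rule: infinite_finite_induct) (simp_all add: tl_mult_add_right)

lemma tl_mult_basis:
  assumes "D1 \<in> diagrams n" "D2 \<in> diagrams n"
  shows "tl_mult n (basis_elem D1) (basis_elem D2) =
    scale (2 ^ stack_loops n D1 D2) (basis_elem (stack_diagram n D1 D2))"
proof
  fix D
  let ?S = "{(D1, D2). D1 \<in> diagrams n \<and> D2 \<in> diagrams n \<and> stack_diagram n D1 D2 = D}"
  have fin: "finite ?S"
    by (rule finite_subset[of _ "diagrams n \<times> diagrams n"]) (use finite_diagrams in auto)
  have "tl_mult n (basis_elem D1) (basis_elem D2) D =
      (\<Sum>q\<in>?S. if q = (D1, D2) then 2 ^ stack_loops n D1 D2 else 0)"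
    unfolding tl_mult_def by (rule sum.cong[OF refl]) (simp add: basis_elem_def split: prod.split)
  also have "\<dots> = (if (D1, D2) \<in> ?S then 2 ^ stack_loops n D1 D2 else 0)"
    by (simp only: sum.delta[OF fin])
  finally show "tl_mult n (basis_elem D1) (basis_elem D2) D =
      scale (2 ^ stack_loops n D1 D2) (basis_elem (stack_diagram n D1 D2)) D"
    using assms by (simp add: scale_def basis_elem_def)
qed

lemma TL_zero [simp]: "0 \<in> TL n" and TL_add: "x \<in> TL n \<Longrightarrow> y \<in> TL n \<Longrightarrow> x + y \<in> TL n"
  and TL_diff: "x \<in> TL n \<Longrightarrow> y \<in> TL n \<Longrightarrow> x - y \<in> TL n" and TL_scale: "x \<in> TL n \<Longrightarrow> scale c x \<in> TL n"
  by (auto simp: TL_def scale_def fun_apply)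

lemma TL_sum: "(\<And>i. i \<in> A \<Longrightarrow> f i \<in> TL n) \<Longrightarrow> (\<Sum>i\<in>A. f i) \<in> TL n"
  by (induction A rule: infinite_finite_induct) (simp_all add: TL_add)

lemma basis_elem_TL_iff: "basis_elem D \<in> TL n \<longleftrightarrow> D \<in> diagrams n"
  by (auto simp: TL_def basis_elem_def)

lemma TL_expansion: "x \<in> TL n \<Longrightarrow> x = (\<Sum>D\<in>diagrams n. scale (x D) (basis_elem D))"
proof
  fix E assume x: "x \<in> TL n"
  have "(\<Sum>D\<in>diagrams n. scale (x D) (basis_elem D)) E = (\<Sum>D\<in>diagrams n. if D = E then x E else 0)"
    unfolding sum_fun_apply by (rule sum.cong[OF refl]) (simp add: scale_def basis_elem_def)
  also have "\<dots> = x E" using x finite_diagrams by (auto simp: TL_def)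
  finally show "x E = (\<Sum>D\<in>diagrams n. scale (x D) (basis_elem D)) E" by simp
qed

lemma GA_expansion: "x \<in> GA n \<Longrightarrow> x = (\<Sum>w | w permutes {1..n}. scale (x w) (basis_elem w))"
proof
  fix v assume x: "x \<in> GA n"
  have "(\<Sum>w | w permutes {1..n}. scale (x w) (basis_elem w)) v = (\<Sum>w | w permutes {1..n}. if w = v then x v else 0)"
    unfolding sum_fun_apply by (rule sum.cong[OF refl]) (simp add: scale_def basis_elem_def)
  also have "\<dots> = x v" using x finite_permutations[of "{1..n}"] by (auto simp: GA_def)
  finally show "x v = (\<Sum>w | w permutes {1..n}. scale (x w) (basis_elem w)) v" by simp
qed

lemma GA_basis [simp]: "w permutes {1..n} \<Longrightarrow> basis_elem w \<in> GA n"
  by (auto simp: GA_def basis_elem_def)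

lemma GA_add: "x \<in> GA n \<Longrightarrow> y \<in> GA n \<Longrightarrow> x + y \<in> GA n"
  and GA_scale: "x \<in> GA n \<Longrightarrow> scale c x \<in> GA n" and GA_zero: "0 \<in> GA n"
  by (auto simp: GA_def scale_def fun_apply)

lemma GA_sum: "(\<And>i. i \<in> A \<Longrightarrow> f i \<in> GA n) \<Longrightarrow> (\<Sum>i\<in>A. f i) \<in> GA n"
  by (induction A rule: infinite_finite_induct) (simp_all add: GA_add GA_zero)

lemma ga_mult_basis:
  assumes "v permutes {1..n}" "w permutes {1..n}"
  shows "ga_mult n (basis_elem v) (basis_elem w) = basis_elem (w \<circ> v)"
proof
  fix z
  let ?S = "{(v, w). v permutes {1..n} \<and> w permutes {1..n} \<and> w \<circ> v = z}"
  have fin: "finite ?S"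
    by (rule finite_subset[of _ "{v. v permutes {1..n}} \<times> {v. v permutes {1..n}}"])
      (auto intro!: finite_permutations)
  have "ga_mult n (basis_elem v) (basis_elem w) z = (\<Sum>q\<in>?S. if q = (v, w) then 1 else 0)"
    unfolding ga_mult_def by (rule sum.cong[OF refl]) (simp add: basis_elem_def split: prod.split)
  also have "\<dots> = (if (v, w) \<in> ?S then 1 else 0)"
    by (simp only: sum.delta[OF fin])
  finally show "ga_mult n (basis_elem v) (basis_elem w) z = basis_elem (w \<circ> v) z"
    using assms by (simp add: basis_elem_def)
qed

lemma GA_mult: "x \<in> GA n \<Longrightarrow> y \<in> GA n \<Longrightarrow> ga_mult n x y \<in> GA n"
  unfolding GA_def ga_mult_def by (auto intro!: sum.neutral dest: permutes_compose)

section \<open>The given homomorphism and its image\<close>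

locale tl_hom =
  fixes n :: nat and \<Phi> :: "ga \<Rightarrow> tl"
  assumes is_hom: "is_TL_hom n \<Phi>"
begin

lemma Phi_funcset: "\<Phi> \<in> GA n \<rightarrow> TL n"
  using is_hom unfolding is_TL_hom_def by (rule conjunct1)

lemma Phi_add: "x \<in> GA n \<Longrightarrow> y \<in> GA n \<Longrightarrow> \<Phi> (x + y) = \<Phi> x + \<Phi> y"
  using is_hom unfolding is_TL_hom_def by (elim conjE) (drule (1) bspec)+

lemma Phi_scale: "x \<in> GA n \<Longrightarrow> \<Phi> (scale c x) = scale c (\<Phi> x)"
  using is_hom unfolding is_TL_hom_def by (elim conjE) (drule spec, drule (1) bspec)

lemma Phi_mult: "x \<in> GA n \<Longrightarrow> y \<in> GA n \<Longrightarrow> \<Phi> (ga_mult n x y) = tl_mult n (\<Phi> x) (\<Phi> y)"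
  using is_hom unfolding is_TL_hom_def by (elim conjE) metis

lemma Phi_one: "\<Phi> (basis_elem id) = tl_one n"
  using is_hom unfolding is_TL_hom_def by (elim conjE) assumption

lemma Phi_s: "1 \<le> i \<Longrightarrow> i < n \<Longrightarrow> \<Phi> (basis_elem (transpose i (i + 1))) = tl_u n i - tl_one n"
  using is_hom unfolding is_TL_hom_def by (elim conjE) metis

lemma Phi_TL: "x \<in> GA n \<Longrightarrow> \<Phi> x \<in> TL n"
  using Phi_funcset by (rule funcset_mem)

lemma Phi_zero: "\<Phi> 0 = 0"
  using Phi_scale[OF GA_zero, of 0] by simp

lemma Phi_sum: "(\<And>i. i \<in> A \<Longrightarrow> f i \<in> GA n) \<Longrightarrow> \<Phi> (\<Sum>i\<in>A. f i) = (\<Sum>i\<in>A. \<Phi> (f i))"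
  by (induction A rule: infinite_finite_induct) (simp_all add: Phi_zero Phi_add GA_sum)

definition T :: "(nat \<Rightarrow> nat) \<Rightarrow> tl" where
  "T w = \<Phi> (basis_elem w)"

text \<open>Closure under \<open>tl_mult\<close> is evident for this set, whereas for
  \<open>TL n\<close> it would require that stacking preserves planarity. The two sets turn out to
  be equal.\<close>

definition generated :: "tl set" where
  "generated = \<Phi> ` GA n"

lemma image_add: "x \<in> generated \<Longrightarrow> y \<in> generated \<Longrightarrow> x + y \<in> generated"
  unfolding generated_def by (elim imageE) (simp only: Phi_add[symmetric] imageI GA_add)

lemma image_scale: "x \<in> generated \<Longrightarrow> scale c x \<in> generated"
  unfolding generated_def by (elim imageE) (simp only: Phi_scale[symmetric] imageI GA_scale)

lemma image_mult: "x \<in> generated \<Longrightarrow> y \<in> generated \<Longrightarrow> tl_mult n x y \<in> generated"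
  unfolding generated_def by (elim imageE) (simp only: Phi_mult[symmetric] imageI GA_mult)

lemma image_T: "w permutes {1..n} \<Longrightarrow> T w \<in> generated"
  by (simp add: generated_def T_def)

lemma T_id: "T id = tl_one n"
  by (simp add: T_def Phi_one)

lemma image_one: "tl_one n \<in> generated"
  using image_T[of id] T_id by simp

lemma transpose_permutes: "1 \<le> j \<Longrightarrow> j \<le> n \<Longrightarrow> 1 \<le> k \<Longrightarrow> k \<le> n \<Longrightarrow> transpose j k permutes {1..n}"
  by (intro permutes_swap_id) auto

lemma T_s: "1 \<le> i \<Longrightarrow> i < n \<Longrightarrow> T (transpose i (i + 1)) = tl_u n i - tl_one n"
  unfolding T_def by (rule Phi_s)

lemma image_u: "1 \<le> i \<Longrightarrow> i < n \<Longrightarrow> tl_u n i \<in> generated"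
  using image_add[OF image_T[OF transpose_permutes[of i "i + 1"]] image_one] T_s[of i] by simp

lemma image_TL: "x \<in> generated \<Longrightarrow> x \<in> TL n"
  by (auto simp: generated_def Phi_TL)

text \<open>Planarity of the generator is read off from the homomorphism: \<open>tl_u n i\<close> is
  the image of \<open>s_i\<close> plus the unit, hence lies in \<open>TL n\<close>.\<close>

lemma u_diagram_in: "1 \<le> i \<Longrightarrow> i < n \<Longrightarrow> u_diagram n i \<in> diagrams n"
  using image_TL[OF image_u] by (simp add: tl_u_eq basis_elem_TL_iff)

text \<open>Closed loops only contribute a power of 2, which is invertible over the
  rationals.\<close>

lemma image_stack:
  assumes "1 \<le> i" "i < n" "D' \<in> diagrams n" "stack_diagram n (u_diagram n i) D' = D" "basis_elem D' \<in> generated"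
  shows "basis_elem D \<in> generated"
proof -
  have "tl_mult n (tl_u n i) (basis_elem D') = scale (2 ^ stack_loops n (u_diagram n i) D') (basis_elem D)"
    using tl_mult_basis[OF u_diagram_in[OF assms(1,2)] assms(3)] assms(4) by (simp add: tl_u_eq)
  then have "scale (2 ^ stack_loops n (u_diagram n i) D') (basis_elem D) \<in> generated"
    using image_mult[OF image_u[OF assms(1,2)] assms(5)] by simp
  from image_scale[OF this, of "1 / 2 ^ stack_loops n (u_diagram n i) D'"] show ?thesis by simp
qed

text \<open>To the right of \<open>m\<close> vertical lines, a cup at the top slides to the left until it sits at
  \<open>m + 1\<close>; then exchanging it with the arc at the bottom point \<open>m + 1\<close> creates one more vertical
  line.  Each step undoes a multiplication by some \<open>u\<^sub>i\<close>.\<close>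

lemma basis_elem_image:
  assumes "m \<le> n" "D \<in> diagrams n" "\<And>k. 1 \<le> k \<Longrightarrow> k \<le> m \<Longrightarrow> {(Top, k), (Bot, k)} \<in> D"
  shows "basis_elem D \<in> generated"
  using assms
proof (induction "n - m" arbitrary: m D)
  case 0
  then have "D = (\<lambda>j. {(Top, j), (Bot, j)}) ` {1..n}" using all_vertical by simp
  then show ?case using image_one by (simp add: tl_one_def)
next
  case (Suc d)
  then have m: "m < n" by simp
  have IH: "basis_elem D \<in> generated"
    if "D \<in> diagrams n" "\<And>k. 1 \<le> k \<Longrightarrow> k \<le> m \<Longrightarrow> {(Top, k), (Bot, k)} \<in> D" "{(Top, m + 1), (Bot, m + 1)} \<in> D" for D
    using Suc.hyps(1)[of "m + 1" D] Suc.hyps(2) m that by (metis (no_types, lifting) Suc_eq_plus1 Suc_leI diff_Suc_Suc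
       Suc_diff_Suc diff_add_inverse2 le_SucE nat.inject)
  have cup: "basis_elem D \<in> generated"
    if "D \<in> diagrams n" "\<And>k. 1 \<le> k \<Longrightarrow> k \<le> m \<Longrightarrow> {(Top, k), (Bot, k)} \<in> D"
      "m < i" "i < n" "{(Top, i), (Top, i + 1)} \<in> D" for D i
    using that
  proof (induction i arbitrary: D)
    case (Suc i)
    have M: "matching (points n) D" using Suc.prems(1) by (simp add: diagrams_iff)
    show ?case
    proof (cases "i = m")
      case True
      have cup: "{(Top, m + 1), (Top, m + 1 + 1)} \<in> D" using Suc.prems(5) True by simp
      have m1: "m + 1 < n" using Suc.prems(4) True by simp
      have "(Bot, m + 1) \<in> points n" using m by (simp add: points_def)
      then obtain y where y: "{(Bot, m + 1), y} \<in> D" using matching_partner[OF M] by blast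
      define D' where "D' = D - {{(Top, m + 1), (Top, m + 1 + 1)}, {(Bot, m + 1), y}} \<union>
        {{(Top, m + 1), (Bot, m + 1)}, {(Top, m + 1 + 1), y}}"
      note D' = noncrossing_jump[OF Suc.prems(1) m1 Suc.prems(2) cup y D'_def]
      have "{(Top, k), (Bot, k)} \<in> D'" if k: "1 \<le> k" "k \<le> m" for k
      proof -
        have "{(Top, k), (Bot, k)} \<noteq> {(Bot, m + 1), y}"
          using k by (auto simp: doubleton_eq_iff)
        moreover have "{(Top, k), (Bot, k)} \<noteq> {(Top, m + 1), (Top, m + 1 + 1)}"
          using k by (auto simp: doubleton_eq_iff)
        ultimately show ?thesis using Suc.prems(2)[OF k] by (simp add: D'_def)
      qed
      moreover have "{(Top, m + 1), (Bot, m + 1)} \<in> D'" by (simp add: D'_def)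
      ultimately have "basis_elem D' \<in> generated" using IH D'(1) by blast
      then show ?thesis using image_stack[OF _ m1 D'] by simp
    next
      case False
      have cup: "{(Top, Suc i), (Top, Suc i + 1)} \<in> D" using Suc.prems(5) .
      have i: "2 \<le> Suc i" "m < i" "1 \<le> Suc i" "i < n" using False Suc.prems(3,4) by simp_all
      have "(Top, Suc i - 1) \<in> points n" using i by (simp add: points_def)
      then obtain y where y: "{(Top, Suc i - 1), y} \<in> D" using matching_partner[OF M] by blast
      define D' where "D' = D - {{(Top, Suc i), (Top, Suc i + 1)}, {(Top, Suc i - 1), y}} \<union>
        {{(Top, Suc i), (Top, Suc i - 1)}, {(Top, Suc i + 1), y}}"
      note D' = noncrossing_slide[OF Suc.prems(1) i(1) Suc.prems(4) cup y D'_def]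
      have "{(Top, k), (Bot, k)} \<in> D'" if k: "1 \<le> k" "k \<le> m" for k
      proof -
        have "{(Top, k), (Bot, k)} \<noteq> {(Top, Suc i - 1), y}"
          using k i by (auto simp: doubleton_eq_iff)
        moreover have "{(Top, k), (Bot, k)} \<noteq> {(Top, Suc i), (Top, Suc i + 1)}"
          using k by (auto simp: doubleton_eq_iff)
        ultimately show ?thesis using Suc.prems(2)[OF k] by (simp add: D'_def)
      qed
      moreover have "{(Top, i), (Top, i + 1)} \<in> D'" by (simp add: D'_def insert_commute)
      ultimately have "basis_elem D' \<in> generated" using Suc.IH D'(1) i by blast
      then show ?thesis using image_stack[OF i(3) Suc.prems(4) D'] by simp
    qed
  qed simp
  show ?case
  proof (cases "{(Top, m + 1), (Bot, m + 1)} \<in> D")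
    case False
    then show ?thesis using exists_cup[OF Suc.prems(2) m Suc.prems(3)] cup Suc.prems by blast
  qed (use IH Suc.prems in blast)
qed

lemma image_eq: "generated = TL n"
proof
  show "TL n \<subseteq> generated"
  proof
    fix x assume x: "x \<in> TL n"
    have zero: "0 \<in> generated" using image_scale[OF image_one, of 0] by simp
    have "(\<Sum>D\<in>A. scale (x D) (basis_elem D)) \<in> generated" if "A \<subseteq> diagrams n" for A
      using finite_subset[OF that finite_diagrams] that
      by (induction A rule: finite_induct)
        (simp_all add: zero image_add image_scale basis_elem_image[of 0])
    then show "x \<in> generated" using TL_expansion[OF x] by (metis order_refl)
  qed
qed (use image_TL in blast)

section \<open>Algebra laws transported from the group algebra\<close>

lemma T_TL: "w permutes {1..n} \<Longrightarrow> T w \<in> TL n"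
  using image_T image_eq by simp

lemma T_mult: "v permutes {1..n} \<Longrightarrow> w permutes {1..n} \<Longrightarrow> tl_mult n (T v) (T w) = T (w \<circ> v)"
  using Phi_mult[of "basis_elem v" "basis_elem w"] by (simp add: T_def ga_mult_basis)

lemma TL_T_expansion:
  assumes "x \<in> TL n"
  obtains a where "x = (\<Sum>w | w permutes {1..n}. scale (a w) (T w))"
proof -
  obtain y where y: "y \<in> GA n" "x = \<Phi> y" using assms by (auto simp: image_eq[symmetric] generated_def)
  have "x = \<Phi> (\<Sum>w | w permutes {1..n}. scale (y w) (basis_elem w))" using y GA_expansion by metis
  also have "\<dots> = (\<Sum>w | w permutes {1..n}. scale (y w) (T w))"
    by (subst Phi_sum) (simp_all add: GA_scale Phi_scale T_def)
  finally show ?thesis by (rule that)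
qed

lemma TL_mult: "x \<in> TL n \<Longrightarrow> y \<in> TL n \<Longrightarrow> tl_mult n x y \<in> TL n"
  using image_mult image_eq by simp

lemma tl_mult_one_left: "x \<in> TL n \<Longrightarrow> tl_mult n (tl_one n) x = x"
proof -
  assume "x \<in> TL n"
  then obtain a where "x = (\<Sum>w | w permutes {1..n}. scale (a w) (T w))" by (rule TL_T_expansion)
  moreover have "tl_mult n (T id) (T w) = T w" if "w permutes {1..n}" for w
    using T_mult[OF permutes_id that] by simp
  ultimately show ?thesis by (simp add: T_id[symmetric] tl_mult_sum_right)
qed

lemma tl_mult_one_right: "x \<in> TL n \<Longrightarrow> tl_mult n x (tl_one n) = x"
proof -
  assume "x \<in> TL n"
  then obtain a where "x = (\<Sum>w | w permutes {1..n}. scale (a w) (T w))" by (rule TL_T_expansion)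
  moreover have "tl_mult n (T w) (T id) = T w" if "w permutes {1..n}" for w
    using T_mult[OF that permutes_id] by simp
  ultimately show ?thesis by (simp add: T_id[symmetric] tl_mult_sum_left)
qed

text \<open>Trilinearity reduces the law to images of permutations, where it is associativity of
  composition.\<close>

lemma tl_mult_assoc:
  assumes "x \<in> TL n" "y \<in> TL n" "z \<in> TL n"
  shows "tl_mult n (tl_mult n x y) z = tl_mult n x (tl_mult n y z)"
proof -
  obtain a where a: "x = (\<Sum>w | w permutes {1..n}. scale (a w) (T w))" using TL_T_expansion[OF assms(1)] .
  obtain b where b: "y = (\<Sum>w | w permutes {1..n}. scale (b w) (T w))" using TL_T_expansion[OF assms(2)] .
  obtain c where c: "z = (\<Sum>w | w permutes {1..n}. scale (c w) (T w))" using TL_T_expansion[OF assms(3)] .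
  have TTT: "tl_mult n (tl_mult n (T u) (T v)) (T w) = tl_mult n (T u) (tl_mult n (T v) (T w))"
    if "u permutes {1..n}" "v permutes {1..n}" "w permutes {1..n}" for u v w
    using that by (simp add: T_mult permutes_compose comp_assoc)
  have TTz: "tl_mult n (tl_mult n (T u) (T v)) z = tl_mult n (T u) (tl_mult n (T v) z)"
    if "u permutes {1..n}" "v permutes {1..n}" for u v
    using that unfolding c by (simp add: tl_mult_sum_right TTT)
  have Tyz: "tl_mult n (tl_mult n (T u) y) z = tl_mult n (T u) (tl_mult n y z)"
    if "u permutes {1..n}" for u
    using that unfolding b by (simp add: tl_mult_sum_right tl_mult_sum_left TTz)
  show ?thesis unfolding a by (simp add: tl_mult_sum_left Tyz)
qed

end

section \<open>Jucys--Murphy elements\<close>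

lemma comp_transpose: "inj f \<Longrightarrow> f \<circ> transpose a b = transpose (f a) (f b) \<circ> f"
  by (rule ext) (auto simp: transpose_def dest: injD)

context tl_hom begin

text \<open>Stacking twice gives a power of 2 times one diagram once the intermediate diagram is
  known to be planar; this holds because it occurs with a nonzero coefficient in an element of
  \<open>TL n\<close>.\<close>

lemma u_products:
  assumes "1 \<le> i" "i < n" "1 \<le> j" "j < n" "1 \<le> k" "k < n"
  shows "\<exists>D l. tl_mult n (tl_mult n (tl_u n i) (tl_u n j)) (tl_u n k) = scale (2 ^ l) (basis_elem D)"
proof -
  let ?E = "stack_diagram n (u_diagram n i) (u_diagram n j)" and ?l = "stack_loops n (u_diagram n i) (u_diagram n j)"
  have 1: "tl_mult n (tl_u n i) (tl_u n j) = scale (2 ^ ?l) (basis_elem ?E)"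
    using tl_mult_basis u_diagram_in assms by (simp add: tl_u_eq)
  have "tl_mult n (tl_u n i) (tl_u n j) \<in> TL n" using image_u image_eq TL_mult assms by simp
  from TL_scale[OF this, of "1 / 2 ^ ?l"] have "?E \<in> diagrams n"
    unfolding 1 by (simp add: basis_elem_TL_iff)
  then have "tl_mult n (basis_elem ?E) (tl_u n k) = scale (2 ^ stack_loops n ?E (u_diagram n k)) (basis_elem (stack_diagram n ?E (u_diagram n k)))"
    using tl_mult_basis u_diagram_in assms by (simp add: tl_u_eq)
  then have "tl_mult n (tl_mult n (tl_u n i) (tl_u n j)) (tl_u n k) =
      scale (2 ^ (?l + stack_loops n ?E (u_diagram n k))) (basis_elem (stack_diagram n ?E (u_diagram n k)))"
    unfolding 1 by (simp add: power_add)
  then show ?thesis by blast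
qed

lemma u_diagram_1_2: "u_diagram n 1 \<noteq> u_diagram n 2"
proof
  assume *: "u_diagram n 1 = u_diagram n 2"
  have "{(Top, 1), (Top, 2)} \<in> u_diagram n 1" by (auto simp: u_diagram_def)
  then have "{(Top, 1), (Top, 2)} \<in> u_diagram n 2" unfolding * .
  then show False by (auto simp: u_diagram_def doubleton_eq_iff)
qed

lemma transpose_comp_self: "transpose a b \<circ> transpose a b = id"
  by (rule ext) simp

text \<open>Since \<open>\<Phi>\<close> respects the braid relation, \<open>u\<^sub>1u\<^sub>2u\<^sub>1 - u\<^sub>1 = u\<^sub>2u\<^sub>1u\<^sub>2 - u\<^sub>2\<close>.  Both
  triple products are multiples of single diagrams by powers of 2, so both sides vanish.\<close>

lemma symmetrizer_123:
  assumes n: "3 \<le> n"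
  shows "T id + T (transpose 1 2) + T (transpose 1 3) + T (transpose 2 3) +
    T (transpose 1 2 \<circ> transpose 1 3) + T (transpose 1 3 \<circ> transpose 1 2) = 0"
proof -
  define u v o' where "u = tl_u n 1" and "v = tl_u n 2" and "o' = tl_one n"
  note [simp] = tl_mult_add_left tl_mult_add_right tl_mult_diff_left tl_mult_diff_right
  have TLs: "u \<in> TL n" "v \<in> TL n" "o' \<in> TL n"
    using image_u[of 1] image_u[of 2] image_one image_eq n by (auto simp: u_def v_def o'_def)
  have one: "tl_mult n o' x = x" "tl_mult n x o' = x" if "x \<in> TL n" for x
    using that tl_mult_one_left tl_mult_one_right by (simp_all add: o'_def)
  have T1: "T (transpose 1 2) = u - o'" and T2: "T (transpose 2 3) = v - o'"
    using T_s[of 1] T_s[of 2] n by (simp_all add: u_def v_def o'_def numeral_2_eq_2 numeral_3_eq_3)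
  have p: "transpose 1 2 permutes {1..n}" "transpose 2 3 permutes {1..n}" "transpose 1 3 permutes {1..n}"
    using n by (intro transpose_permutes; simp)+
  have T_id': "T id = o'" by (simp add: T_id o'_def)
  \<comment> \<open>The relation \<open>u^2 = 2 u\<close> is obtained from \<open>s_i^2 = 1\<close>
    instead of counting loops.\<close>
  have "tl_mult n (u - o') (u - o') = o'" "tl_mult n (v - o') (v - o') = o'"
    using T_mult[OF p(1) p(1)] T_mult[OF p(2) p(2)] unfolding T1 T2 transpose_comp_self T_id' by simp_all
  then have uu: "tl_mult n u u = scale 2 u" and vv: "tl_mult n v v = scale 2 v"
    using one TLs by (simp_all add: fun_eq_iff fun_apply scale_def algebra_simps)
  have comps: "transpose 1 3 = transpose 1 2 \<circ> transpose 2 3 \<circ> transpose 1 (2::nat)"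
    "transpose 1 3 = transpose 2 3 \<circ> transpose 1 2 \<circ> transpose 2 (3::nat)"
    "transpose 1 2 \<circ> transpose 1 3 = transpose 2 3 \<circ> transpose 1 (2::nat)"
    "transpose 1 3 \<circ> transpose 1 2 = transpose 1 2 \<circ> transpose 2 (3::nat)"
    by (rule ext; simp add: transpose_def)+
  have T13: "T (transpose 1 3) = tl_mult n (tl_mult n (u - o') (v - o')) (u - o')"
    unfolding comps(1) T1[symmetric] T2[symmetric] using p by (simp add: T_mult permutes_compose comp_assoc)
  have T13': "T (transpose 1 3) = tl_mult n (tl_mult n (v - o') (u - o')) (v - o')"
    unfolding comps(2) T1[symmetric] T2[symmetric] using p by (simp add: T_mult permutes_compose comp_assoc)
  have Tc: "T (transpose 1 2 \<circ> transpose 1 3) = tl_mult n (u - o') (v - o')"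
    "T (transpose 1 3 \<circ> transpose 1 2) = tl_mult n (v - o') (u - o')"
    unfolding comps(3,4) T1[symmetric] T2[symmetric] using p by (simp_all add: T_mult)
  obtain D k where uvu: "tl_mult n (tl_mult n u v) u = scale (2 ^ k) (basis_elem D)"
    using u_products[of 1 2 1] n unfolding u_def v_def by auto
  obtain D' l where vuv: "tl_mult n (tl_mult n v u) v = scale (2 ^ l) (basis_elem D')"
    using u_products[of 2 1 2] n unfolding u_def v_def by auto
  have TL2: "tl_mult n u v \<in> TL n" "tl_mult n v u \<in> TL n" using TL_mult TLs by simp_all
  have "scale (2 ^ k) (basis_elem D) + v = scale (2 ^ l) (basis_elem D') + u"
    using T13 T13' one TLs TL2 uu vv by (simp add: uvu vuv fun_eq_iff fun_apply scale_def algebra_simps)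
  then have eq: "2 ^ k * basis_elem D E + v E = 2 ^ l * basis_elem D' E + u E" for E
    by (simp add: fun_eq_iff fun_apply scale_def)
  have uE: "u E = (if E = u_diagram n 1 then 1 else 0)" "v E = (if E = u_diagram n 2 then 1 else 0)" for E
    by (simp_all add: u_def v_def tl_u_eq basis_elem_def)
  have "(0::rat) < 2 ^ k + 1" "(0::rat) < 2 ^ l + 1" by (simp_all add: pos_add_strict)
  then have pow: "(2::rat) ^ k + 1 \<noteq> 0" "(2::rat) ^ l + 1 \<noteq> 0" by simp_all
  \<comment> \<open>At \<open>u_diagram n 1\<close> the right side of \<open>eq\<close> is positive,
    so \<open>D\<close> must be that diagram; at \<open>u_diagram n 2\<close> the left side is
    positive, so \<open>D'\<close> is the other one. A second comparison gives
    \<open>2 ^ k = 1\<close>.\<close>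
  have D: "D = u_diagram n 1"
    using eq[of "u_diagram n 1"] u_diagram_1_2 pow by (auto simp: uE basis_elem_def split: if_splits)
  have D': "D' = u_diagram n 2"
    using eq[of "u_diagram n 2"] u_diagram_1_2 pow by (auto simp: uE basis_elem_def split: if_splits)
  have "(2::rat) ^ k = 1" using eq[of "u_diagram n 1"] u_diagram_1_2 D D' by (simp add: uE basis_elem_def)
  then have uvu': "tl_mult n (tl_mult n u v) u = u" using uvu D by (simp add: u_def tl_u_eq)
  show ?thesis unfolding Tc T_id' T13 T1 T2 using TLs TL2
    by (simp add: one uu uvu' fun_eq_iff fun_apply scale_def algebra_simps)
qed

text \<open>Conjugation with a permutation \<open>w\<close> that takes 1, 2, 3 to \<open>a\<close>,
  \<open>b\<close>, \<open>c\<close>.\<close>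

lemma symmetrizer:
  assumes abc: "a \<in> {1..n}" "b \<in> {1..n}" "c \<in> {1..n}" "a \<noteq> b" "a \<noteq> c" "b \<noteq> c"
  shows "T id + T (transpose a b) + T (transpose a c) + T (transpose b c) +
    T (transpose a b \<circ> transpose a c) + T (transpose a c \<circ> transpose a b) = 0"
proof -
  have n: "3 \<le> n"
  proof -
    have "card {a, b, c} \<le> card {1..n}" using abc by (intro card_mono) auto
    then show ?thesis using abc by simp
  qed
  \<comment> \<open>\<open>b'\<close> and \<open>c'\<close> are \<open>b\<close> and
    \<open>c\<close> after undoing the outer transpositions, so each factor of \<open>w\<close> puts
    one value into place without moving the others.\<close>
  define b' where "b' = transpose 1 a b"
  define c' where "c' = transpose 2 b' (transpose 1 a c)"
  define w where "w = transpose 1 a \<circ> transpose 2 b' \<circ> transpose 3 c'"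
  have b': "b' \<in> {1..n}" "b' \<noteq> 1" using abc by (auto simp: b'_def transpose_def)
  have c': "c' \<in> {1..n}" "c' \<noteq> 1" "c' \<noteq> 2" using abc b' n by (auto simp: c'_def b'_def transpose_def)
  have w: "w permutes {1..n}" unfolding w_def
    using abc b' c' n by (intro permutes_compose transpose_permutes) auto
  have w123: "w 1 = a" "w 2 = b" "w 3 = c"
    using abc b' c' by (simp_all add: w_def) (simp_all add: b'_def c'_def)
  have inv: "inv w permutes {1..n}" using permutes_inv[OF w] .
  have conj: "w \<circ> (transpose j k \<circ> inv w) = transpose (w j) (w k)" for j k
    using comp_transpose[OF permutes_inj[OF w], of j k] permutes_inv_o(1)[OF w]
    by (metis comp_assoc comp_id)
  have conj2: "w \<circ> ((transpose i j \<circ> transpose k l) \<circ> inv w) = transpose (w i) (w j) \<circ> transpose (w k) (w l)" for i j k l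
    unfolding conj[symmetric] using permutes_inv_o(2)[OF w] by (metis comp_assoc comp_id)
  have p: "transpose j k permutes {1..n}" if "j \<in> {1,2,3}" "k \<in> {1,2,3}" for j k :: nat
    using n that by (intro transpose_permutes) auto
  have "tl_mult n (T (inv w)) (tl_mult n (T id + T (transpose 1 2) + T (transpose 1 3) + T (transpose 2 3) +
    T (transpose 1 2 \<circ> transpose 1 3) + T (transpose 1 3 \<circ> transpose 1 2)) (T w)) = 0"
    unfolding symmetrizer_123[OF n] by simp
  then have "T (w \<circ> inv w) + T (w \<circ> (transpose 1 2 \<circ> inv w)) + T (w \<circ> (transpose 1 3 \<circ> inv w)) + T (w \<circ> (transpose 2 3 \<circ> inv w)) +
    T (w \<circ> ((transpose 1 2 \<circ> transpose 1 3) \<circ> inv w)) + T (w \<circ> ((transpose 1 3 \<circ> transpose 1 2) \<circ> inv w)) = 0"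
    using w inv p by (simp add: tl_mult_add_left tl_mult_add_right T_mult permutes_compose comp_assoc)
  then show ?thesis unfolding conj conj2 w123 permutes_inv_o(1)[OF w] .
qed

section \<open>Jucys--Murphy elements as operators\<close>

definition act_by :: "(nat \<Rightarrow> nat) \<Rightarrow> tl \<Rightarrow> tl" where
  "act_by w x = tl_mult n (T w) x"

text \<open>Left multiplication by the image of \<open>L_i\<close>, kept as a sum over
  transpositions; \<open>Phi_jucys_murphy\<close> identifies the two.\<close>

definition JM :: "nat \<Rightarrow> tl \<Rightarrow> tl" where
  "JM i x = (\<Sum>j\<in>{1..<i}. act_by (transpose j i) x)"

lemma act_by_linear:
  "act_by w (x + y) = act_by w x + act_by w y" "act_by w (x - y) = act_by w x - act_by w y"
  "act_by w (scale c x) = scale c (act_by w x)" "act_by w (\<Sum>i\<in>A. f i) = (\<Sum>i\<in>A. act_by w (f i))" "act_by w 0 = 0"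
  by (simp_all add: act_by_def tl_mult_add_right tl_mult_diff_right tl_mult_sum_right)

lemma act_by_TL: "w permutes {1..n} \<Longrightarrow> x \<in> TL n \<Longrightarrow> act_by w x \<in> TL n"
  by (simp add: act_by_def TL_mult T_TL)

text \<open>The order of composition is reversed because permutations multiply as right
  operators.\<close>

lemma act_by_act_by: "v permutes {1..n} \<Longrightarrow> w permutes {1..n} \<Longrightarrow> x \<in> TL n \<Longrightarrow> act_by v (act_by w x) = act_by (w \<circ> v) x"
  by (simp add: act_by_def tl_mult_assoc[symmetric] T_TL T_mult)

lemma act_by_id: "x \<in> TL n \<Longrightarrow> act_by id x = x"
  by (simp add: act_by_def T_id tl_mult_one_left)

lemma JM_linear:
  "JM i (x + y) = JM i x + JM i y" "JM i (x - y) = JM i x - JM i y"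
  "JM i (scale c x) = scale c (JM i x)" "JM i (\<Sum>j\<in>A. f j) = (\<Sum>j\<in>A. JM i (f j))" "JM i 0 = 0"
  by (simp_all add: JM_def act_by_linear sum.distrib sum_subtractf scale_sum) (rule sum.swap)

lemma JM_TL: "i \<le> n \<Longrightarrow> x \<in> TL n \<Longrightarrow> JM i x \<in> TL n"
  unfolding JM_def by (intro TL_sum act_by_TL transpose_permutes) auto

lemma Phi_jucys_murphy: "i \<le> n \<Longrightarrow> tl_mult n (\<Phi> (jucys_murphy i)) x = JM i x"
proof -
  assume i: "i \<le> n"
  have "basis_elem (transpose j i) \<in> GA n" if "j \<in> {1..<i}" for j
    using that i by (intro GA_basis transpose_permutes) auto
  then show ?thesis unfolding jucys_murphy_def JM_def act_by_def T_def tl_mult_sum_left[symmetric]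
    by (subst Phi_sum) simp_all
qed

text \<open>The transposition fixes \<open>i\<close> and maps \<open>{1..<i}\<close> to itself, so
  conjugation only permutes the summands of \<open>L_i\<close>.\<close>

lemma act_by_JM_commute:
  assumes kl: "1 \<le> k" "k < l" "l \<le> n" and i: "i \<le> n" "l < i \<or> i < k" and x: "x \<in> TL n"
  shows "act_by (transpose k l) (JM i x) = JM i (act_by (transpose k l) x)"
proof -
  have p: "transpose k l permutes {1..n}" using kl by (intro transpose_permutes) auto
  have pj: "transpose j i permutes {1..n}" if "j \<in> {1..<i}" for j using that i by (intro transpose_permutes) auto
  have ti: "transpose k l i = i" using i kl by auto
  have conj: "transpose k l \<circ> transpose j i = transpose (transpose k l j) i \<circ> transpose k l" for j
    using comp_transpose[of "transpose k l" j i] ti by simp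
  have bij: "bij_betw (transpose k l) {1..<i} {1..<i}"
  proof (rule bij_betw_byWitness[where f' = "transpose k l"])
    show "transpose k l ` {1..<i} \<subseteq> {1..<i}" using i kl by (auto simp: transpose_def)
    then show "transpose k l ` {1..<i} \<subseteq> {1..<i}" .
  qed simp_all
  have "act_by (transpose k l) (JM i x) = (\<Sum>j\<in>{1..<i}. act_by (transpose j i \<circ> transpose k l) x)"
    unfolding JM_def act_by_linear by (intro sum.cong refl act_by_act_by p pj x)
  also have "\<dots> = (\<Sum>j\<in>{1..<i}. act_by (transpose (transpose k l j) i \<circ> transpose k l) x)"
    by (rule sum.reindex_bij_betw[OF bij, symmetric])
  also have "\<dots> = JM i (act_by (transpose k l) x)"
    unfolding JM_def conj[symmetric] by (intro sum.cong refl act_by_act_by[symmetric] p pj x)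
  finally show ?thesis .
qed

text \<open>The degenerate Hecke relation. Conjugation by \<open>s_k\<close> turns the summands of
  \<open>L_k\<close> into those of \<open>L_(k+1)\<close> except \<open>s_k\<close> itself, and this
  one contributes the extra \<open>x\<close>.\<close>

lemma act_by_JM:
  assumes k: "1 \<le> k" "k < n" and x: "x \<in> TL n"
  shows "act_by (transpose k (k + 1)) (JM k x) = JM (k + 1) (act_by (transpose k (k + 1)) x) - x"
proof -
  let ?s = "transpose k (k + 1)"
  have p: "?s permutes {1..n}" using k by (intro transpose_permutes) auto
  have pj: "transpose j k permutes {1..n}" "transpose j (k + 1) permutes {1..n}" if "j \<in> {1..<k}" for j
    using that k by (intro transpose_permutes; auto)+
  have "JM (k + 1) (act_by ?s x) = (\<Sum>j\<in>{1..<k}. act_by (transpose j (k + 1)) (act_by ?s x)) + act_by ?s (act_by ?s x)"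
    unfolding JM_def using k by (simp add: atLeastLessThanSuc)
  also have "act_by ?s (act_by ?s x) = x" using p x by (simp add: act_by_act_by act_by_id transpose_comp_self)
  also have "(\<Sum>j\<in>{1..<k}. act_by (transpose j (k + 1)) (act_by ?s x)) = act_by ?s (JM k x)"
    unfolding JM_def act_by_linear
  proof (rule sum.cong)
    fix j assume j: "j \<in> {1..<k}"
    have "?s \<circ> transpose j (k + 1) = transpose j k \<circ> ?s"
      using comp_transpose[of ?s j "k + 1"] j by simp
    then show "act_by (transpose j (k + 1)) (act_by ?s x) = act_by ?s (act_by (transpose j k) x)"
      using p pj[OF j] x by (simp add: act_by_act_by)
  qed simp
  finally show ?thesis by simp
qed

lemma act_by_JM_Suc:
  assumes k: "1 \<le> k" "k < n" and x: "x \<in> TL n"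
  shows "act_by (transpose k (k + 1)) (JM (k + 1) x) = JM k (act_by (transpose k (k + 1)) x) + x"
proof -
  let ?s = "transpose k (k + 1)"
  have p: "?s permutes {1..n}" using k by (intro transpose_permutes) auto
  have ss: "act_by ?s (act_by ?s y) = y" if "y \<in> TL n" for y
    using p that by (simp add: act_by_act_by act_by_id transpose_comp_self)
  have sx: "act_by ?s x \<in> TL n" using act_by_TL p x by simp
  have "act_by ?s (act_by ?s (JM k (act_by ?s x))) = act_by ?s (JM (k + 1) x - act_by ?s x)"
    using act_by_JM[OF k sx] ss[OF x] by simp
  then show ?thesis using ss JM_TL sx x k by (simp add: act_by_linear)
qed

lemma JM_commute:
  assumes "i \<le> n" "k \<le> n" "x \<in> TL n"
  shows "JM i (JM k x) = JM k (JM i x)"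
proof -
  have "JM i (JM k x) = JM k (JM i x)" if "k < i" "i \<le> n" for i k
  proof -
    have "JM i (JM k x) = (\<Sum>j\<in>{1..<k}. JM i (act_by (transpose j k) x))"
      by (simp only: JM_def[of k] JM_linear)
    also have "\<dots> = (\<Sum>j\<in>{1..<k}. act_by (transpose j k) (JM i x))"
      by (rule sum.cong) (use that assms(3) in \<open>auto simp: act_by_JM_commute\<close>)
    finally show ?thesis by (simp add: JM_def[of k])
  qed
  then show ?thesis using assms by (metis linorder_neqE_nat)
qed

text \<open>Among all ordered pairs the diagonal gives \<open>m\<close> identities, and every
  transposition of \<open>{1..m}\<close> occurs twice.\<close>

lemma sum_act_by_transpose:
  assumes "x \<in> TL n"
  shows "(\<Sum>j\<in>{1..m}. \<Sum>k\<in>{1..m}. act_by (transpose j k) x) = scale (of_nat m) x + scale 2 (\<Sum>i\<in>{1..m}. JM i x)"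
proof (induction m)
  case (Suc m)
  have JM: "(\<Sum>j\<in>{1..m}. act_by (transpose j (Suc m)) x) = JM (Suc m) x"
    by (simp add: JM_def atLeastLessThanSuc_atLeastAtMost)
  have JM': "(\<Sum>k\<in>{1..m}. act_by (transpose (Suc m) k) x) = JM (Suc m) x"
    unfolding JM[symmetric] by (simp add: transpose_commute)
  have step: "(\<Sum>j\<in>{1..Suc m}. \<Sum>k\<in>{1..Suc m}. act_by (transpose j k) x) =
     (\<Sum>j\<in>{1..m}. \<Sum>k\<in>{1..m}. act_by (transpose j k) x) + JM (Suc m) x + (JM (Suc m) x + x)"
    using JM JM' by (simp add: sum.distrib act_by_id assms)
  have "(\<Sum>i\<in>{1..Suc m}. JM i x) = (\<Sum>i\<in>{1..m}. JM i x) + JM (Suc m) x" by simp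
  then show ?case
    by (simp only: step Suc.IH) (simp add: fun_eq_iff fun_apply scale_def algebra_simps)
qed simp

text \<open>In the square of \<open>L_(m+1)\<close> the terms for \<open>(j, k)\<close> and
  \<open>(k, j)\<close> are the two 3-cycles on \<open>j\<close>, \<open>k\<close>,
  \<open>m + 1\<close>. The symmetrizer replaces their sum by transpositions, and summed over all
  pairs these give Jucys--Murphy elements again.\<close>

lemma JM_quadratic:
  assumes m: "m + 1 \<le> n" and x: "x \<in> TL n"
  shows "JM (m + 1) (JM (m + 1) x) = scale (1 - of_nat m) (JM (m + 1) x) - (\<Sum>i\<in>{1..m}. JM i x)
    - scale (of_nat m * (of_nat m - 3) / 2) x"
proof -
  let ?M = "m + 1"
  have p: "transpose j k permutes {1..n}" if "j \<in> {1..?M}" "k \<in> {1..?M}" for j k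
    using that m by (intro transpose_permutes) auto
  define F where "F j k = act_by (transpose k ?M \<circ> transpose j ?M) x" for j k
  define H where "H j k = x + act_by (transpose j k) x + act_by (transpose j ?M) x + act_by (transpose k ?M) x" for j k
  have JM: "JM ?M y = (\<Sum>j\<in>{1..m}. act_by (transpose j ?M) y)" for y
    by (simp add: JM_def atLeastLessThanSuc_atLeastAtMost)
  \<comment> \<open>For \<open>j = k\<close> the product is the identity. The correction term there
    allows the uniform expression \<open>H\<close> to be summed over the whole square.\<close>
  have FF: "F j k + F k j = (if j = k then scale 4 x + scale 2 (act_by (transpose j ?M) x) else 0) - H j k"
    if jk: "j \<in> {1..m}" "k \<in> {1..m}" for j k
  proof (cases "j = k")
    case True
    have "transpose k ?M \<circ> transpose k ?M = id" by (rule transpose_comp_self)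
    then show ?thesis using True x
      by (simp add: F_def H_def act_by_id[unfolded id_def] act_by_id fun_eq_iff fun_apply scale_def)
  next
    case False
    have "T id + T (transpose ?M j) + T (transpose ?M k) + T (transpose j k) +
      T (transpose ?M j \<circ> transpose ?M k) + T (transpose ?M k \<circ> transpose ?M j) = 0"
      using jk False m by (intro symmetrizer) auto
    then have "tl_mult n (T id + T (transpose ?M j) + T (transpose ?M k) + T (transpose j k) +
      T (transpose ?M j \<circ> transpose ?M k) + T (transpose ?M k \<circ> transpose ?M j)) x = 0" by simp
    then have "x + act_by (transpose j ?M) x + act_by (transpose k ?M) x + act_by (transpose j k) x + F k j + F j k = 0"
      using act_by_id[OF x] by (simp add: tl_mult_add_left act_by_def F_def transpose_commute)
    then have "F j k + F k j + H j k = 0" by (simp add: H_def ac_simps)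
    then show ?thesis using False by (simp add: eq_neg_iff_add_eq_0)
  qed
  have "JM ?M (JM ?M x) = (\<Sum>j\<in>{1..m}. \<Sum>k\<in>{1..m}. F j k)"
    unfolding JM act_by_linear F_def using x by (intro sum.cong refl act_by_act_by p) auto
  then have "JM ?M (JM ?M x) + JM ?M (JM ?M x) = (\<Sum>j\<in>{1..m}. \<Sum>k\<in>{1..m}. F j k) + (\<Sum>j\<in>{1..m}. \<Sum>k\<in>{1..m}. F k j)"
    using sum.swap[of F "{1..m}" "{1..m}"] by simp
  also have "\<dots> = (\<Sum>j\<in>{1..m}. \<Sum>k\<in>{1..m}. (if j = k then scale 4 x + scale 2 (act_by (transpose j ?M) x) else 0) - H j k)"
    unfolding sum.distrib[symmetric] by (intro sum.cong refl FF)
  also have "\<dots> = (\<Sum>j\<in>{1..m}. scale 4 x + scale 2 (act_by (transpose j ?M) x)) - (\<Sum>j\<in>{1..m}. \<Sum>k\<in>{1..m}. H j k)"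
    by (simp add: sum_subtractf)
  also have "(\<Sum>j\<in>{1..m}. scale 4 x + scale 2 (act_by (transpose j ?M) x)) = scale (4 * of_nat m) x + scale 2 (JM ?M x)"
    unfolding JM by (simp add: sum.distrib scale_sum fun_eq_iff fun_apply sum_fun_apply scale_def sum_distrib_left)
  also have "(\<Sum>j\<in>{1..m}. \<Sum>k\<in>{1..m}. H j k) = scale (of_nat m * of_nat m) x
      + (scale (of_nat m) x + scale 2 (\<Sum>i\<in>{1..m}. JM i x)) + scale (of_nat m) (JM ?M x) + scale (of_nat m) (JM ?M x)"
    unfolding H_def sum.distrib sum_act_by_transpose[OF x] JM
    by (simp add: fun_eq_iff fun_apply sum_fun_apply scale_def sum_distrib_left)
  finally have eq: "JM ?M (JM ?M x) + JM ?M (JM ?M x) =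
    scale (4 * of_nat m) x + scale 2 (JM ?M x) - (scale (of_nat m * of_nat m) x
      + (scale (of_nat m) x + scale 2 (\<Sum>i\<in>{1..m}. JM i x)) + scale (of_nat m) (JM ?M x) + scale (of_nat m) (JM ?M x))" .
  show ?thesis
  proof
    fix E
    show "JM ?M (JM ?M x) E = (scale (1 - of_nat m) (JM ?M x) - (\<Sum>i\<in>{1..m}. JM i x)
      - scale (of_nat m * (of_nat m - 3) / 2) x) E"
      using fun_cong[OF eq, of E] by (simp add: fun_apply scale_def field_simps)
  qed
qed

end

section \<open>Two-column tableaux as words\<close>

primrec count_upto :: "(nat \<Rightarrow> bool) \<Rightarrow> nat \<Rightarrow> nat" where
  "count_upto w 0 = 0"
| "count_upto w (Suc m) = count_upto w m + (if w (Suc m) then 1 else 0)"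

text \<open>A two-column tableau is a word \<open>w\<close>, where \<open>w i\<close> says that \<open>i\<close> lies in the first column.\<close>

abbreviation col1 :: "(nat \<Rightarrow> bool) \<Rightarrow> nat \<Rightarrow> nat" where
  "col1 w \<equiv> count_upto w"

abbreviation col2 :: "(nat \<Rightarrow> bool) \<Rightarrow> nat \<Rightarrow> nat" where
  "col2 w \<equiv> count_upto (\<lambda>i. \<not> w i)"

definition admissible :: "(nat \<Rightarrow> bool) \<Rightarrow> nat \<Rightarrow> bool" where
  "admissible w m \<longleftrightarrow> (\<forall>k\<le>m. col2 w k \<le> col1 w k)"

text \<open>The row of \<open>i\<close> is one more than the number of earlier entries in its
  column, so the content is 1 or 2 minus that row.\<close>

definition word_content :: "(nat \<Rightarrow> bool) \<Rightarrow> nat \<Rightarrow> int" where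
  "word_content w i = (if w i then - int (col1 w (i - 1)) else 1 - int (col2 w (i - 1)))"

text \<open>Defined for every word, not only for admissible ones; standardness thereby becomes a
  property of words (\<open>tab_StdPar2_iff\<close>).\<close>

definition tab :: "nat \<Rightarrow> (nat \<Rightarrow> bool) \<Rightarrow> tableau" where
  "tab n w = (\<lambda>i\<in>{1..n}. if w i then (col1 w i, 1) else (col2 w i, 2))"

definition word :: "tableau \<Rightarrow> nat \<Rightarrow> bool" where
  "word t i \<longleftrightarrow> column t i = 1"

lemma col1_col2: "col1 w m + col2 w m = m"
  by (induction m) auto

lemma count_upto_cong: "(\<And>i. 1 \<le> i \<Longrightarrow> i \<le> m \<Longrightarrow> w i = w' i) \<Longrightarrow> count_upto w m = count_upto w' m"
  by (induction m) auto

lemma count_upto_mono: "j \<le> k \<Longrightarrow> count_upto w j \<le> count_upto w k"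
  by (induction k) (auto simp: le_Suc_eq)

lemma count_upto_less: "j < k \<Longrightarrow> w k \<Longrightarrow> count_upto w j < count_upto w k"
  using count_upto_mono[of j "k - 1" w] by (cases k) auto

lemma count_upto_card: "count_upto w m = card {k \<in> {1..m}. w k}"
proof (induction m)
  case (Suc m)
  have "{k \<in> {1..Suc m}. w k} = {k \<in> {1..m}. w k} \<union> (if w (Suc m) then {Suc m} else {})"
    by (auto simp: le_Suc_eq)
  moreover have "card ({k \<in> {1..m}. w k} \<union> {Suc m}) = card {k \<in> {1..m}. w k} + 1"
    by (subst card_Un_disjoint) auto
  ultimately show ?case using Suc.IH by simp
qed simp

lemma count_upto_no: "k \<le> m \<Longrightarrow> (\<And>i. k < i \<Longrightarrow> i \<le> m \<Longrightarrow> \<not> w i) \<Longrightarrow> count_upto w m = count_upto w k"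
  by (induction m) (auto simp: le_Suc_eq)

lemma count_upto_all: "k \<le> m \<Longrightarrow> (\<And>i. k < i \<Longrightarrow> i \<le> m \<Longrightarrow> w i) \<Longrightarrow> count_upto w m = count_upto w k + (m - k)"
  by (induction m) (auto simp: le_Suc_eq)

lemma admissible_mono: "admissible w m \<Longrightarrow> k \<le> m \<Longrightarrow> admissible w k"
  by (auto simp: admissible_def)

lemma admissible_Suc: "admissible w (Suc m) \<longleftrightarrow> admissible w m \<and> col2 w (Suc m) \<le> col1 w (Suc m)"
  unfolding admissible_def le_Suc_eq by blast

lemma admissible_cong:
  assumes "\<And>i. 1 \<le> i \<Longrightarrow> i \<le> m \<Longrightarrow> w i = w' i" shows "admissible w m = admissible w' m"
proof -
  have "count_upto w k = count_upto w' k" "count_upto (\<lambda>i. \<not> w i) k = count_upto (\<lambda>i. \<not> w' i) k" if "k \<le> m" for k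
    by (rule count_upto_cong; use assms that in auto)+
  then show ?thesis by (simp add: admissible_def)
qed

lemma word_content_cong:
  assumes "\<And>j. 1 \<le> j \<Longrightarrow> j \<le> i \<Longrightarrow> w j = w' j" "1 \<le> i" shows "word_content w i = word_content w' i"
proof -
  have "count_upto w (i - 1) = count_upto w' (i - 1)" "count_upto (\<lambda>i. \<not> w i) (i - 1) = count_upto (\<lambda>i. \<not> w' i) (i - 1)"
    by (rule count_upto_cong; use assms in auto)+
  then show ?thesis using assms by (simp add: word_content_def)
qed

text \<open>The sum of the contents depends only on the column lengths. It is doubled to avoid
  dividing the triangular numbers.\<close>

lemma sum_word_content:
  "2 * (\<Sum>i\<in>{1..m}. word_content w i) = 2 * int (col1 w m) * int (col2 w m) + 2 * int (col2 w m) - int m * (int m - 1)"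
proof (induction m)
  case (Suc m)
  have "int m = int (col1 w m) + int (col2 w m)" using col1_col2[of w m] by simp
  then show ?case using Suc.IH by (simp add: word_content_def algebra_simps)
qed simp

text \<open>At the first difference the contents are \<open>-a\<close> and \<open>1 - b\<close> for
  the same column lengths \<open>a\<close> and \<open>b\<close>. Equality would mean
  \<open>b = a + 1\<close>, which admissibility forbids.\<close>

lemma word_content_inj:
  assumes w: "admissible w n" and w': "admissible w' n"
    and eq: "\<And>i. 1 \<le> i \<Longrightarrow> i \<le> n \<Longrightarrow> word_content w i = word_content w' i"
    and i: "1 \<le> i" "i \<le> n"
  shows "w i = w' i"
  using i
proof (induction i rule: less_induct)
  case (less i)
  have *: "col1 w (i - 1) = col1 w' (i - 1)" "col2 w (i - 1) = col2 w' (i - 1)"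
    by (rule count_upto_cong; use less in auto)+
  have "col2 w (i - 1) \<le> col1 w (i - 1)" "col2 w' (i - 1) \<le> col1 w' (i - 1)"
    using w w' less.prems by (auto simp: admissible_def)
  then show ?case using eq[OF less.prems] * by (auto simp: word_content_def split: if_splits)
qed

section \<open>Admissible words and standard tableaux\<close>

lemma tab_image:
  "m \<le> n \<Longrightarrow> tab n w ` {1..m} = {1..col1 w m} \<times> {1} \<union> {1..col2 w m} \<times> {2}"
proof (induction m)
  case (Suc m)
  have "{1..Suc m} = insert (Suc m) {1..m}" by auto
  then have "tab n w ` {1..Suc m} = insert (tab n w (Suc m)) ({1..col1 w m} \<times> {1} \<union> {1..col2 w m} \<times> {2})"
    using Suc by simp
  also have "\<dots> = {1..col1 w (Suc m)} \<times> {1} \<union> {1..col2 w (Suc m)} \<times> {2}"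
    using Suc.prems by (auto simp: tab_def)
  finally show ?case .
qed simp

lemma content_tab: "1 \<le> i \<Longrightarrow> i \<le> n \<Longrightarrow> content (tab n w) i = word_content w i"
  by (cases i) (auto simp: content_def tab_def word_content_def)

lemma word_tab: "1 \<le> i \<Longrightarrow> i \<le> n \<Longrightarrow> word (tab n w) i = w i"
  by (auto simp: word_def tab_def)

lemma tab_cong:
  assumes "\<And>i. 1 \<le> i \<Longrightarrow> i \<le> n \<Longrightarrow> w i = w' i" shows "tab n w = tab n w'"
proof
  fix i
  have "count_upto w i = count_upto w' i" "count_upto (\<lambda>i. \<not> w i) i = count_upto (\<lambda>i. \<not> w' i) i" if "i \<le> n"
    by (rule count_upto_cong; use assms that in auto)+
  then show "tab n w i = tab n w' i" using assms by (auto simp: tab_def restrict_def)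
qed

lemma shape_tab: "shape n (tab n w) = {1..col1 w n} \<times> {1} \<union> {1..col2 w n} \<times> {2}"
  unfolding shape_def by (rule tab_image) simp

lemma card_shape_tab: "card (shape n (tab n w)) = n"
proof -
  have "card (shape n (tab n w)) = col1 w n + col2 w n"
    unfolding shape_tab by (subst card_Un_disjoint) (auto simp: card_cartesian_product)
  then show ?thesis by (simp add: col1_col2)
qed

lemma tab_Std:
  assumes "admissible w n"
  shows "shape n (tab n w) \<in> Par2 n" "tab n w \<in> Std (shape n (tab n w))"
proof -
  have le: "col2 w k \<le> col1 w k" if "k \<le> n" for k using assms that by (simp add: admissible_def)
  show "shape n (tab n w) \<in> Par2 n"
    using le[of n] card_shape_tab[of n w] unfolding Par2_def young_def shape_tab by auto
  have "inj_on (tab n w) {1..n}"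
    by (rule eq_card_imp_inj_on) (use card_shape_tab[of n w] in \<open>auto simp: shape_def\<close>)
  then have bij: "bij_betw (tab n w) {1..n} (shape n (tab n w))" by (simp add: bij_betw_def shape_def)
  have "i < j" if "1 \<le> i" "i \<le> n" "1 \<le> j" "j \<le> n" "row (tab n w) i = row (tab n w) j" "column (tab n w) i < column (tab n w) j" for i j
  proof (rule ccontr)
    assume "\<not> i < j"
    then have "j \<le> i" by simp
    have ij: "w i" "\<not> w j" "col1 w i = col2 w j" using that by (auto simp: tab_def split: if_splits)
    \<comment> \<open>With \<open>j\<close> first, the second column would by then be as long as the
      first one becomes only at \<open>i\<close>, against admissibility.\<close>
    then have "j < i" using \<open>j \<le> i\<close> by (metis le_neq_implies_less)
    then have "col1 w j < col1 w i" using ij count_upto_less by blast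
    then show False using le[of j] ij that by simp
  qed
  moreover have "i < j" if "1 \<le> i" "i \<le> n" "1 \<le> j" "j \<le> n" "column (tab n w) i = column (tab n w) j" "row (tab n w) i < row (tab n w) j" for i j
  proof (rule ccontr)
    assume "\<not> i < j"
    then have "col1 w j \<le> col1 w i" "col2 w j \<le> col2 w i" by (simp_all add: count_upto_mono)
    then show False using that by (auto simp: tab_def split: if_splits)
  qed
  ultimately show "tab n w \<in> Std (shape n (tab n w))"
    unfolding Std_def card_shape_tab using bij by (simp add: restrict_extensional tab_def[of n w])
qed

lemma tab_StdPar2: "admissible w n \<Longrightarrow> tab n w \<in> StdPar2 n"
  unfolding StdPar2_def using tab_Std by blast

text \<open>Columns have no gaps and increase downwards, so the entries up to \<open>i\<close> in
  the column of \<open>i\<close> fill exactly the boxes from the top down to its own.\<close>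

lemma Std_row:
  assumes t: "t \<in> Std lam" and lam: "lam \<in> Par2 n" and i: "i \<in> {1..n}"
  shows "row t i = card {k \<in> {1..i}. column t k = column t i}"
proof -
  have card: "card lam = n" and y: "young lam" using lam by (auto simp: Par2_def)
  have bij: "bij_betw t {1..n} lam" using t card by (auto simp: Std_def)
  have std: "k < j" if "k \<in> {1..n}" "j \<in> {1..n}" "column t k = column t j" "row t k < row t j" for k j
    using t that unfolding Std_def card by blast
  have box: "t i \<in> lam" using bij i by (auto simp: bij_betw_def)
  have im: "t ` {k \<in> {1..i}. column t k = column t i} = {1..row t i} \<times> {column t i}"
  proof (intro set_eqI iffI)
    fix x assume "x \<in> t ` {k \<in> {1..i}. column t k = column t i}"
    then obtain k where k: "k \<in> {1..i}" "column t k = column t i" "x = t k" by auto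
    have kn: "k \<in> {1..n}" using k i by auto
    have "row t k \<le> row t i" using std[OF i kn] k by fastforce
    moreover have "t k \<in> lam" using bij kn by (auto simp: bij_betw_def)
    then have "1 \<le> row t k" using y by (cases "t k") (auto simp: young_def)
    ultimately show "x \<in> {1..row t i} \<times> {column t i}" using k by (cases "t k") auto
  next
    fix x assume x: "x \<in> {1..row t i} \<times> {column t i}"
    have "1 \<le> column t i" using box y by (cases "t i") (auto simp: young_def)
    then have "x \<in> lam" using y box x unfolding young_def by (metis atLeastAtMost_iff mem_Times_iff order_refl prod.collapse singletonD)
    then obtain k where k: "k \<in> {1..n}" "x = t k" using bij by (auto simp: bij_betw_def)
    have "k \<le> i"
    proof (cases "row t k < row t i")
      case True
      then show ?thesis using std[OF k(1) i] k x by (simp add: mem_Times_iff)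
    next
      case False
      then have "t k = t i" using k x by (simp add: mem_Times_iff prod_eq_iff)
      then show ?thesis using bij k i by (metis bij_betw_def inj_onD order_refl)
    qed
    then show "x \<in> t ` {k \<in> {1..i}. column t k = column t i}" using k x by (auto simp: mem_Times_iff)
  qed
  have inj: "inj_on t {k \<in> {1..i}. column t k = column t i}"
    using bij_betw_imp_inj_on[OF bij] by (rule inj_on_subset) (use i in auto)
  show ?thesis using card_image[OF inj] unfolding im by (simp add: card_cartesian_product)
qed

lemma StdPar2_tab:
  assumes "t \<in> StdPar2 n"
  shows "t = tab n (word t)" "admissible (word t) n"
proof -
  obtain lam where lam: "lam \<in> Par2 n" and t: "t \<in> Std lam" using assms by (auto simp: StdPar2_def)
  have card: "card lam = n" and y: "young lam" using lam by (auto simp: Par2_def)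
  have bij: "bij_betw t {1..n} lam" and ext: "t \<in> extensional {1..n}" using t card by (auto simp: Std_def)
  have box: "t i \<in> lam" if "i \<in> {1..n}" for i using bij that by (auto simp: bij_betw_def)
  have col: "column t i = 1 \<or> column t i = 2" if "i \<in> {1..n}" for i
    using box[OF that] lam by (cases "t i") (auto simp: Par2_def young_def)
  have row1: "t i = (col1 (word t) i, 1)" if "i \<in> {1..n}" "word t i" for i
    using Std_row[OF t lam that(1)] that by (simp add: word_def count_upto_card prod_eq_iff)
  have row2: "t i = (col2 (word t) i, 2)" if i: "i \<in> {1..n}" "\<not> word t i" for i
  proof -
    have c: "column t i = 2" using col[OF i(1)] i(2) by (simp add: word_def)
    have "k \<in> {1..i} \<and> column t k = 2 \<longleftrightarrow> k \<in> {1..i} \<and> column t k \<noteq> 1" for k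
      using col[of k] i by auto
    then have "{k \<in> {1..i}. column t k = 2} = {k \<in> {1..i}. \<not> word t k}" by (simp add: word_def)
    then show ?thesis using Std_row[OF t lam i(1)] c by (simp add: count_upto_card prod_eq_iff)
  qed
  show "t = tab n (word t)"
    using ext row1 row2 unfolding tab_def by (intro extensionalityI[of _ "{1..n}"]) auto
  have "col2 (word t) m \<le> col1 (word t) m" if "m \<le> n" for m
    using that
  proof (induction m)
    case (Suc m)
    show ?case
    proof (cases "word t (Suc m)")
      case False
      have i: "Suc m \<in> {1..n}" using Suc.prems by simp
      define r where "r = col2 (word t) (Suc m)"
      have tm: "t (Suc m) = (r, 2)" using row2[OF i False] by (simp add: r_def)
      have r: "1 \<le> r" using False by (simp add: r_def)
      \<comment> \<open>The left neighbour of this box holds a smaller entry, and at that entry the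
        first column already has length \<open>r\<close>.\<close>
      have "(r, 2) \<in> lam" using box[OF i] tm by simp
      then have "(r, 1) \<in> lam" using y r unfolding young_def by (metis order_refl one_le_numeral)
      then obtain k where k: "k \<in> {1..n}" "t k = (r, 1)" using bij by (auto simp: bij_betw_def image_iff)
      then have wk: "word t k" by (simp add: word_def)
      have "k < Suc m" using t k i tm unfolding Std_def card by fastforce
      moreover have "col1 (word t) k = r" using row1[OF k(1) wk] k by simp
      ultimately have "r \<le> col1 (word t) (Suc m)" using count_upto_mono[of k "Suc m" "word t"] by simp
      then show ?thesis by (simp only: r_def)
    qed (use Suc in simp)
  qed simp
  then show "admissible (word t) n" by (simp add: admissible_def)
qed

lemma StdPar2_eqI:
  assumes "s \<in> StdPar2 n" "t \<in> StdPar2 n" "\<And>i. 1 \<le> i \<Longrightarrow> i \<le> n \<Longrightarrow> word s i = word t i"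
  shows "s = t"
proof -
  have "s = tab n (word s)" by (rule StdPar2_tab(1)[OF assms(1)])
  also have "\<dots> = tab n (word t)" by (rule tab_cong[OF assms(3)])
  also have "\<dots> = t" by (rule StdPar2_tab(1)[OF assms(2), symmetric])
  finally show ?thesis .
qed

lemma finite_StdPar2: "finite (StdPar2 n)"
proof (rule finite_subset)
  show "StdPar2 n \<subseteq> PiE {1..n} (\<lambda>_. {..n} \<times> {1, 2})"
  proof
    fix t assume "t \<in> StdPar2 n"
    then have t: "tab n (word t) = t" by (rule StdPar2_tab(1)[symmetric])
    have "col1 (word t) i \<le> n" "col2 (word t) i \<le> n" if "i \<le> n" for i
      using col1_col2[of "word t" i] that by simp_all
    then have "tab n (word t) \<in> PiE {1..n} (\<lambda>_. {..n} \<times> {1, 2})"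
      by (auto simp: tab_def PiE_def)
    then show "t \<in> PiE {1..n} (\<lambda>_. {..n} \<times> {1, 2})" unfolding t .
  qed
qed (auto intro!: finite_PiE)

lemma finite_contents: "finite (contents n)"
proof -
  have "contents n = (\<lambda>(s, i). content s i) ` (StdPar2 n \<times> {1..n})" unfolding contents_def by (force simp: image_iff)
  then show ?thesis using finite_StdPar2 by simp
qed

lemma word_content_contents: "admissible w n \<Longrightarrow> i \<in> {1..n} \<Longrightarrow> word_content w i \<in> contents n"
  unfolding contents_def mem_Collect_eq
  by (intro exI[of _ "tab n w"] exI[of _ i] conjI tab_StdPar2) (simp_all add: content_tab)

section \<open>Joint eigenvectors and idempotents\<close>

context tl_hom begin

text \<open>The zero vector is included: what counts is that such vectors span, and an empty
  eigenspace is expressed as \<open>x = 0\<close>.\<close>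

definition eigvec :: "nat \<Rightarrow> (nat \<Rightarrow> bool) \<Rightarrow> tl \<Rightarrow> bool" where
  "eigvec m w x \<longleftrightarrow> x \<in> TL n \<and> (\<forall>i\<in>{1..m}. JM i x = scale (of_int (word_content w i)) x)"

lemma eigvec_TL: "eigvec m w x \<Longrightarrow> x \<in> TL n"
  by (simp add: eigvec_def)

lemma eigvec_lincomb: "eigvec m w x \<Longrightarrow> eigvec m w y \<Longrightarrow> eigvec m w (scale c x + scale d y)"
  by (auto simp: eigvec_def TL_add TL_scale JM_linear scale_add_right mult.commute)

lemma eigvec_JM: "eigvec m w x \<Longrightarrow> m \<le> n \<Longrightarrow> j \<le> n \<Longrightarrow> eigvec m w (JM j x)"
  by (auto simp: eigvec_def JM_TL JM_commute[of _ j] JM_linear)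

text \<open>The eigenvalues found so far have a sum that depends only on the column lengths. The
  roots \<open>-a\<close> and \<open>1 - b\<close> are the contents of the next box in the first and
  in the second column.\<close>

lemma eigvec_quadratic:
  assumes x: "eigvec m w x" and m: "m + 1 \<le> n"
  defines "a \<equiv> of_nat (col1 w m)" and "b \<equiv> of_nat (col2 w m)"
  shows "JM (m + 1) (JM (m + 1) x) = scale (1 - a - b) (JM (m + 1) x) - scale (a * (b - 1)) x"
proof -
  have "(\<Sum>i\<in>{1..m}. JM i x) = (\<Sum>i\<in>{1..m}. scale (of_int (word_content w i)) x)"
    using x by (intro sum.cong) (auto simp: eigvec_def)
  also have "\<dots> = scale (of_int (\<Sum>i\<in>{1..m}. word_content w i)) x"
    by (simp add: fun_eq_iff sum_fun_apply scale_def sum_distrib_right)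
  finally have sum: "(\<Sum>i\<in>{1..m}. JM i x) = scale (of_int (\<Sum>i\<in>{1..m}. word_content w i)) x" .
  have mab: "of_nat m = a + b" unfolding a_def b_def using col1_col2[of w m] by (metis of_nat_add)
  define S :: rat where "S = of_int (\<Sum>i\<in>{1..m}. word_content w i)"
  have "of_int (2 * (\<Sum>i\<in>{1..m}. word_content w i)) = (of_int (2 * int (col1 w m) * int (col2 w m) + 2 * int (col2 w m) - int m * (int m - 1)) :: rat)"
    by (simp only: sum_word_content)
  then have "2 * S = 2 * a * b + 2 * b - of_nat m * (of_nat m - 1)"
    by (simp only: S_def a_def b_def of_int_mult of_int_add of_int_diff of_int_of_nat_eq of_int_numeral of_int_1)
  then have S: "S + (a + b) * (a + b - 3) / 2 = a * (b - 1)" unfolding mab by (simp add: field_simps)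
  have "JM (m + 1) (JM (m + 1) x) = scale (1 - (a + b)) (JM (m + 1) x) - scale S x - scale ((a + b) * (a + b - 3) / 2) x"
    using JM_quadratic[OF m eigvec_TL[OF x]] unfolding sum S_def[symmetric] mab .
  also have "\<dots> = scale (1 - a - b) (JM (m + 1) x) - scale (S + (a + b) * (a + b - 3) / 2) x"
    by (simp add: fun_eq_iff fun_apply scale_def algebra_simps)
  finally show ?thesis unfolding S .
qed

text \<open>The intertwiner behind Young's seminormal form: \<open>s_k\<close>, corrected by the
  inverse difference of the two eigenvalues, exchanges them.\<close>

lemma JM_swap:
  assumes k: "1 \<le> k" "k < n" and x: "x \<in> TL n"
    and c: "JM k x = scale c x" and d: "JM (k + 1) x = scale d x" and cd: "c \<noteq> d"
  defines "y \<equiv> act_by (transpose k (k + 1)) x - scale (1 / (d - c)) x"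
  shows "y \<in> TL n" "JM k y = scale d y" "JM (k + 1) y = scale c y"
    and "\<And>j e. j \<le> n \<Longrightarrow> j \<noteq> k \<Longrightarrow> j \<noteq> k + 1 \<Longrightarrow> JM j x = scale e x \<Longrightarrow> JM j y = scale e y"
proof -
  let ?s = "transpose k (k + 1)"
  have p: "?s permutes {1..n}" using k by (intro transpose_permutes) auto
  show "y \<in> TL n" unfolding y_def using act_by_TL p x by (intro TL_diff TL_scale)
  have "scale d (act_by ?s x) = JM k (act_by ?s x) + x"
    using act_by_JM_Suc[OF k x] unfolding d act_by_linear .
  then have 1: "JM k (act_by ?s x) = scale d (act_by ?s x) - x" by simp
  have "scale c (act_by ?s x) = JM (k + 1) (act_by ?s x) - x"
    using act_by_JM[OF k x] unfolding c act_by_linear .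
  then have 2: "JM (k + 1) (act_by ?s x) = scale c (act_by ?s x) + x" by simp
  have *: "1 + c / (d - c) = d / (d - c)" "d / (d - c) - 1 = c / (d - c)" using cd by (simp_all add: field_simps)
  have "JM k y = scale d (act_by ?s x) - scale (1 + c / (d - c)) x"
    unfolding y_def JM_linear 1 c by (simp add: fun_eq_iff fun_apply scale_def algebra_simps)
  then show "JM k y = scale d y" unfolding * y_def by (simp add: scale_diff_right)
  have "JM (k + 1) y = scale c (act_by ?s x) - scale (d / (d - c) - 1) x"
    unfolding y_def JM_linear 2 d by (simp add: fun_eq_iff fun_apply scale_def algebra_simps)
  then show "JM (k + 1) y = scale c y" unfolding * y_def by (simp add: scale_diff_right)
  fix j e assume j: "j \<le> n" "j \<noteq> k" "j \<noteq> k + 1" and e: "JM j x = scale e x"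
  have "JM j (act_by ?s x) = act_by ?s (JM j x)"
    using j k by (intro act_by_JM_commute[symmetric] x) auto
  then show "JM j y = scale e y" unfolding y_def JM_linear e act_by_linear
    by (simp add: scale_diff_right mult.commute)
qed

text \<open>Swapping adjacent entries reduces this to the case where the last entry of the first column is
  \<open>m - 1\<close>.  There the braid relation of \<open>s\<^bsub>m-1\<^esub>\<close> and \<open>s\<^bsub>m\<^esub>\<close>, which act by \<open>1\<close> and
  \<open>-1\<close>, forces \<open>x = 0\<close>.\<close>

lemma no_third_step:
  assumes "admissible w m" "col1 w m = a" "col2 w m = a" "m + 1 \<le> n" "eigvec m w x"
    and "JM (m + 1) x = scale (1 - of_nat a) x"
  shows "x = 0"
  using assms
proof (induction a arbitrary: w m x)
  case 0
  then have "m = 0" using col1_col2[of w m] by simp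
  then show ?case using "0.prems"(6) by (simp add: JM_def)
next
  case (Suc a)
  note outer = Suc.IH
  have main: "x = 0" if "m - k = d" "1 \<le> k" "k < m" "w k" "\<And>i. k < i \<Longrightarrow> i \<le> m \<Longrightarrow> \<not> w i"
    "admissible w m" "col1 w m = Suc a" "col2 w m = Suc a" "m + 1 \<le> n" "eigvec m w x"
    "JM (m + 1) x = scale (1 - of_nat (Suc a)) x" for d k w x
    using that
  proof (induction d arbitrary: k w x)
    case 0
    then show ?case by simp
  next
    case (Suc d)
    note k = Suc.prems(2,3) and last = Suc.prems(4,5) and cols = Suc.prems(7,8)
    have mk: "m - k = Suc d" using Suc.prems(1) .
    have c1: "col1 w (k - 1) = a" and c1k: "col1 w k = Suc a"
    proof -
      have "col1 w m = col1 w k" using last k by (intro count_upto_no) auto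
      then show "col1 w k = Suc a" using cols by simp
      then show "col1 w (k - 1) = a" using k last by (cases k) auto
    qed
    have c2: "col2 w k + Suc d = Suc a" "col2 w (k - 1) = col2 w k"
    proof -
      have "col2 w m = col2 w k + (m - k)" using last k by (intro count_upto_all) auto
      then show "col2 w k + Suc d = Suc a" using cols mk by simp
      show "col2 w (k - 1) = col2 w k" using k last by (cases k) auto
    qed
    have nwk: "\<not> w (k + 1)" using last k by simp
    have x: "x \<in> TL n" using Suc.prems(10) eigvec_TL by blast
    have ck: "JM k x = scale (- of_nat a) x"
      using Suc.prems(10) k last c1 by (simp add: eigvec_def word_content_def)
    have ck1: "JM (k + 1) x = scale (1 - of_nat (col2 w k)) x"
      using Suc.prems(10) k nwk by (simp add: eigvec_def word_content_def)
    \<comment> \<open>All letters after \<open>k\<close> belong to the second column, so the two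
      eigenvalues differ by \<open>m - k\<close>.\<close>
    have diff: "(1 - of_nat (col2 w k)) - (- of_nat a) = (of_nat (Suc d) :: rat)"
    proof -
      have "of_nat (col2 w k + Suc d) = (of_nat (Suc a) :: rat)" using c2 by simp
      then show ?thesis by (simp add: algebra_simps)
    qed
    then have ne: "(- of_nat a :: rat) \<noteq> 1 - of_nat (col2 w k)" by (metis diff_self of_nat_eq_0_iff nat.distinct(1))
    have kn: "k < n" using k Suc.prems(9) by simp
    define y where "y = act_by (transpose k (k + 1)) x - scale (1 / of_nat (Suc d)) x"
    note swap = JM_swap[OF k(1) kn x ck ck1 ne, unfolded diff, folded y_def]
    have p: "transpose j (j + 1) permutes {1..n}" if "1 \<le> j" "j \<le> m" for j
      using that Suc.prems(9) by (intro transpose_permutes) auto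
    show ?case
    proof (cases "d = 0")
      case False
      define w' where "w' = w \<circ> transpose k (k + 1)"
      have w'_eq: "w' i = w i" if "i \<noteq> k" "i \<noteq> k + 1" for i using that by (simp add: w'_def transpose_def)
      have w'k: "\<not> w' k" "w' (k + 1)" using nwk last by (simp_all add: w'_def)
      have cnt_below: "count_upto w' j = count_upto w j" "col2 w' j = col2 w j" if "j < k" for j
        by (rule count_upto_cong; use w'_eq that in auto)+
      have cnt_k: "col1 w' k = a" "col2 w' k = col2 w k + 1"
        using cnt_below[of "k - 1"] c1 c2(2) w'k k by (cases k; simp)+
      have cnt_above: "count_upto w' j = count_upto w j \<and> col2 w' j = col2 w j" if "k < j" for j
        using that
      proof (induction j)
        case (Suc j)
        show ?case
        proof (cases "j = k")
          case True
          then show ?thesis using w'k nwk cnt_k c1k by simp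
        next
          case False
          then show ?thesis using Suc w'_eq[of "Suc j"] by simp
        qed
      qed simp
      have adm: "admissible w' m" unfolding admissible_def
      proof (intro allI impI)
        fix j assume "j \<le> m"
        then have "col2 w j \<le> col1 w j" using Suc.prems(6) by (simp add: admissible_def)
        then show "col2 w' j \<le> col1 w' j"
          using cnt_below[of j] cnt_above[of j] cnt_k c2 False by (cases j k rule: linorder_cases) auto
      qed
      have wc: "word_content w' i = word_content w i" if "i \<noteq> k" "i \<noteq> k + 1" "1 \<le> i" for i
        using that w'_eq cnt_below[of "i - 1"] cnt_above[of "i - 1"] by (cases i k rule: linorder_cases) (auto simp: word_content_def)
      have wck: "word_content w' k = 1 - int (col2 w k)" "word_content w' (k + 1) = - int a"
        using w'k cnt_k cnt_below[of "k - 1"] c2 k by (simp_all add: word_content_def)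
      have eig: "eigvec m w' y" unfolding eigvec_def
      proof (intro conjI ballI)
        fix i assume i: "i \<in> {1..m}"
        show "JM i y = scale (of_int (word_content w' i)) y"
        proof (cases "i = k \<or> i = k + 1")
          case True
          then show ?thesis using swap(2,3) wck by auto
        next
          case False
          then have "JM i x = scale (of_int (word_content w' i)) x"
            using Suc.prems(10) i wc[of i] by (simp add: eigvec_def)
          then show ?thesis using swap(4)[of i] False i Suc.prems(9) by simp
        qed
      qed (rule swap(1))
      have top: "JM (m + 1) y = scale (1 - of_nat (Suc a)) y"
        using swap(4)[of "m + 1"] Suc.prems(9,11) mk False by simp
      have "y = 0"
      proof (rule Suc.IH[of "k + 1" w' y])
        show "\<not> w' i" if "k + 1 < i" "i \<le> m" for i using w'_eq[of i] last(2)[of i] that by simp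
        show "col1 w' m = Suc a" "col2 w' m = Suc a" using cnt_above[of m] k cols by simp_all
      qed (use mk False w'k adm eig top Suc.prems(9) in auto)
      \<comment> \<open>Now \<open>s_k\<close> acts on \<open>x\<close> by
        \<open>1 / (d + 1)\<close>, but its square is the identity; for \<open>d > 0\<close> only
        \<open>x = 0\<close> is left.\<close>
      then have sx: "act_by (transpose k (k + 1)) x = scale (1 / of_nat (Suc d)) x" by (simp add: y_def)
      have "act_by (transpose k (k + 1)) (act_by (transpose k (k + 1)) x) = x"
        using x p[of k] k by (simp add: act_by_act_by transpose_comp_self act_by_id)
      then have "scale (1 / of_nat (Suc d) * (1 / of_nat (Suc d)) - 1) x = 0"
        unfolding sx act_by_linear by (simp add: scale_diff_left)
      moreover have "(1 / of_nat (Suc d) * (1 / of_nat (Suc d)) :: rat) < 1"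
        using False by (simp add: divide_simps less_1_mult)
      ultimately show ?thesis by (simp add: scale_eq_0_iff)
    next
      case True
      then have mk1: "m = k + 1" using mk k by simp
      have c2k: "col2 w k = a" using c2 True by simp
      \<comment> \<open>\<open>y\<close> has the forbidden eigenvalue \<open>1 - a\<close> of
        \<open>L_k\<close> over two columns of length \<open>a\<close>, so the outer induction
        applies.\<close>
      have "y = 0"
      proof (rule outer[of w "k - 1" y])
        show "admissible w (k - 1)" by (rule admissible_mono[OF Suc.prems(6)]) (use k in simp)
        show "col1 w (k - 1) = a" "col2 w (k - 1) = a" using c1 c2 c2k by simp_all
        show "k - 1 + 1 \<le> n" using kn by simp
        show "eigvec (k - 1) w y" unfolding eigvec_def
        proof (intro conjI ballI)
          fix i assume i: "i \<in> {1..k - 1}"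
          have "i \<in> {1..m}" using i k by auto
          then have "JM i x = scale (of_int (word_content w i)) x"
            using Suc.prems(10) by (simp add: eigvec_def)
          moreover have "i \<le> n" "i \<noteq> k" "i \<noteq> k + 1" using i kn by auto
          ultimately show "JM i y = scale (of_int (word_content w i)) y" using swap(4)[of i] by blast
        qed (rule swap(1))
        show "JM (k - 1 + 1) y = scale (1 - of_nat a) y" using swap(2) k c2k by simp
      qed
      then have sk: "act_by (transpose k (k + 1)) x = x" using True by (simp add: y_def)
      have m1: "1 \<le> m" "m < n" using k Suc.prems(9) by simp_all
      have cm: "JM m x = scale (1 - of_nat a) x" using ck1 mk1 c2k by simp
      have cm1: "JM (m + 1) x = scale (- of_nat a) x" using Suc.prems(11) by simp
      define z where "z = act_by (transpose m (m + 1)) x - scale (1 / (- of_nat a - (1 - of_nat a))) x"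
      have ne': "(1 - of_nat a :: rat) \<noteq> - of_nat a" by simp
      note swap' = JM_swap[OF m1 x cm cm1 ne', folded z_def]
      have "eigvec k w z" unfolding eigvec_def
      proof (intro conjI ballI)
        fix i assume i: "i \<in> {1..k}"
        then have "JM i x = scale (of_int (word_content w i)) x"
          using Suc.prems(10) k by (simp add: eigvec_def)
        then show "JM i z = scale (of_int (word_content w i)) z" using swap'(4)[of i] i kn mk1 by simp
      qed (rule swap'(1))
      \<comment> \<open>Over columns of lengths \<open>a + 1\<close> and \<open>a\<close> the roots
        are \<open>-(a + 1)\<close> and \<open>1 - a\<close>; the eigenvalue \<open>-a\<close> of
        \<open>z\<close> is neither.\<close>
      from eigvec_quadratic[OF this] have "JM m (JM m z) = scale (1 - of_nat (Suc a) - of_nat a) (JM m z) - scale (of_nat (Suc a) * (of_nat a - 1)) z"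
        using kn c1k c2k by (simp add: mk1)
      then have "scale (of_nat a * of_nat a) z = scale ((1 - of_nat (Suc a) - of_nat a) * - of_nat a - of_nat (Suc a) * (of_nat a - 1)) z"
        unfolding swap'(2) JM_linear by (simp add: scale_diff_left)
      also have "(1 - of_nat (Suc a) - of_nat a) * - of_nat a - of_nat (Suc a) * (of_nat a - 1) = of_nat a * of_nat a + (1 :: rat)"
        by (simp add: algebra_simps)
      finally have "z = 0" by (simp add: scale_add_left)
      then have sm: "act_by (transpose m (m + 1)) x = - x"
        by (simp add: z_def scale_minus_left eq_neg_iff_add_eq_0)
      have neg: "act_by v (- x) = - act_by v x" for v using act_by_linear(3)[of v "-1" x] by (simp add: scale_minus_left)
      have braid: "transpose k (k + 1) \<circ> transpose m (m + 1) \<circ> transpose k (k + 1) = transpose m (m + 1) \<circ> transpose k (k + 1) \<circ> transpose m (m + 1)"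
        unfolding mk1 by (rule ext) (simp add: transpose_def)
      have pp: "transpose k (k + 1) permutes {1..n}" "transpose m (m + 1) permutes {1..n}" using p k by simp_all
      have "act_by (transpose k (k + 1)) (act_by (transpose m (m + 1)) (act_by (transpose k (k + 1)) x)) =
        act_by (transpose m (m + 1)) (act_by (transpose k (k + 1)) (act_by (transpose m (m + 1)) x))"
        using pp x braid by (simp add: act_by_act_by act_by_TL permutes_compose)
      then have "- x = x" unfolding sk sm neg by simp
      then show ?thesis by (simp add: fun_eq_iff fun_apply)
    qed
  qed
  have "0 < m" using Suc.prems(2) by (cases m) auto
  have "\<exists>k\<in>{1..m}. w k"
  proof (rule ccontr)
    assume "\<not> ?thesis"
    then have "col1 w m = col1 w 0" by (intro count_upto_no) auto
    then show False using Suc.prems(2) by simp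
  qed
  then have ne: "{k \<in> {1..m}. w k} \<noteq> {}" by blast
  define k where "k = Max {k \<in> {1..m}. w k}"
  have k: "k \<in> {k \<in> {1..m}. w k}" unfolding k_def using ne by (intro Max_in) auto
  have kmax: "\<not> w i" if "k < i" "i \<le> m" for i
  proof
    assume "w i"
    then have "i \<le> k" unfolding k_def using that k by (intro Max_ge) auto
    then show False using that by simp
  qed
  have "\<not> w m"
  proof
    assume "w m"
    then have "col1 w (m - 1) < col2 w (m - 1)" using Suc.prems(2,3) \<open>0 < m\<close> by (cases m) auto
    then show False using Suc.prems(1) by (auto simp: admissible_def not_less[symmetric])
  qed
  then have "k < m" using k by (cases "k = m") auto
  then show ?case using main[of k "m - k" w x] k kmax Suc.prems by simp
qed

end

section \<open>Spanning by joint eigenvectors\<close>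

context tl_hom begin

lemma eigvec_cong:
  assumes "\<And>i. 1 \<le> i \<Longrightarrow> i \<le> m \<Longrightarrow> w i = w' i" shows "eigvec m w x = eigvec m w' x"
proof -
  have "word_content w i = word_content w' i" if "i \<in> {1..m}" for i
    by (rule word_content_cong; use assms that in auto)
  then show ?thesis by (simp add: eigvec_def)
qed

lemma eigvec_Suc:
  "eigvec (Suc m) w x \<longleftrightarrow> eigvec m w x \<and> JM (Suc m) x = scale (of_int (word_content w (Suc m))) x"
  by (auto simp: eigvec_def atLeastAtMostSuc_conv)

text \<open>The spanning property in the form of an induction rule. In the step a vector is split
  into eigenvectors of the next operator by its quadratic equation; when both columns have the same
  length, the part belonging to the second column is zero by \<open>no_third_step\<close>.\<close>

lemma TL_eigvec_induct:
  assumes "m \<le> n" "x \<in> TL n"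
    and "\<And>w v. admissible w m \<Longrightarrow> eigvec m w v \<Longrightarrow> P v"
    and "\<And>u v. u \<in> TL n \<Longrightarrow> v \<in> TL n \<Longrightarrow> P u \<Longrightarrow> P v \<Longrightarrow> P (u + v)"
  shows "P x"
  using assms(1,3)
proof (induction m)
  case 0
  show ?case by (rule "0.prems"(2)[of "\<lambda>_. True"]) (simp_all add: admissible_def eigvec_def assms(2))
next
  case (Suc m)
  show ?case
  proof (rule Suc.IH)
    show "m \<le> n" using Suc.prems(1) by simp
    fix w v assume w: "admissible w m" and v: "eigvec m w v"
    let ?a = "of_nat (col1 w m) :: rat" and ?b = "of_nat (col2 w m) :: rat"
    define L where "L = JM (m + 1)"
    have v_TL: "v \<in> TL n" using v eigvec_TL by blast
    have eL: "eigvec m w (L v)" unfolding L_def using v Suc.prems(1) by (intro eigvec_JM) simp_all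
    have quad: "L (L v) = scale (1 - ?a - ?b) (L v) - scale (?a * (?b - 1)) v"
      unfolding L_def using eigvec_quadratic[OF v] Suc.prems(1) by simp
    \<comment> \<open>\<open>y1\<close> and \<open>y2\<close> are \<open>v\<close> multiplied by one
      factor of the quadratic equation; the other factor annihilates them.\<close>
    define y1 where "y1 = scale 1 (L v) + scale (?b - 1) v"
    define y2 where "y2 = scale 1 (L v) + scale ?a v"
    have e1: "eigvec m w y1" and e2: "eigvec m w y2"
      unfolding y1_def y2_def by (intro eigvec_lincomb eL v)+
    have Ly1: "L y1 = scale (- ?a) y1"
    proof -
      have "L y1 = L (L v) + scale (?b - 1) (L v)" by (simp add: y1_def L_def JM_linear)
      then show ?thesis unfolding quad y1_def by (simp add: fun_eq_iff fun_apply scale_def algebra_simps)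
    qed
    have Ly2: "L y2 = scale (1 - ?b) y2"
    proof -
      have "L y2 = L (L v) + scale ?a (L v)" by (simp add: y2_def L_def JM_linear)
      then show ?thesis unfolding quad y2_def by (simp add: fun_eq_iff fun_apply scale_def algebra_simps)
    qed
    have le: "col2 w m \<le> col1 w m" using w by (simp add: admissible_def)
    have P1: "P (scale c y1)" for c
    proof (rule Suc.prems(2))
      let ?w = "w(Suc m := True)"
      have cnt: "count_upto ?w m = col1 w m" "col2 ?w m = col2 w m" by (rule count_upto_cong; simp)+
      show "admissible ?w (Suc m)"
        using w le cnt by (simp add: admissible_Suc admissible_cong[of m ?w w])
      have "eigvec m ?w y1" using e1 eigvec_cong[of m ?w w] by simp
      moreover have "L y1 = scale (of_int (word_content ?w (Suc m))) y1"
        unfolding Ly1 using cnt by (simp add: word_content_def)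
      ultimately have "eigvec (Suc m) ?w y1" unfolding eigvec_Suc L_def by simp
      from eigvec_lincomb[OF this this, of c 0] show "eigvec (Suc m) ?w (scale c y1)" by simp
    qed
    have P2: "P (scale c y2)" if lt: "col2 w m < col1 w m" for c
    proof (rule Suc.prems(2))
      let ?w = "w(Suc m := False)"
      have cnt: "count_upto ?w m = col1 w m" "col2 ?w m = col2 w m" by (rule count_upto_cong; simp)+
      show "admissible ?w (Suc m)"
        using w lt cnt by (simp add: admissible_Suc admissible_cong[of m ?w w])
      have "eigvec m ?w y2" using e2 eigvec_cong[of m ?w w] by simp
      moreover have "L y2 = scale (of_int (word_content ?w (Suc m))) y2"
        unfolding Ly2 using cnt by (simp add: word_content_def)
      ultimately have "eigvec (Suc m) ?w y2" unfolding eigvec_Suc L_def by simp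
      from eigvec_lincomb[OF this this, of c 0] show "eigvec (Suc m) ?w (scale c y2)" by simp
    qed
    \<comment> \<open>The difference of the two roots, positive by admissibility.\<close>
    define g where "g = ?a - ?b + 1"
    have "?b \<le> ?a" using le by simp
    then have g: "g \<noteq> 0" by (simp add: g_def)
    have "scale g v = scale 1 y2 + scale (-1) y1"
      unfolding y1_def y2_def g_def by (simp add: fun_eq_iff fun_apply scale_def algebra_simps)
    then have "scale (1 / g) (scale g v) = scale (1 / g) (scale 1 y2 + scale (-1) y1)" by simp
    then have v_eq: "v = scale (1 / g) y2 + scale (- 1 / g) y1"
      using g by (simp add: scale_add_right)
    show "P v"
    proof (cases "col2 w m < col1 w m")
      case True
      have "scale (1 / g) y2 \<in> TL n" "scale (- 1 / g) y1 \<in> TL n"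
        using e1 e2 eigvec_TL TL_scale by blast+
      then show ?thesis using assms(4) P1 P2[OF True] v_eq by metis
    next
      case False
      have "y2 = 0"
        by (rule no_third_step[OF w _ _ _ e2]) (use False le Suc.prems(1) Ly2 in \<open>simp_all add: L_def\<close>)
      then show ?thesis using v_eq P1 by (metis add_0 scale_zero_right)
    qed
  qed
qed

section \<open>The idempotents as projections\<close>

lemma tl_prod_mult:
  "set xs \<subseteq> TL n \<Longrightarrow> y \<in> TL n \<Longrightarrow> tl_prod n xs \<in> TL n \<and> tl_mult n (tl_prod n xs) y = foldr (tl_mult n) xs y"
proof (induction xs)
  case Nil
  then show ?case using image_one image_eq by (simp add: tl_prod_def tl_mult_one_left)
next
  case (Cons x xs)
  then have IH: "tl_prod n xs \<in> TL n" "tl_mult n (tl_prod n xs) y = foldr (tl_mult n) xs y" by auto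
  have eq: "tl_prod n (x # xs) = tl_mult n x (tl_prod n xs)" by (simp add: tl_prod_def)
  have "tl_prod n (x # xs) \<in> TL n" unfolding eq using Cons.prems IH by (intro TL_mult) auto
  moreover have "tl_mult n (tl_prod n (x # xs)) y = foldr (tl_mult n) (x # xs) y"
    unfolding eq using Cons.prems IH by (simp add: tl_mult_assoc)
  ultimately show ?case by simp
qed

lemma tl_one_TL: "tl_one n \<in> TL n"
  using image_one image_eq by simp

definition idem_factor :: "tableau \<Rightarrow> int \<Rightarrow> nat \<Rightarrow> tl" where
  "idem_factor t c i = scale (1 / of_int (content t i - c)) (\<Phi> (jucys_murphy i) - scale (of_int c) (tl_one n))"

definition idem_factors :: "tableau \<Rightarrow> tl list" where
  "idem_factors t = [idem_factor t c i. c \<leftarrow> sorted_list_of_set (contents n), i \<leftarrow> [1..<n + 1], c \<noteq> content t i]"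

lemma idem_eq: "idem n \<Phi> t = tl_prod n (idem_factors t)"
  unfolding idem_def idem_factors_def idem_factor_def ..

lemma set_idem_factors: "set (idem_factors t) = {idem_factor t c i | c i. c \<in> contents n \<and> i \<in> {1..n} \<and> c \<noteq> content t i}"
proof -
  have "set (idem_factors t) = (\<Union>c\<in>contents n. \<Union>i\<in>{i \<in> {1..n}. c \<noteq> content t i}. {idem_factor t c i})"
    unfolding idem_factors_def using finite_contents
    by (simp del: upt_Suc add: atLeastLessThanSuc_atLeastAtMost Int_def)
  also have "\<dots> = {idem_factor t c i | c i. c \<in> contents n \<and> i \<in> {1..n} \<and> c \<noteq> content t i}" by blast
  finally show ?thesis .
qed

lemma jucys_murphy_GA: "i \<le> n \<Longrightarrow> jucys_murphy i \<in> GA n"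
  unfolding jucys_murphy_def by (intro GA_sum GA_basis transpose_permutes) auto

lemma idem_factors_TL: "set (idem_factors t) \<subseteq> TL n"
  unfolding set_idem_factors idem_factor_def
  using TL_scale TL_diff Phi_TL jucys_murphy_GA tl_one_TL by fastforce

lemma idem_TL: "idem n \<Phi> t \<in> TL n"
  using tl_prod_mult[OF idem_factors_TL tl_one_TL] by (simp add: idem_eq)

lemma idem_factor_eigvec:
  assumes v: "eigvec n w v" and i: "i \<in> {1..n}"
  shows "tl_mult n (idem_factor t c i) v = scale ((of_int (word_content w i) - of_int c) / of_int (content t i - c)) v"
proof -
  have "JM i v = scale (of_int (word_content w i)) v" using v i by (simp add: eigvec_def)
  then show ?thesis
    unfolding idem_factor_def using i eigvec_TL[OF v]
    by (simp add: tl_mult_diff_left Phi_jucys_murphy tl_mult_one_left scale_diff_left[symmetric])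
qed

lemma foldr_fixed: "(\<And>f. f \<in> set fs \<Longrightarrow> tl_mult n f v = v) \<Longrightarrow> foldr (tl_mult n) fs v = v"
  by (induction fs) auto

lemma foldr_zero: "(\<And>f. f \<in> set fs \<Longrightarrow> \<exists>c. tl_mult n f v = scale c v) \<Longrightarrow> \<exists>f\<in>set fs. tl_mult n f v = 0 \<Longrightarrow>
  foldr (tl_mult n) fs v = 0"
proof (induction fs)
  case (Cons f fs)
  have "\<exists>c. foldr (tl_mult n) gs v = scale c v" if "set gs \<subseteq> set (f # fs)" for gs
    using that
  proof (induction gs)
    case Nil
    then show ?case by (auto intro: exI[of _ 1])
  next
    case (Cons g gs)
    then obtain c d where "foldr (tl_mult n) gs v = scale c v" "tl_mult n g v = scale d v"
      using \<open>\<And>f'. f' \<in> set (f # fs) \<Longrightarrow> \<exists>c. tl_mult n f' v = scale c v\<close> by (metis insert_subset list.simps(15))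
    then show ?case by auto
  qed
  then obtain c where c: "foldr (tl_mult n) fs v = scale c v" by force
  show ?case
  proof (cases "tl_mult n f v = 0")
    case False
    then show ?thesis using Cons by auto
  qed (simp add: c)
qed simp

text \<open>If the words agree, every factor acts as 1. Otherwise some content of \<open>w\<close>
  differs from that of \<open>t\<close>, and since it belongs to \<open>contents n\<close>, the
  product contains a factor that vanishes on \<open>v\<close>.\<close>

lemma idem_eigvec:
  assumes v: "eigvec n w v" and w: "admissible w n" and t: "t \<in> StdPar2 n"
  shows "tl_mult n (idem n \<Phi> t) v = (if \<forall>i\<in>{1..n}. word t i = w i then v else 0)"
proof -
  note t' = StdPar2_tab[OF t]
  have content: "content t i = word_content (word t) i" if "i \<in> {1..n}" for i
    using content_tab[of i n "word t"] t'(1) that by simp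
  have eq: "tl_mult n (idem n \<Phi> t) v = foldr (tl_mult n) (idem_factors t) v"
    unfolding idem_eq using tl_prod_mult[OF idem_factors_TL eigvec_TL[OF v]] by simp
  show ?thesis
  proof (cases "\<forall>i\<in>{1..n}. word t i = w i")
    case True
    have same: "word_content w i = content t i" if "i \<in> {1..n}" for i
      unfolding content[OF that] by (rule word_content_cong) (use True that in auto)
    have "foldr (tl_mult n) (idem_factors t) v = v"
    proof (rule foldr_fixed)
      fix f assume "f \<in> set (idem_factors t)"
      then obtain c i where "f = idem_factor t c i" "i \<in> {1..n}" "c \<noteq> content t i" unfolding set_idem_factors by blast
      moreover then have "(of_int (word_content w i) - of_int c) / of_int (content t i - c) = (1 :: rat)"
        by (simp add: same divide_simps)
      ultimately show "tl_mult n f v = v" using idem_factor_eigvec[OF v] by simp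
    qed
    then show ?thesis using True eq by simp
  next
    case False
    then obtain i where i: "i \<in> {1..n}" "word_content w i \<noteq> content t i"
      using word_content_inj[OF t'(2) w] content by (metis atLeastAtMost_iff)
    have "foldr (tl_mult n) (idem_factors t) v = 0"
    proof (rule foldr_zero)
      fix f assume "f \<in> set (idem_factors t)"
      then obtain c i where "f = idem_factor t c i" "i \<in> {1..n}" unfolding set_idem_factors by blast
      then show "\<exists>c. tl_mult n f v = scale c v" using idem_factor_eigvec[OF v] by blast
    next
      have "idem_factor t (word_content w i) i \<in> set (idem_factors t)"
        unfolding set_idem_factors using i word_content_contents[OF w] by blast
      moreover have "tl_mult n (idem_factor t (word_content w i) i) v = 0"
        using idem_factor_eigvec[OF v i(1)] by simp
      ultimately show "\<exists>f\<in>set (idem_factors t). tl_mult n f v = 0" by blast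
    qed
    then show ?thesis unfolding eq if_not_P[OF False] .
  qed
qed

text \<open>Checked on joint eigenvectors, on which both idempotents act by 0 or 1.\<close>

lemma idem_orthogonal:
  assumes s: "s \<in> StdPar2 n" and t: "t \<in> StdPar2 n" and x: "x \<in> TL n"
  shows "tl_mult n (idem n \<Phi> s) (tl_mult n (idem n \<Phi> t) x) = (if s = t then tl_mult n (idem n \<Phi> t) x else 0)"
proof (rule TL_eigvec_induct[OF order_refl x])
  fix w v assume w: "admissible w n" and v: "eigvec n w v"
  have "s = t" if "\<forall>i\<in>{1..n}. word s i = w i" "\<forall>i\<in>{1..n}. word t i = w i"
    by (rule StdPar2_eqI[OF s t]) (use that in auto)
  then show "tl_mult n (idem n \<Phi> s) (tl_mult n (idem n \<Phi> t) v) = (if s = t then tl_mult n (idem n \<Phi> t) v else 0)"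
    using idem_eigvec[OF v w s] idem_eigvec[OF v w t] by auto
next
  fix u v :: tl
  assume "tl_mult n (idem n \<Phi> s) (tl_mult n (idem n \<Phi> t) u) = (if s = t then tl_mult n (idem n \<Phi> t) u else 0)"
    "tl_mult n (idem n \<Phi> s) (tl_mult n (idem n \<Phi> t) v) = (if s = t then tl_mult n (idem n \<Phi> t) v else 0)"
  then show "tl_mult n (idem n \<Phi> s) (tl_mult n (idem n \<Phi> t) (u + v)) = (if s = t then tl_mult n (idem n \<Phi> t) (u + v) else 0)"
    by (simp add: tl_mult_add_right)
qed

text \<open>The product ignores the values of \<open>x\<close> outside the diagrams; so it is not necessary to know that
  \<open>C_diagram\<close> is noncrossing.\<close>

lemma TL_mult_right:
  assumes "y \<in> TL n" shows "tl_mult n x y \<in> TL n"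
proof -
  define x' where "x' = (\<lambda>D. if D \<in> diagrams n then x D else 0)"
  have "tl_mult n x y = tl_mult n x' y"
    unfolding tl_mult_def x'_def by (intro ext sum.cong) auto
  moreover have "x' \<in> TL n" by (simp add: x'_def TL_def)
  ultimately show ?thesis using TL_mult assms by simp
qed

lemma f_elem_TL: "f_elem n \<Phi> s a \<in> TL n"
proof -
  have "f_elem n \<Phi> s a = tl_mult n (idem n \<Phi> s) (tl_mult n (basis_elem (C_diagram n s a)) (tl_mult n (idem n \<Phi> a) (tl_one n)))"
    by (simp add: f_elem_def tl_prod_def)
  then show ?thesis using TL_mult_right tl_one_TL by simp
qed

lemma e_elem_TL: "e_elem p n \<Phi> \<in> TL n"
  unfolding e_elem_def by (intro TL_sum idem_TL)

text \<open>\<open>f_elem\<close> starts with the idempotent of \<open>s\<close>, so orthogonality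
  leaves one summand of \<open>e\<close>. This identity removes the idempotents at both ends of
  \<open>U_elem\<close>.\<close>

lemma e_elem_f_elem:
  assumes s: "s \<in> t_class p n"
  shows "tl_mult n (e_elem p n \<Phi>) (f_elem n \<Phi> s a) = f_elem n \<Phi> s a"
proof -
  have sub: "t_class p n \<subseteq> StdPar2 n" by (auto simp: t_class_def)
  then have fin: "finite (t_class p n)" using finite_StdPar2 finite_subset by blast
  define x where "x = tl_mult n (basis_elem (C_diagram n s a)) (tl_mult n (idem n \<Phi> a) (tl_one n))"
  have x: "x \<in> TL n" unfolding x_def by (intro TL_mult_right tl_one_TL)
  have f: "f_elem n \<Phi> s a = tl_mult n (idem n \<Phi> s) x"
    by (simp add: f_elem_def tl_prod_def x_def)
  have "tl_mult n (e_elem p n \<Phi>) (f_elem n \<Phi> s a) =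
      (\<Sum>t\<in>t_class p n. tl_mult n (idem n \<Phi> t) (tl_mult n (idem n \<Phi> s) x))"
    by (simp add: e_elem_def tl_mult_sum_left f)
  also have "\<dots> = (\<Sum>t\<in>t_class p n. if t = s then tl_mult n (idem n \<Phi> s) x else 0)"
    by (intro sum.cong refl idem_orthogonal x) (use sub s in auto)
  also have "\<dots> = tl_mult n (idem n \<Phi> s) x" using fin s by simp
  finally show ?thesis by (simp add: f)
qed

end

section \<open>The action of the KLR elements on the seminormal basis\<close>

text \<open>The lattice path of the word. The start at 1 makes it the axial distance: if
  \<open>k\<close> and \<open>k + 1\<close> lie in different columns, their contents differ by
  \<open>height w (k - 1)\<close> up to sign.\<close>

definition height :: "(nat \<Rightarrow> bool) \<Rightarrow> nat \<Rightarrow> int" where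
  "height w m = int (col1 w m) - int (col2 w m) + 1"

lemma height_0 [simp]: "height w 0 = 1"
  by (simp add: height_def)

lemma height_Suc [simp]: "height w (Suc m) = height w m + (if w (Suc m) then 1 else - 1)"
  by (simp add: height_def)

lemma admissible_height: "admissible w n \<longleftrightarrow> (\<forall>m\<le>n. 1 \<le> height w m)"
  by (auto simp: admissible_def height_def)

lemma height_cong: "(\<And>i. 1 \<le> i \<Longrightarrow> i \<le> m \<Longrightarrow> w i = w' i) \<Longrightarrow> height w m = height w' m"
  by (induction m) auto

section \<open>Permuting the entries of a tableau\<close>

lemma involution_permutes:
  assumes "\<And>x. \<sigma> (\<sigma> x) = x" "\<And>x. x \<notin> A \<Longrightarrow> \<sigma> x = x" shows "\<sigma> permutes A"
  unfolding permutes_def using assms by metis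

lemma act_involution: "(\<And>x. \<sigma> (\<sigma> x) = x) \<Longrightarrow> act t \<sigma> = t \<circ> \<sigma>"
  using inv_equality[of \<sigma> \<sigma>] by (simp add: act_def o_def)

text \<open>On the places where \<open>v\<close> holds, the involution preserves the order; so it
  matches the letters up to \<open>j\<close> of the permuted word with the letters up to
  \<open>\<sigma> j\<close> of the original one.\<close>

lemma count_upto_involution:
  assumes inv: "\<And>x. \<sigma> (\<sigma> x) = x" and perm: "\<sigma> permutes {1..n}"
    and mono: "\<And>x y. x \<in> {1..n} \<Longrightarrow> y \<in> {1..n} \<Longrightarrow> v x \<Longrightarrow> v y \<Longrightarrow> x < y \<Longrightarrow> \<sigma> x < \<sigma> y"
    and j: "j \<in> {1..n}" "v (\<sigma> j)"
  shows "count_upto (\<lambda>i. v (\<sigma> i)) j = count_upto v (\<sigma> j)"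
proof -
  have in_n: "\<sigma> x \<in> {1..n} \<longleftrightarrow> x \<in> {1..n}" for x using permutes_in_image[OF perm] .
  have le: "\<sigma> x \<le> \<sigma> j" if "x \<in> {1..n}" "v (\<sigma> x)" "x \<le> j" for x
  proof (rule ccontr)
    assume "\<not> \<sigma> x \<le> \<sigma> j"
    then have "\<sigma> j < \<sigma> x" by simp
    moreover have "\<sigma> j \<in> {1..n}" "\<sigma> x \<in> {1..n}" using in_n that j by blast+
    ultimately have "\<sigma> (\<sigma> j) < \<sigma> (\<sigma> x)" using mono that j by blast
    then show False using that inv by simp
  qed
  have le': "x \<le> j" if "x \<in> {1..n}" "v (\<sigma> x)" "\<sigma> x \<le> \<sigma> j" for x
  proof (cases "\<sigma> x = \<sigma> j")
    case True
    then have "\<sigma> (\<sigma> x) = \<sigma> (\<sigma> j)" by simp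
    then show ?thesis using inv by simp
  next
    case False
    then have "\<sigma> x < \<sigma> j" using that by simp
    moreover have "\<sigma> j \<in> {1..n}" "\<sigma> x \<in> {1..n}" using in_n that j by blast+
    ultimately have "\<sigma> (\<sigma> x) < \<sigma> (\<sigma> j)" using mono that j by blast
    then show ?thesis using inv by simp
  qed
  have "bij_betw \<sigma> {k \<in> {1..j}. v (\<sigma> k)} {k \<in> {1..\<sigma> j}. v k}"
  proof (rule bij_betw_byWitness[where f' = \<sigma>])
    have j': "\<sigma> j \<in> {1..n}" using in_n j by simp
    show "\<sigma> ` {k \<in> {1..j}. v (\<sigma> k)} \<subseteq> {k \<in> {1..\<sigma> j}. v k}"
    proof
      fix y assume "y \<in> \<sigma> ` {k \<in> {1..j}. v (\<sigma> k)}"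
      then obtain k where k: "y = \<sigma> k" "k \<in> {1..j}" "v (\<sigma> k)" by auto
      then have kn: "k \<in> {1..n}" using j by auto
      then have "\<sigma> k \<in> {1..n}" using in_n by simp
      then show "y \<in> {k \<in> {1..\<sigma> j}. v k}" using le[OF kn] k by auto
    qed
    show "\<sigma> ` {k \<in> {1..\<sigma> j}. v k} \<subseteq> {k \<in> {1..j}. v (\<sigma> k)}"
    proof
      fix y assume "y \<in> \<sigma> ` {k \<in> {1..\<sigma> j}. v k}"
      then obtain k where k: "y = \<sigma> k" "k \<in> {1..\<sigma> j}" "v k" by auto
      then have "k \<in> {1..n}" using j' by auto
      then have "\<sigma> k \<in> {1..n}" using in_n by simp
      then show "y \<in> {k \<in> {1..j}. v (\<sigma> k)}" using le'[of "\<sigma> k"] k inv by auto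
    qed
  qed (simp_all add: inv)
  then show ?thesis unfolding count_upto_card by (rule bij_betw_same_card)
qed

text \<open>\<open>tab\<close> recomputes the rows from the word, so the involution can be moved
  onto the word when it keeps the order inside each column.\<close>

lemma act_tab:
  assumes inv: "\<And>x. \<sigma> (\<sigma> x) = x" and perm: "\<sigma> permutes {1..n}"
    and mono: "\<And>x y. x \<in> {1..n} \<Longrightarrow> y \<in> {1..n} \<Longrightarrow> w x = w y \<Longrightarrow> x < y \<Longrightarrow> \<sigma> x < \<sigma> y"
  shows "act (tab n w) \<sigma> = tab n (w \<circ> \<sigma>)"
  unfolding act_involution[OF inv]
proof
  fix j
  show "(tab n w \<circ> \<sigma>) j = tab n (w \<circ> \<sigma>) j"
  proof (cases "j \<in> {1..n}")
    case True
    then have j': "\<sigma> j \<in> {1..n}" using permutes_in_image[OF perm] by simp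
    show ?thesis
    proof (cases "w (\<sigma> j)")
      case t: True
      have "count_upto (\<lambda>i. w (\<sigma> i)) j = count_upto w (\<sigma> j)"
        by (rule count_upto_involution[of \<sigma> n w j]) (use inv perm True t mono in blast)+
      then show ?thesis using True j' t by (simp add: tab_def o_def)
    next
      case f: False
      have "count_upto (\<lambda>i. \<not> w (\<sigma> i)) j = count_upto (\<lambda>i. \<not> w i) (\<sigma> j)"
        by (rule count_upto_involution[of \<sigma> n "\<lambda>i. \<not> w i" j]) (use inv perm True f mono in blast)+
      then show ?thesis using True j' f by (simp add: tab_def o_def)
    qed
  next
    case False
    then have "\<sigma> j = j" using perm by (auto simp: permutes_def)
    then show ?thesis using False by (auto simp: tab_def restrict_def)
  qed
qed

lemma StdPar2_column_increasing:
  assumes t: "t \<in> StdPar2 n" and ij: "i \<in> {1..n}" "j \<in> {1..n}" "column t i = column t j" "row t i < row t j"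
  shows "i < j"
proof -
  obtain lam where lam: "lam \<in> Par2 n" and "t \<in> Std lam" using t by (auto simp: StdPar2_def)
  moreover have "card lam = n" using lam by (simp add: Par2_def)
  ultimately show ?thesis using ij unfolding Std_def by blast
qed

lemma act_tab_not_standard:
  assumes inv: "\<And>x. \<sigma> (\<sigma> x) = x" and perm: "\<sigma> permutes {1..n}"
    and xy: "x \<in> {1..n}" "y \<in> {1..n}" "w x = w y" "x < y" "\<sigma> y < \<sigma> x"
  shows "act (tab n w) \<sigma> \<notin> StdPar2 n"
proof
  assume std: "act (tab n w) \<sigma> \<in> StdPar2 n"
  have in_n: "\<sigma> x \<in> {1..n}" "\<sigma> y \<in> {1..n}" using permutes_in_image[OF perm] xy by blast+
  have "count_upto v x < count_upto v y" if "v y" for v using count_upto_less xy(4) that by blast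
  then have "column (tab n w) x = column (tab n w) y" "row (tab n w) x < row (tab n w) y"
    using xy by (auto simp: tab_def)
  then have "\<sigma> x < \<sigma> y"
    using StdPar2_column_increasing[OF std in_n] by (simp add: act_involution[OF inv] inv)
  then show False using xy by simp
qed

lemma tab_StdPar2_iff: "tab n w \<in> StdPar2 n \<longleftrightarrow> admissible w n"
  using tab_StdPar2 StdPar2_tab(2)[of "tab n w" n] admissible_cong[of n "word (tab n w)" w] word_tab by blast

section \<open>Dominance and the KLR coefficients on paths\<close>

lemma shape_tab_rows:
  assumes "m \<le> n"
  shows "card {x \<in> shape m (tab n w). fst x \<le> k} = min k (col1 w m) + min k (col2 w m)"
proof -
  have "{x \<in> shape m (tab n w). fst x \<le> k} = {1..min k (col1 w m)} \<times> {1} \<union> {1..min k (col2 w m)} \<times> {2}"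
    unfolding shape_def tab_image[OF assms] by auto
  then show ?thesis by (simp add: card_Un_disjoint card_cartesian_product disjoint_iff)
qed

text \<open>Two-column shapes of the same size are ordered by the length of the second
  column.\<close>

lemma tab_le_iff:
  assumes "admissible w n" "admissible w' n"
  shows "tab_le n (tab n w) (tab n w') \<longleftrightarrow> (\<forall>m\<in>{1..n}. col2 w m \<le> col2 w' m)"
proof -
  have "dominated (shape m (tab n w)) (shape m (tab n w')) \<longleftrightarrow> col2 w m \<le> col2 w' m" if m: "m \<in> {1..n}" for m
  proof -
    have mn: "m \<le> n" using m by simp
    have sum: "col1 w m + col2 w m = m" "col1 w' m + col2 w' m = m" by (simp_all add: col1_col2)
    have le: "col2 w m \<le> col1 w m" "col2 w' m \<le> col1 w' m" using assms mn by (auto simp: admissible_def)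
    have dom: "dominated (shape m (tab n w)) (shape m (tab n w')) \<longleftrightarrow>
        (\<forall>k. min k (col1 w m) + min k (col2 w m) \<le> min k (col1 w' m) + min k (col2 w' m))"
      unfolding dominated_def shape_tab_rows[OF mn] ..
    show ?thesis
    proof
      assume "dominated (shape m (tab n w)) (shape m (tab n w'))"
      \<comment> \<open>Dominance is tested on the first \<open>col2 w m\<close> rows, which are
        complete in the first shape.\<close>
      then have "min (col2 w m) (col1 w m) + min (col2 w m) (col2 w m) \<le> min (col2 w m) (col1 w' m) + min (col2 w m) (col2 w' m)"
        unfolding dom by blast
      then show "col2 w m \<le> col2 w' m" using le by linarith
    next
      assume c: "col2 w m \<le> col2 w' m"
      show "dominated (shape m (tab n w)) (shape m (tab n w'))"
        unfolding dom using c sum le by (intro allI) linarith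
    qed
  qed
  then show ?thesis by (simp add: tab_le_def)
qed

lemma transpose_Suc_mono:
  assumes "x < y" "\<not> (x = k \<and> y = k + 1)" shows "transpose k (k + 1) x < transpose k (k + 1) (y :: nat)"
  using assms by (auto simp: transpose_def)

lemma height_transpose:
  assumes "w k \<noteq> w (k + 1)" "1 \<le> k"
  shows "height (w \<circ> transpose k (k + 1)) m = height w m + (if m = k then (if w k then - 2 else 2) else 0)"
proof (induction m)
  case (Suc m)
  show ?case
  proof (cases "Suc m = k \<or> m = k")
    case False
    then have "transpose k (k + 1) (Suc m) = Suc m" by simp
    then show ?thesis using False Suc by simp
  next
    case True
    then show ?thesis using Suc assms by auto
  qed
qed (use assms in simp)

lemma col2_height: "2 * int (col2 w m) = int m + 1 - height w m" "2 * int (col1 w m) = int m - 1 + height w m"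
  using col1_col2[of w m] by (simp_all add: height_def)

lemma act_tab_transpose:
  assumes k: "1 \<le> k" "k < n" and ne: "w k \<noteq> w (k + 1)"
  shows "act (tab n w) (transpose k (k + 1)) = tab n (w \<circ> transpose k (k + 1))"
proof (rule act_tab)
  show "transpose k (k + 1) permutes {1..n}" using k by (intro permutes_swap_id) auto
  fix x y assume "w x = w y" "x < y"
  then show "transpose k (k + 1) x < transpose k (k + 1) y" using ne by (intro transpose_Suc_mono) auto
qed simp

text \<open>The coefficient \<open>psi_beta\<close> of a peak (\<open>b\<close> true) or a valley
  (\<open>b\<close> false) that starts at height \<open>h\<close>, so that \<open>r\<close> is
  \<open>- h\<close> or \<open>h\<close>. Flipping a peak lengthens the second column, hence goes up
  in the dominance order; this decides the value of \<open>\<alpha>\<close>.\<close>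

definition flip_coeff :: "nat \<Rightarrow> bool \<Rightarrow> int \<Rightarrow> rat" where
  "flip_coeff p b h = (let r = of_int (if b then - h else h); \<alpha> = (if b then (r\<^sup>2 - 1) / r\<^sup>2 else 1) in
     if int p dvd h then \<alpha> / (1 - r)
     else if [if b then - h else h = 1] (mod int p) then \<alpha> * r else \<alpha> * r / (1 - r))"

definition stay_coeff :: "nat \<Rightarrow> bool \<Rightarrow> int \<Rightarrow> rat" where
  "stay_coeff p b h = (if int p dvd h then - 1 / of_int (if b then - h else h) else 0)"

context tl_hom begin

text \<open>Neighbours in one column have \<open>r = 1\<close> and a nonstandard swap, so both terms
  vanish. A peak at height 1 has a nonstandard swap too, but there the factor \<open>r^2 - 1\<close>
  already makes \<open>flip_coeff\<close> zero, so the formula covers it.\<close>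

lemma psi_f_elem:
  assumes x: "is_psi p n \<Phi> k x" and p: "3 \<le> p" and k: "1 \<le> k" "k < n"
    and w: "admissible w n" and a: "a \<in> Std (shape n (tab n w))"
  shows "tl_mult n x (f_elem n \<Phi> (tab n w) a) = (if w k = w (k + 1) then 0 else
    scale (flip_coeff p (w k) (height w (k - 1))) (f_elem n \<Phi> (tab n (w \<circ> transpose k (k + 1))) a) +
    scale (stay_coeff p (w k) (height w (k - 1))) (f_elem n \<Phi> (tab n w) a))"
proof -
  let ?t = "act (tab n w) (transpose k (k + 1))" and ?h = "height w (k - 1)"
  define r where "r = content (tab n w) k - content (tab n w) (k + 1)"
  have psi: "tl_mult n x (f_elem n \<Phi> (tab n w) a) = scale (psi_beta p n k (tab n w)) (f_elem n \<Phi> ?t a) -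
          scale (if [r = 0] (mod int p) then 1 / of_int r else 0) (f_elem n \<Phi> (tab n w) a)"
    using x tab_Std[OF w] a unfolding is_psi_def r_def Let_def by blast
  have r_eq: "r = (if w k = w (k + 1) then 1 else if w k then - ?h else ?h)"
    using k unfolding r_def by (cases k) (auto simp: content_tab word_content_def height_def)
  have inv: "transpose k (k + 1) (transpose k (k + 1) y) = y" for y by simp
  have perm: "transpose k (k + 1) permutes {1..n}" using k by (intro transpose_permutes) auto
  have h1: "1 \<le> ?h" using w k by (simp add: admissible_height)
  have small: "\<not> int p dvd 1" "\<not> int p dvd - 1" using p by (auto dest: zdvd_imp_le)
  show ?thesis
  proof (cases "w k = w (k + 1)")
    case True
    have "?t \<notin> StdPar2 n"
      by (rule act_tab_not_standard[OF inv perm, of k "k + 1"]) (use k True in auto)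
    then have "psi_beta p n k (tab n w) = 0" by (simp add: psi_beta_def Let_def)
    moreover have "\<not> [r = 0] (mod int p)" using True small by (simp add: r_eq cong_0_iff)
    ultimately show ?thesis using True psi by simp
  next
    case False
    let ?w = "w \<circ> transpose k (k + 1)"
    have t: "?t = tab n ?w" by (rule act_tab_transpose[OF k False])
    have dvd: "[r = 0] (mod int p) \<longleftrightarrow> int p dvd ?h" using False by (simp add: r_eq cong_0_iff)
    have hs: "height ?w m = height w m + (if m = k then (if w k then - 2 else 2) else 0)" for m
      by (rule height_transpose[OF False k(1)])
    have hk: "height w k = ?h + (if w k then 1 else - 1)" using k by (cases k) auto
    have adm: "admissible ?w n \<longleftrightarrow> \<not> (w k \<and> ?h = 1)"
    proof
      assume "admissible ?w n"
      then have "1 \<le> height ?w k" using k by (simp add: admissible_height)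
      then show "\<not> (w k \<and> ?h = 1)" using hs[of k] hk by auto
    next
      assume *: "\<not> (w k \<and> ?h = 1)"
      show "admissible ?w n" unfolding admissible_height
      proof (intro allI impI)
        fix m assume "m \<le> n"
        then have "1 \<le> height w m" using w by (simp add: admissible_height)
        then show "1 \<le> height ?w m" using hs[of m] hk h1 * by (auto split: if_splits)
      qed
    qed
    have "psi_beta p n k (tab n w) = flip_coeff p (w k) ?h"
    proof (cases "w k \<and> ?h = 1")
      case True
      then have "?t \<notin> StdPar2 n" unfolding t tab_StdPar2_iff using adm by simp
      then show ?thesis using True small by (simp add: psi_beta_def flip_coeff_def Let_def)
    next
      case f: False
      then have admt: "admissible ?w n" using adm by simp
      then have std: "?t \<in> StdPar2 n" unfolding t tab_StdPar2_iff .
      have c2: "2 * int (col2 ?w m) = 2 * int (col2 w m) - (if m = k then (if w k then - 2 else 2) else 0)" for m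
        unfolding col2_height hs by simp
      have less: "tab_less n ?t (tab n w) \<longleftrightarrow> \<not> w k"
      proof
        assume "tab_less n ?t (tab n w)"
        then have "col2 ?w k \<le> col2 w k" using k admt w unfolding tab_less_def t by (simp add: tab_le_iff)
        then show "\<not> w k" using c2[of k] by auto
      next
        assume nw: "\<not> w k"
        have "tab_le n ?t (tab n w)" unfolding t tab_le_iff[OF admt w]
        proof
          fix m assume "m \<in> {1..n}"
          show "col2 ?w m \<le> col2 w m" using c2[of m] nw by (auto split: if_splits)
        qed
        moreover have "?t \<noteq> tab n w"
        proof
          assume "?t = tab n w"
          then have "word (tab n ?w) k = word (tab n w) k" unfolding t by simp
          then show False using k False by (simp add: word_tab)
        qed
        ultimately show "tab_less n ?t (tab n w)" by (simp add: tab_less_def)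
      qed
      have r: "content (tab n w) k - content (tab n w) (k + 1) = (if w k then - ?h else ?h)"
        using r_eq False by (simp add: r_def)
      have alpha: "psi_alpha n k (tab n w) = (if w k then ((of_int (- ?h))\<^sup>2 - 1) / (of_int (- ?h))\<^sup>2 else 1)"
        unfolding psi_alpha_def Let_def less r by simp
      show ?thesis unfolding psi_beta_def Let_def flip_coeff_def alpha r
        using std by (simp add: cong_0_iff)
    qed
    moreover have "- scale (if [r = 0] (mod int p) then 1 / of_int r else 0) y = scale (stay_coeff p (w k) ?h) y" for y :: tl
      unfolding dvd stay_coeff_def using False by (simp add: r_eq scale_minus_left)
    ultimately show ?thesis using psi False unfolding t by (metis (no_types, lifting) diff_conv_add_uminus)
  qed
qed

end

section \<open>Simultaneous flips at separated positions\<close>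

text \<open>The transpositions at all positions of \<open>S\<close> at once, written as toggling the
  letters \<open>k\<close> and \<open>k + 1\<close>; this is a swap where the two letters
  differ.\<close>

definition flips :: "nat set \<Rightarrow> (nat \<Rightarrow> bool) \<Rightarrow> nat \<Rightarrow> bool" where
  "flips S w x \<longleftrightarrow> w x \<noteq> (x \<in> S \<or> 0 < x \<and> x - 1 \<in> S)"

text \<open>Flips at such positions move disjoint pairs of letters, and none of them changes the
  height at which another one starts.\<close>

definition sparse :: "nat set \<Rightarrow> bool" where
  "sparse S \<longleftrightarrow> 0 \<notin> S \<and> (\<forall>k\<in>S. Suc k \<notin> S)"

lemma sparse_subset: "sparse S \<Longrightarrow> R \<subseteq> S \<Longrightarrow> sparse R"
  by (auto simp: sparse_def)

lemma flips_empty [simp]: "flips {} w = w"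
  by (auto simp: flips_def)

lemma flips_flips [simp]: "flips S (flips S w) = w"
  by (auto simp: flips_def)

lemma height_flips:
  assumes "sparse S" "\<And>k. k \<in> S \<Longrightarrow> w k \<noteq> w (k + 1)"
  shows "height (flips S w) m = height w m + (if m \<in> S then (if w m then - 2 else 2) else 0)"
proof (induction m)
  case 0
  then show ?case using assms(1) by (simp add: sparse_def)
next
  case (Suc m)
  show ?case
  proof (cases "m \<in> S")
    case True
    then have "Suc m \<notin> S" "w (Suc m) = (\<not> w m)" using assms by (auto simp: sparse_def)
    then show ?thesis using Suc True by (auto simp: flips_def)
  next
    case False
    then show ?thesis using Suc by (auto simp: flips_def)
  qed
qed

lemma flips_insert:
  assumes "sparse (insert k S)" "k \<notin> S" "w k \<noteq> w (k + 1)"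
  shows "flips S w \<circ> transpose k (k + 1) = flips (insert k S) w"
proof
  fix x
  have k: "Suc k \<notin> S" "0 < k" "k - 1 \<notin> S" using assms(1,2) by (auto simp: sparse_def)
  consider "x = k" | "x = k + 1" | "x \<noteq> k" "x \<noteq> k + 1" by blast
  then show "(flips S w \<circ> transpose k (k + 1)) x = flips (insert k S) w x"
  proof cases
    case 3
    then have "x - 1 \<noteq> k \<or> x = 0" by auto
    then show ?thesis using 3 by (auto simp: flips_def)
  qed (use k assms(2,3) in \<open>auto simp: flips_def\<close>)
qed

locale klr_action = tl_hom +
  fixes p :: nat and \<psi> :: "nat \<Rightarrow> tl" and a :: tableau
  assumes p3: "3 \<le> p" and psi: "\<And>k. 1 \<le> k \<Longrightarrow> k < n \<Longrightarrow> is_psi p n \<Phi> k (\<psi> k)"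
begin

definition f :: "(nat \<Rightarrow> bool) \<Rightarrow> tl" where
  "f w = f_elem n \<Phi> (tab n w) a"

text \<open>The condition on \<open>a\<close> fixes the shape, which a path determines by its final
  height (\<open>ok_height\<close>).\<close>

definition ok :: "(nat \<Rightarrow> bool) \<Rightarrow> bool" where
  "ok w \<longleftrightarrow> admissible w n \<and> a \<in> Std (shape n (tab n w))"

definition run :: "nat list \<Rightarrow> tl \<Rightarrow> tl" where
  "run ks y = foldr (\<lambda>k. tl_mult n (\<psi> k)) ks y"

lemma run_simps [simp]: "run [] y = y" "run (k # ks) y = tl_mult n (\<psi> k) (run ks y)"
  "run (ks @ ls) y = run ks (run ls y)"
  by (simp_all add: run_def)

lemma run_linear: "run ks (x + y) = run ks x + run ks y" "run ks (scale c x) = scale c (run ks x)"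
  "run ks 0 = 0"
  by (induction ks) (simp_all add: tl_mult_add_right)

lemma run_sum: "run ks (\<Sum>i\<in>A. g i) = (\<Sum>i\<in>A. run ks (g i))"
  by (induction ks) (simp_all add: tl_mult_sum_right)

lemma f_TL: "f w \<in> TL n"
  by (simp add: f_def f_elem_TL)

lemma psi_TL: "1 \<le> k \<Longrightarrow> k < n \<Longrightarrow> \<psi> k \<in> TL n"
  using psi by (auto simp: is_psi_def)

lemma psi_f:
  assumes "ok w" "1 \<le> k" "k < n"
  shows "tl_mult n (\<psi> k) (f w) = (if w k = w (k + 1) then 0 else
    scale (flip_coeff p (w k) (height w (k - 1))) (f (w \<circ> transpose k (k + 1))) +
    scale (stay_coeff p (w k) (height w (k - 1))) (f w))"
  unfolding f_def using assms psi_f_elem[OF psi p3] by (simp add: ok_def)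

lemma ok_height:
  assumes "ok w" "admissible w' n" "height w' n = height w n"
  shows "ok w'"
proof -
  have "col1 w' n = col1 w n" "col2 w' n = col2 w n"
    using assms(3) col1_col2[of w n] col1_col2[of w' n] by (simp_all add: height_def)
  then have "shape n (tab n w') = shape n (tab n w)" by (simp add: shape_tab)
  then show ?thesis using assms by (simp add: ok_def)
qed

lemma ok_flips:
  assumes w: "ok w" and S: "sparse S" "\<And>k. k \<in> S \<Longrightarrow> k < n"
    and h: "\<And>k. k \<in> S \<Longrightarrow> w k \<noteq> w (k + 1) \<and> (w k \<longrightarrow> 1 < height w (k - 1))"
  shows "ok (flips S w)"
proof (rule ok_height[OF w])
  have hf: "height (flips S w) m = height w m + (if m \<in> S then (if w m then - 2 else 2) else 0)" for m
    by (rule height_flips[OF S(1)]) (use h in blast)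
  show "height (flips S w) n = height w n" using hf[of n] S by auto
  show "admissible (flips S w) n" unfolding admissible_height
  proof (intro allI impI)
    fix m assume "m \<le> n"
    then have 1: "1 \<le> height w m" using w by (simp add: ok_def admissible_height)
    show "1 \<le> height (flips S w) m"
    proof (cases "m \<in> S \<and> w m")
      case True
      then have "height w m = height w (m - 1) + 1" using S by (cases m) (auto simp: sparse_def)
      then show ?thesis using h[of m] True hf[of m] by simp
    next
      case False
      then show ?thesis using hf[of m] 1 by auto
    qed
  qed
qed

text \<open>A peak at height 1 cannot be flipped, but its coefficient \<open>flip_coeff p True 1\<close> is 0; so for a
  single position no bound on \<open>h\<close> is necessary.\<close>

lemma layer:
  assumes "distinct ks" "sparse (set ks)" "ok w"
    and ks: "\<And>k. k \<in> set ks \<Longrightarrow> k < n \<and> w k = b \<and> w (k + 1) = (\<not> b) \<and> height w (k - 1) = h"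
    and h: "b \<longrightarrow> 1 < h \<or> length ks \<le> 1"
  shows "run ks (f w) = (\<Sum>S\<in>Pow (set ks).
    scale (stay_coeff p b h ^ card (set ks - S) * flip_coeff p b h ^ card S) (f (flips S w)))"
  using assms
proof (induction ks)
  case (Cons k ks)
  let ?c = "\<lambda>A S. stay_coeff p b h ^ card (A - S) * flip_coeff p b h ^ card S"
  let ?A = "set ks"
  have k: "1 \<le> k" "k < n" "w k = b" "w (k + 1) = (\<not> b)" "height w (k - 1) = h"
    using Cons.prems(2) Cons.prems(4)[of k] by (auto simp: sparse_def)
  have kA: "k \<notin> ?A" "k + 1 \<notin> ?A" "k - 1 \<notin> ?A" using Cons.prems(1,2) k(1) by (auto simp: sparse_def)
  have spA: "sparse ?A" by (rule sparse_subset[OF Cons.prems(2)]) auto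
  have IH: "run ks (f w) = (\<Sum>S\<in>Pow ?A. scale (?c ?A S) (f (flips S w)))"
    by (rule Cons.IH[OF _ spA Cons.prems(3)]) (use Cons.prems(1,4,5) in auto)
  have step: "tl_mult n (\<psi> k) (f (flips S w)) =
      scale (flip_coeff p b h) (f (flips (insert k S) w)) + scale (stay_coeff p b h) (f (flips S w))"
    if S: "S \<in> Pow ?A" for S
  proof -
    have sp: "sparse S" using sparse_subset[OF spA] S by simp
    have letters: "flips S w k = b" "flips S w (k + 1) = (\<not> b)"
      using kA k S by (auto simp: flips_def)
    have okS: "ok (flips S w)"
    proof (cases "length (k # ks) \<le> 1")
      case True
      then show ?thesis using S Cons.prems(3) by simp
    next
      case False
      show ?thesis
      proof (rule ok_flips[OF Cons.prems(3) sp])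
        fix l assume "l \<in> S"
        then have l: "l \<in> set (k # ks)" using S by auto
        from Cons.prems(4)[OF l]
        show "l < n" "w l \<noteq> w (l + 1) \<and> (w l \<longrightarrow> 1 < height w (l - 1))"
          using Cons.prems(5) False by auto
      qed
    qed
    have "height (flips S w) (k - 1) = h"
    proof -
      have "w l \<noteq> w (l + 1)" if "l \<in> S" for l using Cons.prems(4)[of l] that S by auto
      then show ?thesis using height_flips[OF sp, of w "k - 1"] kA S k(5) by auto
    qed
    moreover have "flips S w \<circ> transpose k (k + 1) = flips (insert k S) w"
      by (rule flips_insert) (use sparse_subset[OF Cons.prems(2), of "insert k S"] S kA k in auto)
    ultimately show ?thesis using psi_f[OF okS k(1,2)] letters by simp
  qed
  have "run (k # ks) (f w) = (\<Sum>S\<in>Pow ?A. scale (?c ?A S) (tl_mult n (\<psi> k) (f (flips S w))))"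
    by (simp add: IH tl_mult_sum_right)
  also have "\<dots> = (\<Sum>S\<in>Pow ?A. scale (?c (set (k # ks)) (insert k S)) (f (flips (insert k S) w)) +
      scale (?c (set (k # ks)) S) (f (flips S w)))"
  proof (rule sum.cong)
    fix S assume S: "S \<in> Pow ?A"
    then have fS: "finite S" "k \<notin> S" using kA finite_subset by auto
    have "set (k # ks) - S = insert k (?A - S)" using fS by auto
    then have "card (set (k # ks) - S) = Suc (card (?A - S))" using kA by simp
    moreover have "set (k # ks) - insert k S = ?A - S" using kA by auto
    ultimately have "?c (set (k # ks)) (insert k S) = ?c ?A S * flip_coeff p b h"
      "?c (set (k # ks)) S = ?c ?A S * stay_coeff p b h" using fS by simp_all
    then show "scale (?c ?A S) (tl_mult n (\<psi> k) (f (flips S w))) =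
      scale (?c (set (k # ks)) (insert k S)) (f (flips (insert k S) w)) + scale (?c (set (k # ks)) S) (f (flips S w))"
      by (simp only: step[OF S] scale_add_right scale_scale)
  qed simp
  also have "\<dots> = (\<Sum>S\<in>insert k ` Pow ?A. scale (?c (set (k # ks)) S) (f (flips S w))) +
      (\<Sum>S\<in>Pow ?A. scale (?c (set (k # ks)) S) (f (flips S w)))"
  proof -
    have "inj_on (insert k) (Pow ?A)" using kA(1) by (auto simp: inj_on_def)
    then show ?thesis by (simp only: sum.distrib sum.reindex o_def)
  qed
  also have "\<dots> = (\<Sum>S\<in>Pow (set (k # ks)). scale (?c (set (k # ks)) S) (f (flips S w)))"
    using kA(1) by (subst sum.union_disjoint[symmetric]) (auto simp: Pow_insert Un_commute)
  finally show ?case .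
qed simp

text \<open>Away from the walls \<open>stay_coeff\<close> is zero, and of all subsets only the full
  one survives.\<close>

lemma layer_all:
  assumes "distinct ks" "sparse (set ks)" "ok w"
    and "\<And>k. k \<in> set ks \<Longrightarrow> k < n \<and> w k = b \<and> w (k + 1) = (\<not> b) \<and> height w (k - 1) = h"
    and "b \<longrightarrow> 1 < h \<or> length ks \<le> 1" and h: "\<not> int p dvd h"
  shows "run ks (f w) = scale (flip_coeff p b h ^ length ks) (f (flips (set ks) w))"
proof -
  have "(\<Sum>S\<in>Pow (set ks). scale (stay_coeff p b h ^ card (set ks - S) * flip_coeff p b h ^ card S) (f (flips S w))) =
    (\<Sum>S\<in>{set ks}. scale (stay_coeff p b h ^ card (set ks - S) * flip_coeff p b h ^ card S) (f (flips S w)))"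
  proof (rule sum.mono_neutral_right)
    show "\<forall>S\<in>Pow (set ks) - {set ks}. scale (stay_coeff p b h ^ card (set ks - S) * flip_coeff p b h ^ card S) (f (flips S w)) = 0"
    proof
      fix S assume "S \<in> Pow (set ks) - {set ks}"
      then have "set ks - S \<noteq> {}" by auto
      then have "0 < card (set ks - S)" by (simp add: card_gt_0_iff)
      then have z: "(0::rat) ^ card (set ks - S) = 0" by (rule zero_power)
      then show "scale (stay_coeff p b h ^ card (set ks - S) * flip_coeff p b h ^ card S) (f (flips S w)) = 0"
        by (simp only: stay_coeff_def h if_False z mult_zero_left scale_zero_left)
    qed
  qed auto
  then show ?thesis using layer[OF assms(1-5)] distinct_card[OF assms(1)] by simp
qed

text \<open>The other positions of the layer have distance at least 2 from \<open>k\<close> and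
  leave the equal letters at \<open>k\<close> and \<open>k + 1\<close> alone, so
  \<open>\<psi> k\<close> meets them in every term and gives zero.\<close>

lemma run_kill:
  assumes "sparse (set ks)" "\<And>l. l \<in> set ks \<Longrightarrow> l < n" "k \<in> set ks" "ok u" "u k = u (k + 1)"
  shows "run ks (f u) = 0"
  using assms
proof (induction ks arbitrary: u rule: rev_induct)
  case (snoc l ks)
  have l: "1 \<le> l" "l < n" using snoc.prems(1,2) by (auto simp: sparse_def)
  show ?case
  proof (cases "u l = u (l + 1)")
    case True
    then show ?thesis using psi_f[OF snoc.prems(4) l] by (simp add: run_linear)
  next
    case False
    then have "l \<noteq> k" using snoc.prems(5) by auto
    then have k: "k \<in> set ks" using snoc.prems(3) by auto
    have sp: "sparse (set ks)" by (rule sparse_subset[OF snoc.prems(1)]) auto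
    have kl: "k + 1 \<noteq> l" "l + 1 \<noteq> k" using snoc.prems(1) k by (auto simp: sparse_def)
    let ?u = "u \<circ> transpose l (l + 1)"
    have "scale (flip_coeff p (u l) (height u (l - 1))) (run ks (f ?u)) = 0"
    \<comment> \<open>Only for such a peak does the flip leave the admissible words, and its
      coefficient is zero.\<close>
    proof (cases "u l \<and> height u (l - 1) = 1")
      case True
      have "\<not> int p dvd 1" using p3 by (auto dest: zdvd_imp_le)
      then have "flip_coeff p (u l) (height u (l - 1)) = 0" using True by (simp add: flip_coeff_def Let_def)
      then show ?thesis by simp
    next
      case f: False
      have "1 \<le> height u (l - 1)" using snoc.prems(4) l by (simp add: ok_def admissible_height)
      then have "ok (flips {l} u)" using f False l
        by (intro ok_flips[OF snoc.prems(4)]) (auto simp: sparse_def)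
      moreover have "flips {l} u = ?u"
        using flips_insert[of l "{}" u] False l by (simp add: sparse_def)
      ultimately have "ok ?u" by simp
      moreover have "?u k = ?u (k + 1)" using snoc.prems(5) kl \<open>l \<noteq> k\<close> by (simp add: transpose_def)
      ultimately have "run ks (f ?u) = 0" using snoc.IH[OF sp _ k] snoc.prems(2) by simp
      then show ?thesis by simp
    qed
    moreover have "run ks (f u) = 0" using snoc.IH[OF sp _ k snoc.prems(4,5)] snoc.prems(2) by simp
    ultimately show ?thesis using psi_f[OF snoc.prems(4) l] False by (simp add: run_linear)
  qed
qed simp

end

section \<open>Products of the coefficients\<close>

text \<open>The sign of the valley flips on one side of the wall, one factor -1 for each. It arises
  on both sides, so only its square enters.\<close>

definition layer_sign :: "nat \<Rightarrow> rat" where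
  "layer_sign p = (\<Prod>g\<in>{1..<p}. (- 1) ^ (p - g))"

lemma sign_square: "layer_sign p * layer_sign p = 1"
  unfolding layer_sign_def prod.distrib[symmetric] by (simp add: power_mult_distrib[symmetric])

text \<open>\<open>x g\<close> has exponent \<open>p - g\<close> in its own factor and
  \<open>p - g - 1\<close> in the denominator of the next, so it survives exactly once.\<close>

lemma telescope:
  fixes x :: "nat \<Rightarrow> rat"
  assumes "\<And>g. g \<le> p \<Longrightarrow> x g \<noteq> 0"
  shows "(\<Prod>g\<in>{1..<p}. (x g / x (g - 1)) ^ (p - g)) = (\<Prod>g\<in>{1..<p}. x g) / x 0 ^ (p - 1)"
  using assms
proof (induction p)
  case (Suc p)
  show ?case
  proof (cases "p = 0")
    case False
    have tel: "(\<Prod>g\<in>{1..q}. x g / x (g - 1)) = x q / x 0" if "q \<le> p" for q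
      using that Suc.prems
    proof (induction q)
      case (Suc q)
      then show ?case by (simp add: prod.nat_ivl_Suc')
    qed simp
    have "(\<Prod>g\<in>{1..<Suc p}. (x g / x (g - 1)) ^ (Suc p - g)) = (\<Prod>g\<in>{1..<Suc p}. (x g / x (g - 1)) ^ (p - g) * (x g / x (g - 1)))"
      by (rule prod.cong) (auto simp: Suc_diff_le)
    also have "\<dots> = (\<Prod>g\<in>{1..<Suc p}. (x g / x (g - 1)) ^ (p - g)) * (\<Prod>g\<in>{1..p}. x g / x (g - 1))"
      by (simp only: prod.distrib atLeastLessThanSuc_atLeastAtMost)
    also have "(\<Prod>g\<in>{1..<Suc p}. (x g / x (g - 1)) ^ (p - g)) = (\<Prod>g\<in>{1..<p}. (x g / x (g - 1)) ^ (p - g))"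
      using False by (simp add: prod.atLeastLessThan_Suc)
    also have "\<dots> = (\<Prod>g\<in>{1..<p}. x g) / x 0 ^ (p - 1)" using Suc by simp
    also have "(\<Prod>g\<in>{1..p}. x g / x (g - 1)) = x p / x 0" using tel by simp
    also have "(\<Prod>g\<in>{1..<p}. x g) / x 0 ^ (p - 1) * (x p / x 0) = (\<Prod>g\<in>{1..<Suc p}. x g) / x 0 ^ (Suc p - 1)"
      using False by (cases p) (simp_all add: prod.atLeastLessThan_Suc)
    finally show ?thesis .
  qed simp
qed simp

text \<open>For \<open>g > 1\<close> the denominators contain \<open>y g\<close> once more often
  than the numerators; \<open>y 1\<close> occurs in a numerator only.\<close>

lemma telescope_down:
  fixes y :: "nat \<Rightarrow> rat"
  assumes "\<And>g. 1 \<le> g \<Longrightarrow> g \<le> p \<Longrightarrow> y g \<noteq> 0" and p: "1 \<le> p"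
  shows "(\<Prod>g\<in>{1..<p}. (y g / y (g + 1)) ^ (p - g)) = y 1 ^ p / (\<Prod>g\<in>{1..p}. y g)"
  using p assms(1)
proof (induction p rule: dec_induct)
  case base
  then show ?case by simp
next
  case (step p)
  have tel: "(\<Prod>g\<in>{1..q}. y g / y (g + 1)) = y 1 / y (q + 1)" if "q \<le> p" for q
    using that step.prems
  proof (induction q)
    case 0
    then show ?case using step.hyps by simp
  next
    case (Suc q)
    then show ?case by (simp add: prod.nat_ivl_Suc')
  qed
  have "(\<Prod>g\<in>{1..<Suc p}. (y g / y (g + 1)) ^ (Suc p - g)) = (\<Prod>g\<in>{1..<Suc p}. (y g / y (g + 1)) ^ (p - g) * (y g / y (g + 1)))"
    by (rule prod.cong) (auto simp: Suc_diff_le)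
  also have "\<dots> = (\<Prod>g\<in>{1..<Suc p}. (y g / y (g + 1)) ^ (p - g)) * (\<Prod>g\<in>{1..p}. y g / y (g + 1))"
    by (simp only: prod.distrib atLeastLessThanSuc_atLeastAtMost)
  also have "(\<Prod>g\<in>{1..<Suc p}. (y g / y (g + 1)) ^ (p - g)) = (\<Prod>g\<in>{1..<p}. (y g / y (g + 1)) ^ (p - g))"
    using step.hyps by (simp add: prod.atLeastLessThan_Suc)
  also have "\<dots> = y 1 ^ p / (\<Prod>g\<in>{1..p}. y g)" using step by simp
  also have "(\<Prod>g\<in>{1..p}. y g / y (g + 1)) = y 1 / y (p + 1)" using tel by simp
  finally show ?case by (simp add: prod.nat_ivl_Suc')
qed

text \<open>\<open>Q\<close> is the height of the path of \<open>f(s)\<close> before the window and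
  will be identified with rho; \<open>H\<close> is the height of the wall.\<close>

locale flip_coefficients =
  fixes p :: nat and Q :: int
  assumes p3: "3 \<le> p" and odd: "odd p" and Q: "1 \<le> Q"
begin

definition H :: int where "H = Q * int p"

lemma H_ge: "int p \<le> H"
  using Q p3 by (simp add: H_def mult_le_cancel_right1)

lemma cong_g: "int p dvd H + g \<longleftrightarrow> int p dvd g" "[H + g = 1] (mod int p) \<longleftrightarrow> int p dvd g - 1"
  "[- (H + g) = 1] (mod int p) \<longleftrightarrow> int p dvd g + 1"
proof -
  have H: "int p dvd H" by (simp add: H_def)
  show "int p dvd H + g \<longleftrightarrow> int p dvd g" using H by (simp add: dvd_add_right_iff)
  have "H + g - 1 = H + (g - 1)" "- (H + g) - 1 = - (H + (g + 1))" by simp_all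
  then show "[H + g = 1] (mod int p) \<longleftrightarrow> int p dvd g - 1" "[- (H + g) = 1] (mod int p) \<longleftrightarrow> int p dvd g + 1"
    using H by (simp_all only: cong_iff_dvd_diff dvd_add_right_iff dvd_minus_iff)
qed

lemma dvd_small: "\<bar>g\<bar> < int p \<Longrightarrow> int p dvd g \<longleftrightarrow> g = 0"
  using dvd_imp_le_int[of g "int p"] by auto

lemma dvd_up: "1 \<le> g \<Longrightarrow> g < p \<Longrightarrow> \<not> int p dvd int g" "1 \<le> g \<Longrightarrow> g < p \<Longrightarrow> int p dvd int g - 1 \<longleftrightarrow> g = 1"
  "1 \<le> g \<Longrightarrow> g < p \<Longrightarrow> int p dvd int g + 1 \<longleftrightarrow> g = p - 1"
proof -
  assume g: "1 \<le> g" "g < p"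
  show "\<not> int p dvd int g" using g dvd_small[of "int g"] by simp
  show "int p dvd int g - 1 \<longleftrightarrow> g = 1" using g dvd_small[of "int g - 1"] by auto
  show "int p dvd int g + 1 \<longleftrightarrow> g = p - 1"
  proof (cases "g = p - 1")
    case False
    then show ?thesis using g dvd_small[of "int g + 1"] by auto
  qed (use g in auto)
qed

lemma dvd_down: "1 \<le> g \<Longrightarrow> g < p \<Longrightarrow> \<not> int p dvd - int g" "1 \<le> g \<Longrightarrow> g < p \<Longrightarrow> int p dvd - int g - 1 \<longleftrightarrow> g = p - 1"
  "1 \<le> g \<Longrightarrow> g < p \<Longrightarrow> int p dvd - int g + 1 \<longleftrightarrow> g = 1"
proof -
  assume g: "1 \<le> g" "g < p"
  have "- int g - 1 = - (int g + 1)" "- int g + 1 = - (int g - 1)" by simp_all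
  then show "\<not> int p dvd - int g" "int p dvd - int g - 1 \<longleftrightarrow> g = p - 1" "int p dvd - int g + 1 \<longleftrightarrow> g = 1"
    using dvd_up[OF g] by (simp_all only: dvd_minus_iff not_False_eq_True)
qed

abbreviation T where "T h \<equiv> flip_coeff p True h"
abbreviation F where "F h \<equiv> flip_coeff p False h"

lemma p_not_dvd: "\<not> int p dvd 1" "\<not> int p dvd 2"
  using p3 by (auto dest: zdvd_imp_le)

lemma not_cong: "int p dvd h \<Longrightarrow> \<not> [h = 1] (mod int p)" "int p dvd h \<Longrightarrow> \<not> [- h = 1] (mod int p)"
  "[h = 1] (mod int p) \<Longrightarrow> \<not> [- h = 1] (mod int p)"
proof -
  show "\<not> [h = 1] (mod int p)" "\<not> [- h = 1] (mod int p)" if "int p dvd h"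
    using that p_not_dvd by (simp_all add: cong_iff_dvd_diff dvd_diff_right_iff)
  show "\<not> [- h = 1] (mod int p)" if "[h = 1] (mod int p)"
  proof
    assume "[- h = 1] (mod int p)"
    then have "[h + - h = 1 + 1] (mod int p)" by (rule cong_add[OF that])
    then show False using p_not_dvd by (simp add: cong_iff_dvd_diff)
  qed
qed

lemma F_value:
  assumes "1 \<le> h"
  shows "F h = (if int p dvd h then - 1 / (of_int h - 1) else if [h = 1] (mod int p) then of_int h
    else - (of_int h / (of_int h - 1)))"
  by (simp add: flip_coeff_def Let_def minus_divide_right)

text \<open>The scalar of flipping a peak and flipping the resulting valley back. It is 1 in
  general; the exceptions are the residues 0, 1 and -1, which \<open>psi_beta\<close> treats
  separately for \<open>h\<close> or \<open>- h\<close>.\<close>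

lemma T_F_value:
  assumes h: "1 \<le> h"
  shows "T h * F h = (if int p dvd h then - 1 / (of_int h)\<^sup>2 else if [h = 1] (mod int p) then 1 - of_int h
    else if [- h = 1] (mod int p) then 1 + of_int h else 1)"
proof -
  define x :: rat where "x = of_int h"
  have x: "0 < x" "x \<noteq> 0" "1 + x \<noteq> 0" using h by (auto simp: x_def)
  have ne1: "1 - x \<noteq> 0" if "\<not> [h = 1] (mod int p)"
  proof
    assume "1 - x = 0"
    then have "h = 1" by (simp add: x_def)
    then show False using that by simp
  qed
  consider "int p dvd h" | "\<not> int p dvd h" "[h = 1] (mod int p)" | "\<not> int p dvd h" "\<not> [h = 1] (mod int p)" "[- h = 1] (mod int p)"
    | "\<not> int p dvd h" "\<not> [h = 1] (mod int p)" "\<not> [- h = 1] (mod int p)" by blast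
  then show ?thesis
  proof cases
    case 1
    then have "T h * F h = ((x\<^sup>2 - 1) / x\<^sup>2 / (1 + x)) * (1 / (1 - x))"
      by (simp add: flip_coeff_def Let_def x_def)
    also have "\<dots> = - 1 / x\<^sup>2" using x ne1[OF not_cong(1)[OF 1]] by (simp add: divide_simps power2_eq_square) algebra
    finally show ?thesis using 1 by (simp add: x_def)
  next
    case 2
    then have "T h * F h = ((x\<^sup>2 - 1) / x\<^sup>2 * - x / (1 + x)) * x"
      using not_cong(3)[OF 2(2)] by (simp add: flip_coeff_def Let_def x_def)
    also have "\<dots> = 1 - x" using x by (simp add: divide_simps power2_eq_square) algebra
    finally show ?thesis using 2 by (simp add: x_def)
  next
    case 3
    then have "T h * F h = ((x\<^sup>2 - 1) / x\<^sup>2 * - x) * (x / (1 - x))"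
      by (simp add: flip_coeff_def Let_def x_def)
    also have "\<dots> = 1 + x" using x ne1[OF 3(2)] by (simp add: divide_simps power2_eq_square) algebra
    finally show ?thesis using 3 by (simp add: x_def)
  next
    case 4
    then have "T h * F h = ((x\<^sup>2 - 1) / x\<^sup>2 * - x / (1 + x)) * (x / (1 - x))"
      by (simp add: flip_coeff_def Let_def x_def)
    also have "\<dots> = 1" using x ne1[OF 4(2)] by (simp add: divide_simps power2_eq_square) algebra
    finally show ?thesis using 4 by (simp add: x_def)
  qed
qed

text \<open>Between two walls only the heights next to a wall are exceptional: \<open>g = 1\<close>,
  with \<open>p - 1\<close> flips, and \<open>g = p - 1\<close>, with a single one.\<close>

lemma two_factor_prod:
  fixes A B :: rat
  assumes "\<And>g. 1 \<le> g \<Longrightarrow> g < p \<Longrightarrow> c g = (if g = 1 then A else if g = p - 1 then B else 1)"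
  shows "(\<Prod>g\<in>{1..<p}. c g ^ (p - g)) = A ^ (p - 1) * B"
proof -
  have "(\<Prod>g\<in>{1..<p}. c g ^ (p - g)) = (\<Prod>g\<in>{1..<p}. (if g = 1 then A ^ (p - 1) else 1) * (if g = p - 1 then B else 1))"
    by (rule prod.cong) (use assms p3 in auto)
  also have "\<dots> = A ^ (p - 1) * B" using p3 by (simp add: prod.distrib)
  finally show ?thesis .
qed

lemma even_power: "(- x :: rat) ^ (p - 1) = x ^ (p - 1)" "(- x) ^ p = - (x ^ p)"
  using odd by simp_all

abbreviation HH :: rat where "HH \<equiv> of_int H"

text \<open>The height \<open>H + 1\<close> is 1 mod \<open>p\<close> and gives \<open>- H\<close>;
  the height \<open>H + p - 1\<close> is -1 mod \<open>p\<close> and gives \<open>H + p\<close>. The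
  sign disappears as \<open>p - 1\<close> is even.\<close>

lemma prod_up: "(\<Prod>g\<in>{1..<p}. (T (H + int g) * F (H + int g)) ^ (p - g)) = HH ^ (p - 1) * (HH + of_nat p)"
proof -
  have "(\<Prod>g\<in>{1..<p}. (T (H + int g) * F (H + int g)) ^ (p - g)) = (- HH) ^ (p - 1) * (HH + of_nat p)"
  proof (rule two_factor_prod)
    fix g assume g: "1 \<le> g" "g < p"
    have "1 \<le> H + int g" using H_ge g by linarith
    from T_F_value[OF this] show "T (H + int g) * F (H + int g) = (if g = 1 then - HH else if g = p - 1 then HH + of_nat p else 1)"
      unfolding cong_g using dvd_up[OF g] p3 by auto
  qed
  then show ?thesis by (simp only: even_power)
qed

lemma prod_down: "(\<Prod>g\<in>{1..<p}. (T (H - int g) * F (H - int g)) ^ (p - g)) = HH ^ (p - 1) * - (HH - of_nat p)"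
proof (rule two_factor_prod)
  fix g assume g: "1 \<le> g" "g < p"
  have e: "H - int g = H + - int g" by simp
  have "1 \<le> H - int g" using H_ge g by linarith
  from T_F_value[OF this] show "T (H - int g) * F (H - int g) = (if g = 1 then HH else if g = p - 1 then - (HH - of_nat p) else 1)"
    unfolding e cong_g using dvd_down[OF g] p3 by auto
qed

lemma HH_Q: "HH = of_int Q * of_nat p" "of_int Q \<noteq> (0 :: rat)" "of_nat p \<noteq> (0 :: rat)" "HH \<noteq> 0" "0 < HH"
proof -
  show 1: "HH = of_int Q * of_nat p" by (simp add: H_def)
  show 2: "of_int Q \<noteq> (0 :: rat)" "of_nat p \<noteq> (0 :: rat)" using Q p3 by auto
  show "HH \<noteq> 0" using 1 2 by simp
  show "0 < HH" using H_ge p3 by simp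
qed

lemma H_power: "HH ^ p = HH ^ (p - 1) * HH"
  using p3 by (cases p) simp_all

lemma dvd_H: "int p dvd H"
  by (simp add: H_def)

text \<open>The diagonal entry of a path that rises first: the layers there and back give
  \<open>H ^ (p - 1) * (H + p)\<close>, and the \<open>p\<close> peaks kept at the wall give
  \<open>1 / H ^ p\<close>.\<close>

lemma stay_True: "(\<Prod>g\<in>{1..<p}. (T (H + int g) * F (H + int g)) ^ (p - g)) * stay_coeff p True H ^ p = (of_int Q + 1) / of_int Q"
proof -
  have "stay_coeff p True H = 1 / HH" using dvd_H by (simp add: stay_coeff_def)
  then have s: "stay_coeff p True H ^ p = 1 / (HH ^ (p - 1) * HH)"
    by (simp only: power_one_over H_power)
  have cancel: "A * B * (1 / (A * C)) = B / C" if "A \<noteq> 0" for A B C :: rat using that by simp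
  have "(\<Prod>g\<in>{1..<p}. (T (H + int g) * F (H + int g)) ^ (p - g)) * stay_coeff p True H ^ p = (HH + of_nat p) / HH"
    unfolding prod_up s by (rule cancel) (use HH_Q(4) in simp)
  also have "\<dots> = (of_int Q + 1) / of_int Q" using HH_Q by (simp add: divide_simps) (simp add: algebra_simps)
  finally show ?thesis .
qed

text \<open>For a path that falls first. Since \<open>p\<close> is odd, the \<open>p\<close> kept
  valleys contribute a sign, which cancels the one in \<open>prod_down\<close>.\<close>

lemma stay_False: "(\<Prod>g\<in>{1..<p}. (T (H - int g) * F (H - int g)) ^ (p - g)) * stay_coeff p False H ^ p = (of_int Q - 1) / of_int Q"
proof -
  have "stay_coeff p False H = - (1 / HH)" using dvd_H by (simp add: stay_coeff_def)
  then have s: "stay_coeff p False H ^ p = - (1 / (HH ^ (p - 1) * HH))"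
    by (simp only: even_power power_one_over H_power)
  have cancel: "A * - B * - (1 / (A * C)) = B / C" if "A \<noteq> 0" for A B C :: rat using that by simp
  have "(\<Prod>g\<in>{1..<p}. (T (H - int g) * F (H - int g)) ^ (p - g)) * stay_coeff p False H ^ p = (HH - of_nat p) / HH"
    unfolding prod_down s by (rule cancel) (use HH_Q(4) in simp)
  also have "\<dots> = (of_int Q - 1) / of_int Q" using HH_Q by (simp add: divide_simps) (simp add: algebra_simps)
  finally show ?thesis .
qed

definition X :: rat where
  "X = (\<Prod>k = 1..p - 1. (of_int Q + 1) * of_nat p - of_nat k) / (\<Prod>k = 1..p - 1. of_int Q * of_nat p - of_nat k)"

lemma prod_reflect: "(\<Prod>k = 1..p - 1. (of_int Q + 1) * of_nat p - of_nat k) = (\<Prod>g\<in>{1..<p}. HH + of_nat g)"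
  by (rule prod.reindex_bij_witness[of _ "\<lambda>g. p - g" "\<lambda>k. p - k"])
    (use p3 in \<open>auto simp: HH_Q(1) of_nat_diff algebra_simps\<close>)

lemma F_up: "(\<Prod>g\<in>{1..<p}. F (H + int g) ^ (p - g)) = layer_sign p * (\<Prod>g\<in>{1..<p}. HH + of_nat g)"
proof -
  let ?x = "\<lambda>g. HH + of_nat g"
  have ne: "?x g \<noteq> 0" for g
  proof -
    have "0 < ?x g" using HH_Q(5) by (intro add_pos_nonneg) simp_all
    then show ?thesis by simp
  qed
  \<comment> \<open>The exceptional value at \<open>g = 1\<close> is the general one times
    \<open>- H\<close>; raised to the power \<open>p - 1\<close>, this cancels the denominator left
    by telescoping.\<close>
  have "F (H + int g) = (- 1) * (?x g / ?x (g - 1)) * (if g = 1 then - HH else 1)" if g: "1 \<le> g" "g < p" for g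
  proof -
    have h: "1 \<le> H + int g" using H_ge g by linarith
    have y: "of_int (H + int g) = ?x g" "?x g - 1 = ?x (g - 1)" using g by (simp_all add: of_nat_diff)
    have Fg: "F (H + int g) = (if g = 1 then ?x g else - (?x g / ?x (g - 1)))"
      using F_value[OF h] dvd_up[OF g] unfolding y unfolding cong_g by (simp only: if_False)
    show ?thesis
    proof (cases "g = 1")
      case True
      have "A = - 1 * (A / B) * - B" if "B \<noteq> 0" for A B :: rat using that by simp
      then have "?x g = - 1 * (?x g / HH) * - HH" using HH_Q(4) by blast
      moreover have "?x (g - 1) = HH" using True by simp
      ultimately show ?thesis unfolding Fg using True by (simp only: if_True simp_thms)
    next
      case False
      then show ?thesis unfolding Fg by (simp only: if_False mult_minus1 mult_1_right)
    qed
  qed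
  then have "(\<Prod>g\<in>{1..<p}. F (H + int g) ^ (p - g)) =
    (\<Prod>g\<in>{1..<p}. (- 1) ^ (p - g) * (?x g / ?x (g - 1)) ^ (p - g) * (if g = 1 then - HH else 1) ^ (p - g))"
    by (intro prod.cong refl) (simp only: power_mult_distrib atLeastLessThan_iff)
  also have "\<dots> = layer_sign p * (\<Prod>g\<in>{1..<p}. (?x g / ?x (g - 1)) ^ (p - g)) * (\<Prod>g\<in>{1..<p}. (if g = 1 then - HH else 1) ^ (p - g))"
    by (simp only: prod.distrib layer_sign_def)
  also have "(\<Prod>g\<in>{1..<p}. (if g = 1 then - HH else 1) ^ (p - g)) = HH ^ (p - 1)"
  proof -
    have "(\<Prod>g\<in>{1..<p}. (if g = 1 then - HH else 1) ^ (p - g)) = (- HH) ^ (p - 1) * 1"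
      by (rule two_factor_prod) auto
    then show ?thesis by (simp only: even_power mult_1_right)
  qed
  also have "(\<Prod>g\<in>{1..<p}. (?x g / ?x (g - 1)) ^ (p - g)) = (\<Prod>g\<in>{1..<p}. ?x g) / HH ^ (p - 1)"
    using telescope[of p ?x] ne by simp
  finally show ?thesis using HH_Q(4) by simp
qed

text \<open>For \<open>Q\<close> at least 2 the height \<open>H - p\<close> is not zero. The
  exceptional value is at \<open>g = p - 1\<close> with exponent 1, so its correction
  \<open>-(H - p)\<close> enters once and cancels the last factor of the telescoped
  denominator.\<close>

lemma F_down:
  assumes Q2: "2 \<le> Q"
  shows "(\<Prod>g\<in>{1..<p}. F (H - int g) ^ (p - g)) = layer_sign p * - ((HH - 1) ^ p / (\<Prod>g\<in>{1..<p}. HH - of_nat g))"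
proof -
  let ?y = "\<lambda>g. HH - of_nat g"
  have "2 * int p \<le> H" using Q2 unfolding H_def by (intro mult_right_mono) simp_all
  then have "of_nat (2 * p) \<le> HH" by (metis of_int_le_iff of_int_of_nat_eq of_nat_mult of_nat_numeral)
  then have ne: "?y g \<noteq> 0" if "g \<le> p" for g
  proof -
    have "of_nat g < (of_nat (2 * p) :: rat)" using that p3 by (simp only: of_nat_less_iff)
    then show ?thesis using \<open>of_nat (2 * p) \<le> HH\<close> by simp
  qed
  have "F (H - int g) = (- 1) * (?y g / ?y (g + 1)) * (if g = p - 1 then - ?y p else 1)" if g: "1 \<le> g" "g < p" for g
  proof -
    have e: "H - int g = H + - int g" by simp
    have h: "1 \<le> H - int g" using H_ge g by linarith
    have y: "of_int (H - int g) = ?y g" "?y g - 1 = ?y (g + 1)" by simp_all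
    have Fg: "F (H - int g) = (if g = p - 1 then ?y g else - (?y g / ?y (g + 1)))"
      using F_value[OF h] dvd_down[OF g] unfolding y unfolding e cong_g by (simp only: if_False)
    show ?thesis
    proof (cases "g = p - 1")
      case True
      have gp: "g + 1 = p" using True p3 by simp
      have "A = - 1 * (A / B) * - B" if "B \<noteq> 0" for A B :: rat using that by simp
      then have "?y g = - 1 * (?y g / ?y p) * - ?y p" using ne[of p] by blast
      then show ?thesis unfolding Fg gp using True by (simp only: if_True simp_thms)
    next
      case False
      then show ?thesis unfolding Fg by (simp only: if_False mult_minus1 mult_1_right)
    qed
  qed
  then have "(\<Prod>g\<in>{1..<p}. F (H - int g) ^ (p - g)) =
    (\<Prod>g\<in>{1..<p}. (- 1) ^ (p - g) * (?y g / ?y (g + 1)) ^ (p - g) * (if g = p - 1 then - ?y p else 1) ^ (p - g))"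
    by (intro prod.cong refl) (simp only: power_mult_distrib atLeastLessThan_iff)
  also have "\<dots> = layer_sign p * (\<Prod>g\<in>{1..<p}. (?y g / ?y (g + 1)) ^ (p - g)) * (\<Prod>g\<in>{1..<p}. (if g = p - 1 then - ?y p else 1) ^ (p - g))"
    by (simp only: prod.distrib layer_sign_def)
  also have "(\<Prod>g\<in>{1..<p}. (if g = p - 1 then - ?y p else 1) ^ (p - g)) = - ?y p"
  proof -
    have "(\<Prod>g\<in>{1..<p}. (if g = p - 1 then - ?y p else 1) ^ (p - g)) = 1 ^ (p - 1) * - ?y p"
      by (rule two_factor_prod) (use p3 in auto)
    then show ?thesis by (simp only: power_one mult_1_left)
  qed
  also have "(\<Prod>g\<in>{1..<p}. (?y g / ?y (g + 1)) ^ (p - g)) = ?y 1 ^ p / (\<Prod>g\<in>{1..p}. ?y g)"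
    using telescope_down[of p ?y] ne p3 by simp
  also have "(\<Prod>g\<in>{1..p}. ?y g) = (\<Prod>g\<in>{1..<p}. ?y g) * ?y p"
    using p3 by (cases p) (simp_all add: prod.nat_ivl_Suc' atLeastLessThanSuc_atLeastAtMost)
  also have "layer_sign p * (?y 1 ^ p / ((\<Prod>g\<in>{1..<p}. ?y g) * ?y p)) * - ?y p =
    layer_sign p * - (?y 1 ^ p / (\<Prod>g\<in>{1..<p}. ?y g))"
  proof -
    have "s * (A / (B * C)) * - C = s * - (A / B)" if "C \<noteq> 0" for s A B C :: rat
      using that by (simp add: divide_simps)
    then show ?thesis using ne[of p] by blast
  qed
  finally show ?thesis by simp
qed

lemma X_eq: "X = (\<Prod>g\<in>{1..<p}. HH + of_nat g) / (\<Prod>g\<in>{1..<p}. HH - of_nat g)"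
proof -
  have "{1..p - 1} = {1..<p}" using p3 by auto
  then show ?thesis unfolding X_def prod_reflect HH_Q(1)[symmetric] by simp
qed

text \<open>Valley flips on the way from below the wall to above it. At the wall \<open>F H\<close>
  is \<open>-1 / (H - 1)\<close>, and its \<open>p\<close>-th power cancels the numerator
  \<open>(H - 1) ^ p\<close> of \<open>F_down\<close>.\<close>

lemma cross_False:
  assumes Q2: "2 \<le> Q"
  shows "(\<Prod>g\<in>{1..<p}. F (H - int g) ^ (p - g)) * F H ^ p * (\<Prod>g\<in>{1..<p}. F (H + int g) ^ (p - g)) = X"
proof -
  have "H \<noteq> 1" using H_ge p3 by simp
  then have H1: "HH - 1 \<noteq> 0" by (simp flip: of_int_eq_1_iff)
  have "F H = - (1 / (HH - 1))" using F_value[of H] dvd_H H_ge p3 by simp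
  then have FH: "F H ^ p = - (1 / (HH - 1) ^ p)" by (simp only: even_power power_one_over)
  have "s * - (A ^ p / B) * - (1 / A ^ p) * (s * C) = (s * s) * (C / B)" if "A \<noteq> 0" for s A B C :: rat
    using that by simp
  then show ?thesis unfolding F_down[OF Q2] F_up FH X_eq using H1 sign_square by simp
qed

text \<open>Multiplication by \<open>X\<close>, written as the product of valley flips, pairs each
  peak flip with the valley flip at the same height; the result is known from
  \<open>T_F_value\<close>, and \<open>X\<close> is divided out at the end.\<close>

lemma cross_True:
  assumes Q2: "2 \<le> Q"
  shows "(\<Prod>g\<in>{1..<p}. T (H + int g) ^ (p - g)) * T H ^ p * (\<Prod>g\<in>{1..<p}. T (H - int g) ^ (p - g)) =
    ((of_int Q)\<^sup>2 - 1) / (X * (of_int Q)\<^sup>2)" (is "?L = _")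
proof -
  have "1 \<le> H" using H_ge p3 by simp
  from T_F_value[OF this] have TF: "T H * F H = - (1 / HH\<^sup>2)" using dvd_H by simp
  then have TFp: "(T H * F H) ^ p = - (1 / (HH\<^sup>2) ^ p)" by (simp only: even_power power_one_over)
  have "?L * X = (\<Prod>g\<in>{1..<p}. (T (H + int g) * F (H + int g)) ^ (p - g)) * (T H * F H) ^ p *
     (\<Prod>g\<in>{1..<p}. (T (H - int g) * F (H - int g)) ^ (p - g))"
    unfolding cross_False[OF Q2, symmetric] power_mult_distrib prod.distrib by (simp add: ac_simps)
  also have "\<dots> = (HH ^ (p - 1) * HH ^ (p - 1)) * ((HH + of_nat p) * (HH - of_nat p)) / (HH ^ p * HH ^ p)"
  proof -
    have "A * B * - (1 / D) * (A * - C) = A * A * (B * C) / D" for A B C D :: rat by simp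
    moreover have "(HH\<^sup>2) ^ p = HH ^ p * HH ^ p" by (simp only: power2_eq_square power_mult_distrib)
    ultimately show ?thesis unfolding prod_up prod_down TFp by metis
  qed
  also have "\<dots> = ((HH + of_nat p) * (HH - of_nat p)) / HH\<^sup>2"
    unfolding H_power using HH_Q(4) by (simp add: power2_eq_square)
  also have "\<dots> = ((of_int Q)\<^sup>2 - 1) / (of_int Q)\<^sup>2"
    unfolding HH_Q(1) using HH_Q(2,3) by (simp add: divide_simps power2_eq_square) (simp add: algebra_simps)
  finally have eq: "?L * X = ((of_int Q)\<^sup>2 - 1) / (of_int Q)\<^sup>2" .
  have "X \<noteq> 0"
  proof
    assume "X = 0"
    then have "((of_int Q)\<^sup>2 - 1) / (of_int Q)\<^sup>2 = (0 :: rat)" using eq by simp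
    then have "(of_int Q)\<^sup>2 = (1 :: rat)" using HH_Q(2) by simp
    then have "Q\<^sup>2 = 1" by (metis of_int_eq_1_iff of_int_power)
    then show False using Q2 by (simp add: power2_eq_1_iff)
  qed
  moreover have "L = N / (Y * D)" if "L * Y = N / D" "Y \<noteq> 0" "D \<noteq> 0" for L Y N D :: rat
    using that by (simp add: field_simps)
  moreover have "(of_int Q)\<^sup>2 \<noteq> (0 :: rat)" using HH_Q(2) by simp
  ultimately show ?thesis using eq by blast
qed

text \<open>For \<open>g = p - 1\<close> the flip is that of a peak at height 1.\<close>

lemma cross_True_1:
  assumes "Q = 1"
  shows "(\<Prod>g\<in>{1..<p}. T (H - int g) ^ (p - g)) = 0"
proof -
  have "H = int p" unfolding H_def using assms by simp
  then have "H - int (p - 1) = 1" using p3 by (simp add: of_nat_diff)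
  moreover have "T 1 = 0" using p_not_dvd by (simp add: flip_coeff_def Let_def)
  ultimately have "T (H - int (p - 1)) = 0" by simp
  then have "T (H - int (p - 1)) ^ (p - (p - 1)) = 0" using p3 by simp
  moreover have "p - 1 \<in> {1..<p}" using p3 by auto
  ultimately show ?thesis by (meson finite_atLeastLessThan prod_zero)
qed

end

section \<open>Crossing two blocks\<close>

text \<open>\<open>zig p m b w j\<close> is the word \<open>b\<^bsup>p-j\<^esup> (\<not>b b)\<^bsup>j\<^esup> (\<not>b)\<^bsup>p-j\<^esup>\<close> in the window
  \<open>m + 1, \<dots>, m + 2p\<close> and \<open>w\<close> elsewhere.\<close>

definition zig :: "nat \<Rightarrow> nat \<Rightarrow> bool \<Rightarrow> (nat \<Rightarrow> bool) \<Rightarrow> nat \<Rightarrow> nat \<Rightarrow> bool" where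
  "zig p m b w j x = (if x \<le> m \<or> m + 2 * p < x then w x
     else if x \<le> m + (p - j) then b
     else if m + (p + j) < x then \<not> b
     else even (x - (m + (p - j))) = b)"

text \<open>The indices of the factors of \<open>Psi\<close> at level \<open>j\<close>, counted from
  the start \<open>m\<close> of the window; they are centred at \<open>m + p\<close>, the last entry
  of the first block.\<close>

definition layer_positions :: "nat \<Rightarrow> nat \<Rightarrow> nat \<Rightarrow> nat list" where
  "layer_positions p m j = map (\<lambda>l. m + (p - j) + 1 + 2 * l) [0..<j]"

lemma set_layer_positions:
  "x \<in> set (layer_positions p m j) \<longleftrightarrow> (\<exists>l<j. x = m + (p - j) + 1 + 2 * l)"
  by (auto simp: layer_positions_def)

lemma layer_positions_iff:
  assumes "j \<le> p"
  shows "x \<in> set (layer_positions p m j) \<longleftrightarrow> m + (p - j) < x \<and> x < m + (p + j) \<and> odd (x - (m + (p - j)))"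
proof
  assume "x \<in> set (layer_positions p m j)"
  then obtain l where "l < j" "x = m + (p - j) + 1 + 2 * l" unfolding set_layer_positions by blast
  then show "m + (p - j) < x \<and> x < m + (p + j) \<and> odd (x - (m + (p - j)))" using assms by auto
next
  assume x: "m + (p - j) < x \<and> x < m + (p + j) \<and> odd (x - (m + (p - j)))"
  then obtain l where l: "x - (m + (p - j)) = 2 * l + 1" by (elim conjE oddE)
  then have "x = m + (p - j) + 1 + 2 * l" "l < j" using x assms by linarith+
  then show "x \<in> set (layer_positions p m j)" unfolding set_layer_positions by blast
qed

lemma sparse_layer_positions: "j \<le> p \<Longrightarrow> sparse (set (layer_positions p m j))"
  unfolding sparse_def by (auto simp: layer_positions_iff Suc_diff_le)

lemma distinct_layer_positions: "distinct (layer_positions p m j)"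
  by (simp add: layer_positions_def distinct_map inj_on_def)

lemma length_layer_positions [simp]: "length (layer_positions p m j) = j"
  by (simp add: layer_positions_def)

text \<open>Consecutive positions differ by 2, so the toggled pairs of letters tile an interval of
  length \<open>2 * j\<close>.\<close>

lemma layer_positions_cover:
  assumes "j \<le> p"
  shows "x \<in> set (layer_positions p m j) \<or> 0 < x \<and> x - 1 \<in> set (layer_positions p m j) \<longleftrightarrow>
    m + (p - j) < x \<and> x \<le> m + (p + j)"
proof (cases "m + (p - j) < x")
  case True
  then obtain d where d: "x = Suc (m + (p - j) + d)" using less_imp_Suc_add by blast
  have "x \<in> set (layer_positions p m j) \<longleftrightarrow> Suc d < 2 * j \<and> even d"
    unfolding layer_positions_iff[OF assms] d using assms by auto
  moreover have "x - 1 \<in> set (layer_positions p m j) \<longleftrightarrow> d < 2 * j \<and> odd d"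
    unfolding layer_positions_iff[OF assms] d using assms odd_pos[of d] by auto
  moreover have "x \<le> m + (p + j) \<longleftrightarrow> Suc d \<le> 2 * j" unfolding d using assms by auto
  ultimately show ?thesis using True by presburger
next
  case False
  then show ?thesis unfolding layer_positions_iff[OF assms] by auto
qed

text \<open>On the central \<open>2 * j\<close> letters the word for \<open>j - 1\<close>
  alternates, starting with \<open>b\<close>, and the layer toggles all of them.\<close>

lemma flips_zig:
  assumes j: "1 \<le> j" "j \<le> p"
  shows "flips (set (layer_positions p m j)) (zig p m b w (j - 1)) = zig p m b w j"
proof
  fix x
  show "flips (set (layer_positions p m j)) (zig p m b w (j - 1)) x = zig p m b w j x"
  proof (cases "m + (p - j) < x \<and> x \<le> m + (p + j)")
    case True
    then obtain d where d: "x = Suc (m + (p - j) + d)" using less_imp_Suc_add by blast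
    have d2: "d < 2 * j" using True d j by linarith
    have "m < x" "x \<le> m + 2 * p" using d d2 j by linarith+
    then have outside: "(x \<le> m \<or> m + 2 * p < x) = False" by simp
    have "(x \<le> m + (p - (j - 1))) = (d = 0)" "(m + (p + (j - 1)) < x) = (d = 2 * j - 1)"
      "x - (m + (p - (j - 1))) = d" using d d2 j by linarith+
    then have "zig p m b w (j - 1) x = (if d = 0 then b else if d = 2 * j - 1 then \<not> b else even d = b)"
      unfolding zig_def outside by (simp only: if_False)
    moreover have "\<not> x \<le> m + (p - j)" "\<not> m + (p + j) < x" "x - (m + (p - j)) = Suc d"
      using d d2 j by linarith+
    then have "zig p m b w j x = (odd d = b)"
      unfolding zig_def outside by (simp only: if_False even_Suc)
    ultimately have "zig p m b w (j - 1) x = (\<not> zig p m b w j x)" using d2 by auto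
    then show ?thesis unfolding flips_def layer_positions_cover[OF j(2)] using True by simp
  next
    case False
    then consider "x \<le> m + (p - j)" | "m + (p + j) < x" by linarith
    then have "zig p m b w (j - 1) x = zig p m b w j x"
    proof cases
      case 1
      then have "x \<le> m + (p - (j - 1))" by linarith
      then show ?thesis using 1 by (simp only: zig_def if_True)
    next
      case 2
      have "\<not> x \<le> m + (p - (j - 1))" "m + (p + (j - 1)) < x" "\<not> x \<le> m + (p - j)" using 2 j by linarith+
      then show ?thesis using 2 by (simp only: zig_def if_True if_False)
    qed
    then show ?thesis using False by (simp only: flips_def layer_positions_cover[OF j(2)] simp_thms)
  qed
qed

lemma flips_zig_back:
  assumes "1 \<le> j" "j \<le> p"
  shows "flips (set (layer_positions p m j)) (zig p m b w j) = zig p m b w (j - 1)"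
  using flips_flips[of "set (layer_positions p m j)" "zig p m b w (j - 1)"] unfolding flips_zig[OF assms] .

lemma zig_at:
  assumes j: "j \<le> p" and k: "k \<in> set (layer_positions p m j)"
  shows "zig p m b w j k = (\<not> b)" "zig p m b w j (k + 1) = b"
proof -
  have k': "m + (p - j) < k" "k < m + (p + j)" "odd (k - (m + (p - j)))" using k layer_positions_iff[OF j] by auto
  then have "even (k + 1 - (m + (p - j)))" by (simp add: Suc_diff_le)
  then show "zig p m b w j k = (\<not> b)" "zig p m b w j (k + 1) = b" using k' j by (auto simp: zig_def)
qed

lemma zig_at_prev:
  assumes j: "1 \<le> j" "j \<le> p" and k: "k \<in> set (layer_positions p m j)"
  shows "zig p m b w (j - 1) k = b" "zig p m b w (j - 1) (k + 1) = (\<not> b)"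
proof -
  have "flips (set (layer_positions p m j)) (zig p m b w j) x = (\<not> zig p m b w j x)" if "x = k \<or> x = k + 1" for x
    using that k by (auto simp: flips_def)
  then show "zig p m b w (j - 1) k = b" "zig p m b w (j - 1) (k + 1) = (\<not> b)"
    using zig_at[OF j(2) k] unfolding flips_zig_back[OF j] by auto
qed

definition slope :: "bool \<Rightarrow> int" where
  "slope b = (if b then 1 else - 1)"

text \<open>All flips of a layer start at the same height, so a layer contributes one coefficient to
  the power \<open>j\<close>.\<close>

lemma height_zig:
  assumes j: "j \<le> p" and k: "k \<in> set (layer_positions p m j)"
  shows "height (zig p m b w j) (k - 1) = height w m + slope b * int (p - j)"
proof -
  let ?z = "zig p m b w j"
  have 0: "height ?z m = height w m" by (rule height_cong) (simp add: zig_def)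
  have 1: "height ?z (m + q) = height w m + slope b * int q" if "q \<le> p - j" for q
    using that
  proof (induction q)
    case (Suc q)
    then have "?z (Suc (m + q)) = b" by (auto simp: zig_def)
    then show ?case using Suc by (simp add: slope_def algebra_simps)
  qed (simp add: 0)
  have 2: "height ?z (m + (p - j) + 2 * l) = height w m + slope b * int (p - j)" if "l < j" for l
    using that
  proof (induction l)
    case (Suc l)
    have "m + (p - j) + 1 + 2 * l \<in> set (layer_positions p m j)" unfolding set_layer_positions using Suc.prems by auto
    from zig_at[OF j this] have "?z (Suc (m + (p - j) + 2 * l)) = (\<not> b)" "?z (Suc (Suc (m + (p - j) + 2 * l))) = b" by simp_all
    then show ?case using Suc by simp
  qed (use 1[of "p - j"] in simp)
  obtain l where "l < j" "k = m + (p - j) + 1 + 2 * l" using k unfolding set_layer_positions by blast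
  then show ?thesis using 2[of l] by simp
qed

lemma height_zig_prev:
  assumes j: "1 \<le> j" "j \<le> p" and k: "k \<in> set (layer_positions p m j)"
  shows "height (zig p m b w (j - 1)) (k - 1) = height w m + slope b * int (p - j)"
proof -
  have "height (flips (set (layer_positions p m j)) (zig p m b w j)) (k - 1) = height (zig p m b w j) (k - 1)"
  proof -
    have "k - 1 \<notin> set (layer_positions p m j)"
      using sparse_layer_positions[OF j(2), of m] k unfolding sparse_def by (cases k) auto
    then show ?thesis
      using height_flips[OF sparse_layer_positions[OF j(2), of m], of "zig p m b w j"] zig_at[OF j(2), of _ m b w] by simp
  qed
  then show ?thesis using height_zig[OF j(2) k] unfolding flips_zig_back[OF j] by simp
qed

text \<open>An alternating window that starts with \<open>\<not> b\<close> is also the stage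
  \<open>p - 1\<close> of the opposite shape. So after the wall has been passed, the rest is a
  descent in the window for \<open>\<not> b\<close>.\<close>

lemma zig_full: "1 \<le> p \<Longrightarrow> zig p m b w p = zig p m (\<not> b) w (p - 1)"
proof
  fix x assume p: "1 \<le> p"
  show "zig p m b w p x = zig p m (\<not> b) w (p - 1) x"
  proof (cases "x \<le> m \<or> m + 2 * p < x")
    case True
    then show ?thesis by (simp add: zig_def)
  next
    case False
    then obtain d where d: "x = Suc (m + d)" "d < 2 * p" using less_imp_Suc_add[of m x] by auto
    have "p - (p - 1) = 1" "p + (p - 1) = 2 * p - 1" using p by simp_all
    then show ?thesis using d p unfolding zig_def by (cases "d = 0"; cases "d = 2 * p - 1") auto
  qed
qed

section \<open>Layers acting on a window\<close>

context klr_action begin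

definition layers :: "nat \<Rightarrow> nat list \<Rightarrow> tl \<Rightarrow> tl" where
  "layers m js y = foldr (\<lambda>j. run (layer_positions p m j)) js y"

lemma layers_simps [simp]: "layers m [] y = y" "layers m (j # js) y = run (layer_positions p m j) (layers m js y)"
  "layers m (js @ ks) y = layers m js (layers m ks y)"
  by (simp_all add: layers_def)

lemma layers_linear: "layers m js (x + y) = layers m js x + layers m js y"
  "layers m js (scale c x) = scale c (layers m js x)"
  by (induction js) (simp_all add: run_linear)

end

text \<open>\<open>b\<close> is a parameter because one computation uses the windows for
  \<open>b\<close> and for \<open>\<not> b\<close>. By \<open>H_p\<close> all heights
  \<open>hgt j\<close> with \<open>j\<close> positive are at least 1.\<close>

locale klr_window = klr_action +
  fixes m :: nat and b :: bool and w :: "nat \<Rightarrow> bool"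
  assumes m: "m + 2 * p \<le> n"
    and wall: "int p dvd height w m" and H_p: "int p \<le> height w m"
begin

abbreviation Z where "Z \<equiv> zig p m b w"

abbreviation hgt :: "nat \<Rightarrow> int" where
  "hgt j \<equiv> height w m + slope b * int (p - j)"

lemma hgt_not_dvd: "1 \<le> j \<Longrightarrow> j < p \<Longrightarrow> \<not> int p dvd hgt j"
proof -
  assume j: "1 \<le> j" "j < p"
  then have "\<not> int p dvd int (p - j)" using zdvd_not_zless[of "int (p - j)" "int p"] by simp
  moreover have "int p dvd hgt j \<longleftrightarrow> int p dvd slope b * int (p - j)"
    using wall by (simp add: dvd_add_right_iff)
  ultimately show ?thesis by (cases b) (simp_all add: slope_def)
qed

lemma positions_less_n: "j \<le> p \<Longrightarrow> k \<in> set (layer_positions p m j) \<Longrightarrow> k < n"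
  using m by (auto simp: layer_positions_iff)

lemma layer_forward:
  assumes j: "1 \<le> j" "j < p" and ok: "ok (Z (j - 1))"
  shows "run (layer_positions p m j) (f (Z (j - 1))) = scale (flip_coeff p b (hgt j) ^ j) (f (Z j))" "ok (Z j)"
proof -
  let ?ks = "layer_positions p m j"
  have sp: "sparse (set ?ks)" using sparse_layer_positions j by simp
  have H: "b \<longrightarrow> 1 < hgt j" using j H_p by (auto simp: slope_def)
  have ks: "k < n \<and> Z (j - 1) k = b \<and> Z (j - 1) (k + 1) = (\<not> b) \<and> height (Z (j - 1)) (k - 1) = hgt j"
    if "k \<in> set ?ks" for k
    using positions_less_n[of j k] zig_at_prev[OF j(1) _ that] height_zig_prev[OF j(1) _ that] j that by simp
  have fl: "flips (set ?ks) (Z (j - 1)) = Z j" by (rule flips_zig) (use j in auto)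
  show "run ?ks (f (Z (j - 1))) = scale (flip_coeff p b (hgt j) ^ j) (f (Z j))"
    using layer_all[OF distinct_layer_positions sp ok ks _ hgt_not_dvd[OF j]] H fl by simp
  have "ok (flips (set ?ks) (Z (j - 1)))"
    by (rule ok_flips[OF ok sp]) (use ks H in auto)
  then show "ok (Z j)" using fl by simp
qed

text \<open>In a falling window the last layer may consist of a peak at height 1, whose flip is
  inadmissible. The equation remains true with coefficient 0, but \<open>ok\<close> is claimed only
  from \<open>j = 2\<close> on.\<close>

lemma layer_backward:
  assumes j: "1 \<le> j" "j < p" and ok: "ok (Z j)"
  shows "run (layer_positions p m j) (f (Z j)) = scale (flip_coeff p (\<not> b) (hgt j) ^ j) (f (Z (j - 1)))"
    "2 \<le> j \<Longrightarrow> ok (Z (j - 1))"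
proof -
  let ?ks = "layer_positions p m j"
  have sp: "sparse (set ?ks)" using sparse_layer_positions j by simp
  have H: "\<not> b \<longrightarrow> 1 < hgt j \<or> length ?ks \<le> 1" using j H_p by (auto simp: slope_def)
  have ks: "k < n \<and> Z j k = (\<not> b) \<and> Z j (k + 1) = (\<not> \<not> b) \<and> height (Z j) (k - 1) = hgt j"
    if "k \<in> set ?ks" for k
    using positions_less_n[of j k] zig_at[OF _ that] height_zig[OF _ that] j that by simp
  have fl: "flips (set ?ks) (Z j) = Z (j - 1)" by (rule flips_zig_back) (use j in auto)
  show "run ?ks (f (Z j)) = scale (flip_coeff p (\<not> b) (hgt j) ^ j) (f (Z (j - 1)))"
    using layer_all[OF distinct_layer_positions sp ok ks H hgt_not_dvd[OF j]] fl by simp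
  assume j2: "2 \<le> j"
  have "ok (flips (set ?ks) (Z j))"
    by (rule ok_flips[OF ok sp]) (use ks H j2 in auto)
  then show "ok (Z (j - 1))" using fl by simp
qed

lemma layers_up:
  assumes "ok (Z 0)" "j < p"
  shows "layers m (rev [1..<Suc j]) (f (Z 0)) = scale (\<Prod>l\<in>{1..j}. flip_coeff p b (hgt l) ^ l) (f (Z j)) \<and> ok (Z j)"
  using assms(2)
proof (induction j)
  case (Suc j)
  have *: "[1..<Suc (Suc j)] = [1..<Suc j] @ [Suc j]" by simp
  show ?case unfolding * using Suc layer_forward[of "Suc j"] by (simp add: run_linear del: upt_Suc)
qed (use assms(1) in simp)

lemma layers_down:
  assumes "ok (Z j)" "j < p"
  shows "layers m [1..<Suc j] (f (Z j)) = scale (\<Prod>l\<in>{1..j}. flip_coeff p (\<not> b) (hgt l) ^ l) (f (Z 0))"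
  using assms
proof (induction j)
  case (Suc j)
  have *: "[1..<Suc (Suc j)] = [1..<Suc j] @ [Suc j]" by simp
  have bk: "run (layer_positions p m (Suc j)) (f (Z (Suc j))) = scale (flip_coeff p (\<not> b) (hgt (Suc j)) ^ Suc j) (f (Z j))"
    "1 \<le> j \<Longrightarrow> ok (Z j)"
    using layer_backward[of "Suc j"] Suc.prems by simp_all
  show ?case
  proof (cases "j = 0")
    case True
    then show ?thesis using bk by simp
  next
    case False
    then have "layers m [1..<Suc j] (f (Z j)) = scale (\<Prod>l\<in>{1..j}. flip_coeff p (\<not> b) (hgt l) ^ l) (f (Z 0))"
      using Suc bk by simp
    then show ?thesis unfolding * using bk(1)
      by (simp add: layers_linear mult.commute del: upt_Suc)
  qed
qed simp

text \<open>At the wall both terms of \<open>\<psi>\<close> occur, so the layer expands over all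
  subsets of its positions. If a subset is neither empty nor full, some two neighbouring positions
  are treated differently; then the two letters between them agree, and layer \<open>p - 1\<close>,
  which has a position there, gives zero.\<close>

lemma middle:
  assumes ok: "ok (Z (p - 1))"
  shows "run (layer_positions p m (p - 1)) (run (layer_positions p m p) (f (Z (p - 1)))) =
    scale (stay_coeff p b (height w m) ^ p) (run (layer_positions p m (p - 1)) (f (Z (p - 1)))) +
    scale (flip_coeff p b (height w m) ^ p) (run (layer_positions p m (p - 1)) (f (Z p)))" "ok (Z p)"
proof -
  let ?ks = "layer_positions p m p" and ?ls = "layer_positions p m (p - 1)" and ?H = "height w m"
  let ?c = "\<lambda>S. stay_coeff p b ?H ^ card (set ?ks - S) * flip_coeff p b ?H ^ card S"
  have sp: "sparse (set ?ks)" using sparse_layer_positions by simp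
  have spl: "sparse (set ?ls)" using sparse_layer_positions by simp
  have H: "b \<longrightarrow> 1 < ?H" using p3 H_p by simp
  have p1: "1 \<le> p" "p \<le> p" using p3 by simp_all
  have ks: "k < n \<and> Z (p - 1) k = b \<and> Z (p - 1) (k + 1) = (\<not> b) \<and> height (Z (p - 1)) (k - 1) = ?H"
    if "k \<in> set ?ks" for k
    using positions_less_n[OF p1(2) that] zig_at_prev[OF p1 that] height_zig_prev[OF p1 that] by simp
  have fl: "flips (set ?ks) (Z (p - 1)) = Z p" by (rule flips_zig[OF p1])
  have okS: "ok (flips S (Z (p - 1)))" if "S \<subseteq> set ?ks" for S
    by (rule ok_flips[OF ok sparse_subset[OF sp that]]) (use ks H that in auto)
  show "ok (Z p)" using okS[OF order_refl] fl by simp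
  have kill: "run ?ls (f (flips S (Z (p - 1)))) = 0" if S: "S \<subseteq> set ?ks" "S \<noteq> {}" "S \<noteq> set ?ks" for S
  proof -
    let ?x = "\<lambda>l. m + 1 + 2 * l"
    have memS: "x \<in> set ?ks \<longleftrightarrow> (\<exists>l<p. x = ?x l)" for x by (simp add: set_layer_positions)
    have "\<exists>l. l + 1 < p \<and> (?x l \<in> S) \<noteq> (?x (l + 1) \<in> S)"
    proof (rule ccontr)
      assume no: "\<not> ?thesis"
      have all: "(?x l \<in> S) = (?x 0 \<in> S)" if "l < p" for l
        using that
      proof (induction l)
        case (Suc l)
        have "(?x l \<in> S) = (?x (l + 1) \<in> S)" using no Suc.prems by auto
        then show ?case using Suc by simp
      qed simp
      show False
      proof (cases "?x 0 \<in> S")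
        case True
        have "set ?ks \<subseteq> S"
        proof
          fix x assume "x \<in> set ?ks"
          then obtain l where "l < p" "x = ?x l" using memS by blast
          then show "x \<in> S" using all[of l] True by simp
        qed
        then show False using S by simp
      next
        case False
        have "x \<notin> S" for x
        proof
          assume x: "x \<in> S"
          then obtain l where "l < p" "x = ?x l" using memS S(1) by blast
          then show False using all[of l] False x by simp
        qed
        then show False using S by blast
      qed
    qed
    then obtain l where l: "l + 1 < p" "(?x l \<in> S) \<noteq> (?x (l + 1) \<in> S)" by blast
    define k where "k = ?x l + 1"
    have k_ls: "k \<in> set ?ls" unfolding set_layer_positions using l p3 by (intro exI[of _ l]) (simp add: k_def)
    have "\<exists>l'<p. ?x l = ?x l'" by (rule exI[of _ l]) (use l in simp)
    moreover have "\<exists>l'<p. ?x (l + 1) = ?x l'" by (rule exI[of _ "l + 1"]) (use l in simp)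
    ultimately have in_ks: "?x l \<in> set ?ks" "?x (l + 1) \<in> set ?ks" by (simp_all only: memS)
    have k_not: "k \<notin> S" using sp in_ks(1) S(1) unfolding sparse_def k_def by auto
    have letters: "Z (p - 1) k = (\<not> b)" "Z (p - 1) (k + 1) = b"
      using zig_at_prev[OF p1 in_ks(1)] zig_at_prev[OF p1 in_ks(2)] by (simp_all add: k_def)
    have "flips S (Z (p - 1)) k = flips S (Z (p - 1)) (k + 1)"
      unfolding flips_def letters using k_not l(2) by (auto simp: k_def)
    then show ?thesis
      using run_kill[OF spl _ k_ls okS[OF S(1)]] positions_less_n[of "p - 1"] by simp
  qed
  have ne: "set ?ks \<noteq> {}" using distinct_card[OF distinct_layer_positions[of p m p]] p3 by auto
  have card: "card (set ?ks) = p" using distinct_card[OF distinct_layer_positions[of p m p]] by simp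
  have "run ?ls (run ?ks (f (Z (p - 1)))) = (\<Sum>S\<in>Pow (set ?ks). scale (?c S) (run ?ls (f (flips S (Z (p - 1))))))"
    using layer[OF distinct_layer_positions sp ok ks] H by (simp add: run_sum run_linear)
  also have "\<dots> = (\<Sum>S\<in>{{}, set ?ks}. scale (?c S) (run ?ls (f (flips S (Z (p - 1))))))"
    by (rule sum.mono_neutral_right) (use kill in auto)
  also have "\<dots> = scale (stay_coeff p b ?H ^ p) (run ?ls (f (Z (p - 1)))) + scale (flip_coeff p b ?H ^ p) (run ?ls (f (Z p)))"
    using ne card fl by simp
  finally show "run ?ls (run ?ks (f (Z (p - 1)))) =
    scale (stay_coeff p b ?H ^ p) (run ?ls (f (Z (p - 1)))) + scale (flip_coeff p b ?H ^ p) (run ?ls (f (Z p)))" .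
qed

lemma prod_rev: "(\<Prod>l\<in>{1..p - 1}. g (p - l) ^ l) = (\<Prod>i\<in>{1..<p}. (g i :: rat) ^ (p - i))"
  by (rule prod.reindex_bij_witness[of _ "\<lambda>i. p - i" "\<lambda>l. p - l"]) (use p3 in auto)

text \<open>After the middle layer, the unflipped term returns over the same heights by the opposite
  flips. The flipped term is at stage \<open>p - 1\<close> of the window for \<open>\<not> b\<close>
  and continues beyond the wall, by flips of the same kind as before.\<close>

theorem layers_window:
  assumes ok: "ok (Z 0)"
  shows "layers m ([1..<p] @ [p] @ rev [1..<p]) (f (Z 0)) =
    scale ((\<Prod>g\<in>{1..<p}. (flip_coeff p b (height w m + slope b * int g) * flip_coeff p (\<not> b) (height w m + slope b * int g)) ^ (p - g))
        * stay_coeff p b (height w m) ^ p) (f (Z 0)) +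
    scale ((\<Prod>g\<in>{1..<p}. flip_coeff p b (height w m + slope b * int g) ^ (p - g)) * flip_coeff p b (height w m) ^ p
        * (\<Prod>g\<in>{1..<p}. flip_coeff p b (height w m - slope b * int g) ^ (p - g))) (f (zig p m (\<not> b) w 0))"
proof -
  interpret dual: klr_window n \<Phi> p \<psi> a m "\<not> b" w by unfold_locales (rule m wall H_p)+
  let ?H = "height w m"
  define c where "c = (\<lambda>B s. \<Prod>g\<in>{1..<p}. flip_coeff p B (?H + s * int g) ^ (p - g))"
  have pr: "(\<Prod>l\<in>{1..p - 1}. flip_coeff p B (?H + s * int (p - l)) ^ l) = c B s" for B s
    using prod_rev[of "\<lambda>i. flip_coeff p B (?H + s * int i)"] by (simp add: c_def)
  have p1: "Suc (p - 1) = p" "p - 1 < p" using p3 by simp_all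
  have up: "layers m (rev [1..<p]) (f (Z 0)) = scale (c b (slope b)) (f (Z (p - 1)))" and okp: "ok (Z (p - 1))"
    using layers_up[OF ok p1(2)] unfolding pr p1(1) by auto
  have "1 \<le> p - 1" using p3 by simp
  from upt_Suc_append[OF this] have split: "[1..<p] = [1..<p - 1] @ [p - 1]" unfolding p1(1) .
  have down_layers: "layers m [1..<p] y = layers m [1..<p - 1] (run (layer_positions p m (p - 1)) y)" for y
    by (subst split) simp
  have down: "layers m [1..<p] (f (Z (p - 1))) = scale (c (\<not> b) (slope b)) (f (Z 0))"
    using layers_down[OF okp p1(2)] unfolding pr p1(1) .
  have full: "Z p = dual.Z (p - 1)" using zig_full[of p m b w] p3 by simp
  have down': "layers m [1..<p] (f (Z p)) = scale (c b (- slope b)) (f (dual.Z 0))"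
  proof -
    have "ok (dual.Z (p - 1))" using middle(2)[OF okp] full by simp
    from dual.layers_down[OF this p1(2)] show ?thesis unfolding full pr p1(1) by (simp add: slope_def)
  qed
  have "layers m ([1..<p] @ [p] @ rev [1..<p]) (f (Z 0)) =
      scale (c b (slope b)) (layers m [1..<p] (run (layer_positions p m p) (f (Z (p - 1)))))"
    by (simp only: layers_simps up layers_linear run_linear)
  also have "layers m [1..<p] (run (layer_positions p m p) (f (Z (p - 1)))) =
      scale (stay_coeff p b ?H ^ p) (layers m [1..<p] (f (Z (p - 1)))) + scale (flip_coeff p b ?H ^ p) (layers m [1..<p] (f (Z p)))"
    unfolding down_layers middle(1)[OF okp] by (simp add: layers_linear)
  also have "\<dots> = scale (stay_coeff p b ?H ^ p * c (\<not> b) (slope b)) (f (Z 0)) + scale (flip_coeff p b ?H ^ p * c b (- slope b)) (f (dual.Z 0))"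
    unfolding down down' by simp
  finally have "layers m ([1..<p] @ [p] @ rev [1..<p]) (f (Z 0)) =
    scale ((c b (slope b) * c (\<not> b) (slope b)) * stay_coeff p b ?H ^ p) (f (Z 0)) +
    scale (c b (slope b) * flip_coeff p b ?H ^ p * c b (- slope b)) (f (dual.Z 0))"
    by (simp add: scale_add_right ac_simps)
  then show ?thesis unfolding c_def by (simp add: power_mult_distrib prod.distrib)
qed

end

section \<open>The class of the one-column tableau\<close>

lemma prefix_first_column:
  assumes "\<And>x. 1 \<le> x \<Longrightarrow> x \<le> m + l \<Longrightarrow> m < x \<Longrightarrow> w x = c"
  shows "height w (m + l) = height w m + (if c then int l else - int l)"
  using assms by (induction l) auto

lemma content_one_column: "x \<in> {1..n} \<Longrightarrow> content (one_column n) x = 1 - int x"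
  by (simp add: content_def one_column_def)

text \<open>The congruence of the contents with \<open>1 - x\<close>, rewritten by means of
  \<open>col1 + col2 = x - 1\<close>: each column may be entered only when the other one has the
  right length mod \<open>p\<close>.\<close>

locale class_word =
  fixes p n :: nat and w :: "nat \<Rightarrow> bool"
  assumes p3: "3 \<le> p" and adm: "admissible w n"
    and first: "\<And>x. 1 \<le> x \<Longrightarrow> x \<le> n \<Longrightarrow> w x \<Longrightarrow> p dvd col2 w (x - 1)"
    and second: "\<And>x. 1 \<le> x \<Longrightarrow> x \<le> n \<Longrightarrow> \<not> w x \<Longrightarrow> p dvd col1 w (x - 1) + 1"
begin

lemma initial: "1 \<le> x \<Longrightarrow> x < p \<Longrightarrow> x \<le> n \<Longrightarrow> w x"
proof (rule ccontr)
  assume x: "1 \<le> x" "x < p" "x \<le> n" "\<not> w x"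
  have "p dvd col1 w (x - 1) + 1" using second x by blast
  moreover have "col1 w (x - 1) \<le> x - 1" using col1_col2[of w "x - 1"] by linarith
  ultimately show False using x nat_dvd_not_less[of "col1 w (x - 1) + 1" p] by linarith
qed

text \<open>After \<open>k < p\<close> equal letters of a block, the divisibility required for the
  other column fails by \<open>k\<close>; so the first letter of a block determines the
  others.\<close>

lemma block_step:
  assumes m: "m + p \<le> n" and c2: "p dvd col2 w m" and pm: "p dvd m + 1"
  shows "\<And>l. 1 \<le> l \<Longrightarrow> l \<le> p \<Longrightarrow> w (m + l) = w (m + 1)"
proof -
  have c1: "p dvd col1 w m + 1"
  proof -
    have "col1 w m + 1 + col2 w m = m + 1" using col1_col2[of w m] by simp
    then show ?thesis using c2 pm by (metis dvd_add_left_iff)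
  qed
  fix l assume "1 \<le> l" "l \<le> p"
  then show "w (m + l) = w (m + 1)"
  proof (induction l rule: less_induct)
    case (less l)
    show ?case
    proof (cases "l = 1")
      case False
      define k where "k = l - 1"
      have k: "1 \<le> k" "k < p" "l = Suc k" using False less.prems by (auto simp: k_def)
      have same: "w (m + j) = w (m + 1)" if "1 \<le> j" "j \<le> k" for j using less.IH[of j] that k by simp
      have not: "\<not> p dvd k" using k nat_dvd_not_less by simp
      show ?thesis
      proof (cases "w (m + 1)")
        case True
        have "col1 w (m + k) = col1 w m + (m + k - m)"
        proof (rule count_upto_all)
          fix x assume "m < x" "x \<le> m + k"
          then show "w x" using same[of "x - m"] True by simp
        qed simp
        then have "col1 w (m + l - 1) + 1 = (col1 w m + 1) + k" using k by simp
        then have "\<not> p dvd col1 w (m + l - 1) + 1"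
          using not dvd_add_right_iff[OF c1, of k] by simp
        then have "w (m + l)" using second[of "m + l"] less.prems m by auto
        then show ?thesis using True by simp
      next
        case False
        have "col2 w (m + k) = col2 w m + (m + k - m)"
        proof (rule count_upto_all)
          fix x assume "m < x" "x \<le> m + k"
          then show "\<not> w x" using same[of "x - m"] False by simp
        qed simp
        then have "col2 w (m + l - 1) = col2 w m + k" using k by simp
        then have "\<not> p dvd col2 w (m + l - 1)"
          using not dvd_add_right_iff[OF c2, of k] by simp
        then have "\<not> w (m + l)" using first[of "m + l"] less.prems m by auto
        then show ?thesis using False by simp
      qed
    qed simp
  qed
qed

definition v :: "nat \<Rightarrow> bool" where
  "v j = w (j * p)"

text \<open>The path of the tableau is the path of \<open>f(s)\<close> enlarged by the factor
  \<open>p\<close>: the \<open>p - 1\<close> initial entries lead to height \<open>p\<close>, and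
  each block adds or subtracts \<open>p\<close>. This places walls at the ends of the
  blocks.\<close>

lemma blocks:
  assumes "(Suc j) * p \<le> n + 1"
  shows "p dvd col2 w (Suc j * p - 1) \<and> height w (Suc j * p - 1) = int p * height v j"
  using assms
proof (induction j)
  case 0
  have w: "w x" if "0 < x" "x \<le> p - 1" for x using initial that 0 by simp
  then have "count_upto (\<lambda>i. \<not> w i) (p - 1) = count_upto (\<lambda>i. \<not> w i) 0" by (intro count_upto_no) auto
  moreover have "height w (0 + (p - 1)) = height w 0 + (if True then int (p - 1) else - int (p - 1))"
    by (rule prefix_first_column) (use w in auto)
  ultimately show ?case using p3 by (simp add: of_nat_diff)
next
  case (Suc j)
  let ?m = "Suc j * p - 1"
  have IH: "p dvd col2 w ?m" "height w ?m = int p * height v j" using Suc by simp_all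
  have m1: "?m + 1 = Suc j * p" and mp: "?m + p = Suc (Suc j) * p - 1" using p3 by simp_all
  have const: "w (?m + l) = v (Suc j)" if "1 \<le> l" "l \<le> p" for l
    using block_step[of ?m l] IH(1) that Suc.prems m1 mp by (simp add: v_def)
  have h: "height w (?m + p) = height w ?m + (if v (Suc j) then int p else - int p)"
  proof (rule prefix_first_column)
    fix x assume "?m < x" "x \<le> ?m + p"
    then show "w x = v (Suc j)" using const[of "x - ?m"] by simp
  qed
  have "p dvd col2 w (?m + p)"
  proof (cases "v (Suc j)")
    case True
    have "col2 w (?m + p) = col2 w ?m"
    proof (rule count_upto_no)
      fix x assume "?m < x" "x \<le> ?m + p"
      then show "\<not> \<not> w x" using const[of "x - ?m"] True by simp
    qed simp
    then show ?thesis using IH by simp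
  next
    case False
    have "col2 w (?m + p) = col2 w ?m + (?m + p - ?m)"
    proof (rule count_upto_all)
      fix x assume "?m < x" "x \<le> ?m + p"
      then show "\<not> w x" using const[of "x - ?m"] False by simp
    qed simp
    then show ?thesis using IH by simp
  qed
  then show ?case using h IH unfolding mp by (simp add: algebra_simps)
qed

lemma block_const:
  assumes "1 \<le> j" "(j + 1) * p \<le> n + 1" "x \<in> block p j"
  shows "w x = v j"
proof -
  let ?m = "j * p - 1"
  obtain j' where j: "j = Suc j'" using assms(1) by (cases j) auto
  have "p dvd col2 w ?m" using blocks[of j'] assms(2) j by simp
  moreover have jp: "?m + 1 = j * p" using p3 j by simp
  moreover have "?m + p \<le> n" using assms(2) jp by simp
  ultimately have "w (?m + l) = w (?m + 1)" if "1 \<le> l" "l \<le> p" for l using block_step[of ?m l] that by simp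
  from this[of "x - ?m"] show ?thesis using assms(3) jp by (auto simp: block_def v_def)
qed

end

lemma class_word:
  assumes p: "3 \<le> p" and s: "s \<in> t_class p n"
  shows "class_word p n (word s)"
proof
  have std: "s \<in> StdPar2 n" using s by (simp add: t_class_def)
  show "3 \<le> p" by (rule p)
  show "admissible (word s) n" by (rule StdPar2_tab(2)[OF std])
  let ?w = "word s"
  have c: "int p dvd word_content ?w x - (1 - int x)" if x: "1 \<le> x" "x \<le> n" for x
  proof -
    have "[content s x = content (one_column n) x] (mod int p)" using s x by (simp add: t_class_def)
    moreover have "content s x = word_content ?w x" using content_tab[OF x, of ?w] StdPar2_tab(1)[OF std] by simp
    ultimately show ?thesis using content_one_column[of x n] x by (simp add: cong_iff_dvd_diff)
  qed
  have sum: "int (col1 ?w (x - 1)) + int (col2 ?w (x - 1)) = int x - 1" if "1 \<le> x" for x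
    using col1_col2[of ?w "x - 1"] that by linarith
  show "p dvd col2 ?w (x - 1)" if x: "1 \<le> x" "x \<le> n" and "?w x" for x
  proof -
    have "word_content ?w x - (1 - int x) = int (col2 ?w (x - 1))"
      using sum[OF x(1)] \<open>?w x\<close> by (simp add: word_content_def)
    then show ?thesis using c[OF x] by simp
  qed
  show "p dvd col1 ?w (x - 1) + 1" if x: "1 \<le> x" "x \<le> n" and "\<not> ?w x" for x
  proof -
    have "word_content ?w x - (1 - int x) = int (col1 ?w (x - 1) + 1)"
      using sum[OF x(1)] \<open>\<not> ?w x\<close> by (simp add: word_content_def)
    then show ?thesis using c[OF x] by (simp only: int_dvd_int_iff)
  qed
qed

lemma f_tab_eq:
  assumes p: "3 \<le> p" and s: "s \<in> t_class p n" and n: "(n2 + 1) * p \<le> n + 1" and j: "j \<in> {1..n2}"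
  shows "f_tab p n2 s j = tab n2 (\<lambda>k. word s (k * p)) j"
proof -
  interpret class_word p n "word s" by (rule class_word[OF p s])
  have "in_first p s k = word s (k * p)" if k: "k \<in> {1..n2}" for k
  proof -
    have "(k + 1) * p \<le> (n2 + 1) * p" using k by (intro mult_right_mono) auto
    then have kn: "(k + 1) * p \<le> n + 1" using n by (rule order_trans)
    have "word s x = word s (k * p)" if "x \<in> block p k" for x
      using block_const[OF _ kn that] k by (simp add: v_def)
    moreover have "k * p \<in> block p k" using p by (simp add: block_def)
    ultimately show ?thesis unfolding in_first_def word_def by blast
  qed
  then have "{k \<in> {1..j}. in_first p s k = in_first p s j} = {k \<in> {1..j}. word s (k * p) = word s (j * p)}"
    "in_first p s j = word s (j * p)" using j by auto
  then show ?thesis using j by (simp add: f_tab_def tab_def count_upto_card)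
qed

lemma block_swap_cases:
  assumes "1 \<le> p" "1 \<le> i"
  defines "m \<equiv> i * p - 1"
  shows "block_swap p i x = (if m < x \<and> x \<le> m + p then x + p else if m + p < x \<and> x \<le> m + 2 * p then x - p else x)"
proof -
  have "m + 1 = i * p" using assms by simp
  then have "x \<in> block p i \<longleftrightarrow> m < x \<and> x \<le> m + p" "x \<in> block p (i + 1) \<longleftrightarrow> m + p < x \<and> x \<le> m + 2 * p"
    by (auto simp: block_def)
  then show ?thesis by (simp only: block_swap_def)
qed

section \<open>U_i as a product of layers\<close>

context klr_action begin

lemma run_TL: "(\<And>k. k \<in> set ks \<Longrightarrow> 1 \<le> k \<and> k < n) \<Longrightarrow> y \<in> TL n \<Longrightarrow> run ks y \<in> TL n"
  by (induction ks) (simp_all add: TL_mult psi_TL)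

lemma Psi_run:
  assumes i: "1 \<le> i" and n: "(i + 2) * p \<le> n + 1" and j: "1 \<le> j" "j \<le> p" and y: "y \<in> TL n"
  defines "m \<equiv> i * p - 1"
  shows "Psi p n \<psi> i j \<in> TL n" "tl_mult n (Psi p n \<psi> i j) y = run (layer_positions p m j) y"
    "run (layer_positions p m j) y \<in> TL n"
proof -
  let ?ks = "layer_positions p m j"
  have m1: "m + 1 = i * p" using i p3 by (simp add: m_def)
  have pos: "(i + 1) * p - 1 + 1 + 2 * l - j = m + (p - j) + 1 + 2 * l" for l
  proof -
    have "(i + 1) * p = m + 1 + p" using m1 by simp
    then show ?thesis using j by simp
  qed
  have Psi: "Psi p n \<psi> i j = tl_prod n (map \<psi> ?ks)"
    unfolding Psi_def Let_def layer_positions_def map_map o_def pos ..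
  have range: "1 \<le> k \<and> k < n" if "k \<in> set ?ks" for k
    using that j n m1 unfolding set_layer_positions by auto
  have sub: "set (map \<psi> ?ks) \<subseteq> TL n" using range psi_TL by auto
  show "Psi p n \<psi> i j \<in> TL n" "tl_mult n (Psi p n \<psi> i j) y = run ?ks y"
    using tl_prod_mult[OF sub y] unfolding Psi by (simp_all add: run_def foldr_map o_def)
  show "run ?ks y \<in> TL n" using run_TL range y by blast
qed

lemma U_elem_layers:
  assumes i: "1 \<le> i" and n: "(i + 2) * p \<le> n + 1" and y: "y \<in> TL n"
  shows "tl_mult n (U_elem p n \<Phi> \<psi> i) y =
    tl_mult n (e_elem p n \<Phi>) (layers (i * p - 1) ([1..<p] @ [p] @ rev [1..<p]) (tl_mult n (e_elem p n \<Phi>) y))"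
proof -
  let ?js = "[1..<p] @ [p] @ rev [1..<p]" and ?e = "e_elem p n \<Phi>"
  have js: "1 \<le> j \<and> j \<le> p" if "j \<in> set ?js" for j using that p3 by auto
  have Psi_TL: "Psi p n \<psi> i j \<in> TL n" if "j \<in> set ?js" for j
    using Psi_run(1)[OF i n _ _ y] js[OF that] by blast
  have sub: "set ([?e] @ map (Psi p n \<psi> i) ?js @ [?e]) \<subseteq> TL n" using Psi_TL e_elem_TL by auto
  have layers: "foldr (tl_mult n) (map (Psi p n \<psi> i) js) z = layers (i * p - 1) js z \<and> layers (i * p - 1) js z \<in> TL n"
    if "z \<in> TL n" "\<And>j. j \<in> set js \<Longrightarrow> 1 \<le> j \<and> j \<le> p" for js z
    using that(2)
  proof (induction js)
    case (Cons j js)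
    then have IH: "foldr (tl_mult n) (map (Psi p n \<psi> i) js) z = layers (i * p - 1) js z" "layers (i * p - 1) js z \<in> TL n" by auto
    have "1 \<le> j" "j \<le> p" using Cons.prems by auto
    from Psi_run(2,3)[OF i n this IH(2)] IH(1) show ?case by simp
  qed (simp add: that(1))
  have "tl_mult n ?e y \<in> TL n" using TL_mult e_elem_TL y by blast
  from layers[OF this js]
  have "foldr (tl_mult n) (map (Psi p n \<psi> i) ?js) (tl_mult n ?e y) = layers (i * p - 1) ?js (tl_mult n ?e y)" by blast
  moreover have "tl_mult n (U_elem p n \<Phi> \<psi> i) y = foldr (tl_mult n) ([?e] @ map (Psi p n \<psi> i) ?js @ [?e]) y"
    unfolding U_elem_def using tl_prod_mult[OF sub y] by blast
  ultimately show ?thesis by (simp only: foldr_append foldr.simps o_apply id_apply)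
qed

lemma layers_zero: "layers m js 0 = 0"
  using layers_linear(2)[of m js 0 0] by simp

text \<open>The layer that acts first is the single \<open>\<psi>\<close> at the border
  \<open>m + p\<close> of the two blocks.\<close>

lemma layers_same_column:
  assumes ok: "ok w" and m: "m + p < n" and same: "w (m + p) = w (m + p + 1)"
  shows "layers m ([1..<p] @ [p] @ rev [1..<p]) (f w) = 0"
proof -
  have "[1..<p] = 1 # [2..<p]" using p3 by (simp add: upt_conv_Cons numeral_2_eq_2)
  then have "layers m (rev [1..<p]) (f w) = layers m (rev [2..<p]) (tl_mult n (\<psi> (m + p)) (f w))"
    using p3 by (simp add: layer_positions_def)
  also have "tl_mult n (\<psi> (m + p)) (f w) = 0" using psi_f[OF ok, of "m + p"] same m p3 by simp
  finally show ?thesis by (simp add: layers_zero run_linear)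
qed

end

section \<open>Swapping two adjacent blocks\<close>

text \<open>The rising path exceeds the falling one by twice a tent over the window; both
  admissibility and dominance are read off from this.\<close>

lemma height_zig_diff:
  "height (zig p m True w 0) x - height (zig p m False w 0) x =
    (if x \<le> m then 0 else if x \<le> m + p then 2 * int (x - m) else if x \<le> m + 2 * p then 2 * int (m + 2 * p - x) else 0)"
proof (induction x)
  case (Suc x)
  consider "Suc x \<le> m" | "m < Suc x" "Suc x \<le> m + p" | "m + p < Suc x" "Suc x \<le> m + 2 * p" | "m + 2 * p < Suc x" by linarith
  then show ?case
  proof cases
    case 2
    have "zig p m True w 0 (Suc x) = True" "zig p m False w 0 (Suc x) = False" using 2 by (simp_all add: zig_def)
    then show ?thesis using Suc 2 by (simp split: if_splits)
  next
    case 3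
    have "zig p m True w 0 (Suc x) = False" "zig p m False w 0 (Suc x) = True" using 3 by (simp_all add: zig_def)
    then show ?thesis using Suc 3 by (simp split: if_splits)
  next
    case 4
    have "zig p m True w 0 (Suc x) = w (Suc x)" "zig p m False w 0 (Suc x) = w (Suc x)" using 4 by (simp_all add: zig_def)
    then show ?thesis using Suc 4 by (simp split: if_splits)
  qed (use Suc in \<open>simp add: zig_def\<close>)
qed simp

lemma block_swap_involution:
  assumes "1 \<le> p" "1 \<le> i"
  shows "block_swap p i (block_swap p i x) = x"
proof -
  define m where "m = i * p - 1"
  note c = block_swap_cases[OF assms, folded m_def]
  consider "x \<le> m" | "m < x" "x \<le> m + p" | "m + p < x" "x \<le> m + 2 * p" | "m + 2 * p < x" by linarith
  then show ?thesis by cases (auto simp: c)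
qed

lemma block_swap_permutes:
  assumes "1 \<le> p" "1 \<le> i" "(i + 2) * p \<le> n + 1"
  shows "block_swap p i permutes {1..n}"
proof (rule involution_permutes)
  show "block_swap p i (block_swap p i x) = x" for x using block_swap_involution assms by blast
  have "i * p - 1 + 2 * p \<le> n" using assms by simp
  then show "block_swap p i x = x" if "x \<notin> {1..n}" for x
    using that unfolding block_swap_cases[OF assms(1,2)] by auto
qed

lemma zig_0_block_swap:
  assumes "1 \<le> p" "1 \<le> i"
  shows "zig p (i * p - 1) b w 0 \<circ> block_swap p i = zig p (i * p - 1) (\<not> b) w 0"
proof
  fix x
  let ?m = "i * p - 1"
  consider "x \<le> ?m" | "?m < x" "x \<le> ?m + p" | "?m + p < x" "x \<le> ?m + 2 * p" | "?m + 2 * p < x" by linarith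
  then show "(zig p ?m b w 0 \<circ> block_swap p i) x = zig p ?m (\<not> b) w 0 x"
    by cases (auto simp: zig_def block_swap_cases[OF assms])
qed

text \<open>The two blocks lie in different columns, so exchanging them keeps the order inside each
  column.\<close>

lemma act_block_swap_zig:
  assumes p: "1 \<le> p" and i: "1 \<le> i" and n: "(i + 2) * p \<le> n + 1"
  shows "act (tab n (zig p (i * p - 1) b w 0)) (block_swap p i) = tab n (zig p (i * p - 1) (\<not> b) w 0)"
proof -
  let ?m = "i * p - 1"
  have "act (tab n (zig p ?m b w 0)) (block_swap p i) = tab n (zig p ?m b w 0 \<circ> block_swap p i)"
  proof (rule act_tab)
    show "block_swap p i (block_swap p i x) = x" for x using block_swap_involution p i by blast
    show "block_swap p i permutes {1..n}" by (rule block_swap_permutes[OF p i n])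
    fix x y assume same: "zig p ?m b w 0 x = zig p ?m b w 0 y" and "x < y"
    have "\<not> (?m < x \<and> x \<le> ?m + p \<and> ?m + p < y \<and> y \<le> ?m + 2 * p)" using same by (auto simp: zig_def)
    then show "block_swap p i x < block_swap p i y"
      using \<open>x < y\<close> unfolding block_swap_cases[OF p i] by auto
  qed
  then show ?thesis by (simp only: zig_0_block_swap[OF p i])
qed

text \<open>Entries move by \<open>p\<close> or not at all, so the residues required of the contents
  are the same before and after the swap.\<close>

lemma act_block_swap_class:
  assumes p: "1 \<le> p" and i: "1 \<le> i" and n: "(i + 2) * p \<le> n + 1"
    and s: "s \<in> t_class p n" and t: "act s (block_swap p i) \<in> StdPar2 n"
  shows "act s (block_swap p i) \<in> t_class p n"
proof -
  let ?\<sigma> = "block_swap p i"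
  have "[content (act s ?\<sigma>) x = content (one_column n) x] (mod int p)" if x: "x \<in> {1..n}" for x
  proof -
    have y: "?\<sigma> x \<in> {1..n}" using permutes_in_image[OF block_swap_permutes[OF p i n]] x by simp
    have "content (act s ?\<sigma>) x = content s (?\<sigma> x)"
      using act_involution[of ?\<sigma> s] block_swap_involution[OF p i] by (simp add: content_def)
    moreover have "[content s (?\<sigma> x) = 1 - int (?\<sigma> x)] (mod int p)"
    proof -
      have "[content s (?\<sigma> x) = content (one_column n) (?\<sigma> x)] (mod int p)" using s y unfolding t_class_def by blast
      then show ?thesis unfolding content_one_column[OF y] .
    qed
    moreover have "[1 - int (?\<sigma> x) = 1 - int x] (mod int p)"
      unfolding block_swap_cases[OF p i] by (auto simp: cong_iff_dvd_diff of_nat_diff)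
    ultimately show ?thesis using content_one_column[OF x] by (metis cong_trans)
  qed
  then show ?thesis using t by (simp add: t_class_def)
qed

section \<open>The action of U_i on a pair of paths\<close>

theorem theorem6p1:
  fixes p n n1 n2 r0 i :: nat
    and \<Phi> :: "ga \<Rightarrow> tl" and \<psi> :: "nat \<Rightarrow> tl"
    and s a :: tableau
  assumes "prime p" and "odd p" and "n \<ge> p"
    and "n = (p - 1) + n1" and "n1 = p * n2 + r0" and "r0 < p"
    and "is_TL_hom n \<Phi>"
    and "\<And>k. 1 \<le> k \<Longrightarrow> k < n \<Longrightarrow> is_psi p n \<Phi> k (\<psi> k)"
    and "s \<in> t_class p n" and "a \<in> t_class p n" and "shape n s = shape n a"
    and "1 \<le> i" and "i < n2"
  shows "let f = f_elem n \<Phi>;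
             U = (\<lambda>x. tl_mult n (U_elem p n \<Phi> \<psi> i) x);
             t = act s (block_swap p i)
         in
         (t \<in> StdPar2 n \<longrightarrow>
            (let su = (if tab_less n t s then s else t);
                 sd = act su (block_swap p i);
                 \<rho> = (of_int (content (f_tab p n2 su) i - content (f_tab p n2 su) (i + 1)) :: rat);
                 X = (\<Prod>k = 1..p - 1. (\<rho> + 1) * of_nat p - of_nat k) /
                     (\<Prod>k = 1..p - 1. \<rho> * of_nat p - of_nat k)
             in
             U (f sd a) = scale ((\<rho> + 1) / \<rho>) (f sd a)
                          + scale ((\<rho>\<^sup>2 - 1) / (X * \<rho>\<^sup>2)) (f su a) \<and>
             U (f su a) = scale ((\<rho> - 1) / \<rho>) (f su a) + scale X (f sd a))) \<and>
         (t \<notin> StdPar2 n \<longrightarrow>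
            (column (f_tab p n2 s) i = column (f_tab p n2 s) (i + 1) \<longrightarrow> U (f s a) = 0) \<and>
            (row (f_tab p n2 s) i = row (f_tab p n2 s) (i + 1) \<longrightarrow> U (f s a) = scale 2 (f s a)))"
proof -
  have p3: "3 \<le> p"
    using prime_ge_2_nat[OF assms(1)] assms(2) by (cases "p = 2") auto
  have p1: "1 \<le> p" and i1: "1 \<le> i" using p3 assms(12) by simp_all
  have n_eq: "n + 1 = (n2 + 1) * p + r0" using assms(4,5) p1 by (simp add: algebra_simps)
  have n_i: "(i + 2) * p \<le> n + 1"
  proof -
    have "(i + 2) * p \<le> (n2 + 1) * p" using assms(13) by (intro mult_right_mono) auto
    then show ?thesis using n_eq by linarith
  qed
  have n_n2: "(n2 + 1) * p \<le> n + 1" using n_eq by simp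
  interpret tl_hom n \<Phi> by unfold_locales (rule assms(7))
  interpret klr_action n \<Phi> p \<psi> a by unfold_locales (use p3 assms(8) in auto)
  define w m where "w = word s" and "m = i * p - 1"
  define U where "U = tl_mult n (U_elem p n \<Phi> \<psi> i)"
  let ?\<sigma> = "block_swap p i" and ?t = "act s (block_swap p i)"
  have m1: "m + 1 = i * p" using i1 p1 by (simp add: m_def)
  have mn: "m + 2 * p \<le> n" using n_i m1 by simp
  have std: "s \<in> StdPar2 n" and std_a: "a \<in> StdPar2 n" using assms(9,10) by (auto simp: t_class_def)
  have s_tab: "s = tab n w" and adm: "admissible w n" unfolding w_def using StdPar2_tab[OF std] by blast+
  have a_Std: "a \<in> Std (shape n a)" using StdPar2_tab[OF std_a] tab_Std(2) by metis
  have ok: "ok w" using adm a_Std assms(11) unfolding ok_def s_tab by simp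
  interpret class_word p n w unfolding w_def by (rule class_word[OF p3 assms(9)])
  \<comment> \<open>The wall where the window starts has height \<open>p * Q\<close>;
    \<open>rho\<close> below shows that \<open>Q\<close> is the axial distance in the
    statement.\<close>
  define Q where "Q = height v (i - 1)"
  obtain i' where i': "i = Suc i'" using i1 by (cases i) auto
  have H: "height w m = int p * Q"
    using blocks[of i'] n_i unfolding i' m_def Q_def by simp
  have "1 \<le> height w m" using adm mn by (simp add: admissible_height)
  then have Q1: "1 \<le> Q" using H p1 by (metis int_one_le_iff_zero_less not_le of_nat_0_le_iff zero_less_mult_pos zero_less_mult_iff)
  interpret fc: flip_coefficients p Q by unfold_locales (use p3 assms(2) Q1 in auto)
  have fcH: "height w m = fc.H" using H by (simp add: fc.H_def)
  let ?wT = "zig p m True w 0" and ?wF = "zig p m False w 0"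
  have swap_T: "act (tab n ?wT) ?\<sigma> = tab n ?wF" and swap_F: "act (tab n ?wF) ?\<sigma> = tab n ?wT"
    using act_block_swap_zig[OF p1 i1 n_i, of True w] act_block_swap_zig[OF p1 i1 n_i, of False w] by (simp_all add: m_def)
  have w_block: "w x = v i" if "m < x" "x \<le> m + p" for x
  proof (rule block_const)
    show "(i + 1) * p \<le> n + 1" using n_i by simp
    show "x \<in> block p i" using that m1 by (auto simp: block_def)
  qed (rule i1)
  have w_block': "w x = v (i + 1)" if "m + p < x" "x \<le> m + 2 * p" for x
  proof (rule block_const)
    show "(i + 1 + 1) * p \<le> n + 1" using n_i by simp
    show "x \<in> block p (i + 1)" using that m1 by (auto simp: block_def)
  qed simp
  have w_zig: "w = zig p m (v i) w 0" if "v (i + 1) = (\<not> v i)"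
  proof
    fix x
    consider "x \<le> m" | "m < x" "x \<le> m + p" | "m + p < x" "x \<le> m + 2 * p" | "m + 2 * p < x" by linarith
    then show "w x = zig p m (v i) w 0 x"
      by cases (use that w_block[of x] w_block'[of x] in \<open>auto simp: zig_def\<close>)
  qed
  have e_f: "tl_mult n (e_elem p n \<Phi>) (f u) = f u" if "tab n u \<in> t_class p n" for u
    unfolding f_def by (rule e_elem_f_elem[OF that])
  have U_f: "U (f u) = tl_mult n (e_elem p n \<Phi>) (layers m ([1..<p] @ [p] @ rev [1..<p]) (f u))"
    if "tab n u \<in> t_class p n" for u
    unfolding U_def U_elem_layers[OF i1 n_i f_TL] e_f[OF that] m_def ..
  \<comment> \<open>The second term keeps its factor \<open>e\<close>, because the falling path may
    be inadmissible and is then not known to be fixed by \<open>e\<close>.\<close>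
  have U_T: "U (f ?wT) = scale ((of_int Q + 1) / of_int Q) (f ?wT) +
      scale ((\<Prod>g\<in>{1..<p}. fc.T (fc.H + int g) ^ (p - g)) * fc.T fc.H ^ p * (\<Prod>g\<in>{1..<p}. fc.T (fc.H - int g) ^ (p - g)))
        (tl_mult n (e_elem p n \<Phi>) (f ?wF))"
    if okT: "ok ?wT" and T: "tab n ?wT \<in> t_class p n"
  proof -
    interpret klr_window n \<Phi> p \<psi> a m True w
      by unfold_locales (use mn fcH fc.dvd_H fc.H_ge in auto)
    have "layers m ([1..<p] @ [p] @ rev [1..<p]) (f ?wT) = scale ((of_int Q + 1) / of_int Q) (f ?wT) +
      scale ((\<Prod>g\<in>{1..<p}. fc.T (fc.H + int g) ^ (p - g)) * fc.T fc.H ^ p * (\<Prod>g\<in>{1..<p}. fc.T (fc.H - int g) ^ (p - g))) (f ?wF)"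
      using layers_window[OF okT] fc.stay_True unfolding fcH by (simp add: slope_def)
    then show ?thesis unfolding U_f[OF T] by (simp add: tl_mult_add_right e_f[OF T])
  qed
  have U_F: "U (f ?wF) = scale ((of_int Q - 1) / of_int Q) (f ?wF) + scale fc.X (f ?wT)"
    if okF: "ok ?wF" and F: "tab n ?wF \<in> t_class p n" and T: "tab n ?wT \<in> t_class p n" and Q2: "2 \<le> Q"
  proof -
    interpret klr_window n \<Phi> p \<psi> a m False w
      by unfold_locales (use mn fcH fc.dvd_H fc.H_ge in auto)
    have "layers m ([1..<p] @ [p] @ rev [1..<p]) (f ?wF) = scale ((of_int Q - 1) / of_int Q) (f ?wF) + scale fc.X (f ?wT)"
      using layers_window[OF okF] fc.stay_False fc.cross_False[OF Q2] unfolding fcH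
      by (simp add: slope_def mult.commute mult.left_commute)
    then show ?thesis unfolding U_f[OF F] by (simp add: tl_mult_add_right e_f[OF T] e_f[OF F])
  qed
  have fs: "f_elem n \<Phi> (tab n u) a = f u" for u by (simp add: f_def)
  have hz: "height ?wT x - height ?wF x \<ge> 0" "height ?wT n = height ?wF n" for x
    using height_zig_diff[of p m w x] height_zig_diff[of p m w n] mn by (simp_all split: if_splits)
  have f_tab: "f_tab p n2 s j = tab n2 v j" if "j \<in> {1..n2}" for j
  proof -
    have "v = (\<lambda>k. w (k * p))" by (simp add: v_def fun_eq_iff)
    then show ?thesis using f_tab_eq[OF p3 assms(9) n_n2 that] by (simp only: w_def)
  qed
  have i_n2: "i \<in> {1..n2}" "i + 1 \<in> {1..n2}" using i1 assms(13) by auto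
  have height_m: "height ?wF m = height w m" by (rule height_cong) (simp add: zig_def)
  have not_less: "\<not> tab_less n (tab n ?wF) (tab n ?wT)" if "admissible ?wT n" "admissible ?wF n"
  proof
    assume "tab_less n (tab n ?wF) (tab n ?wT)"
    moreover have "m + 1 \<in> {1..n}" using mn p1 by simp
    ultimately have "col2 ?wF (m + 1) \<le> col2 ?wT (m + 1)" unfolding tab_less_def tab_le_iff[OF that(2,1)] by blast
    moreover have "height ?wT (m + 1) - height ?wF (m + 1) = 2" using p1 by (simp only: height_zig_diff) simp
    ultimately show False using col2_height(1)[of ?wT "m + 1"] col2_height(1)[of ?wF "m + 1"] by linarith
  qed
  \<comment> \<open>The rising path has fewer second-column entries at every point, so the tableau
    of \<open>?wF\<close> plays the role of \<open>s_u\<close> and that of \<open>?wT\<close> the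
    role of \<open>s_d\<close>.\<close>
  have less: "tab_less n (tab n ?wT) (tab n ?wF)" if "admissible ?wT n" "admissible ?wF n"
    unfolding tab_less_def
  proof
    show "tab_le n (tab n ?wT) (tab n ?wF)" unfolding tab_le_iff[OF that]
    proof
      fix x
      show "col2 ?wT x \<le> col2 ?wF x" using col2_height(1)[of ?wT x] col2_height(1)[of ?wF x] hz(1)[of x] by linarith
    qed
    show "tab n ?wT \<noteq> tab n ?wF"
    proof
      assume "tab n ?wT = tab n ?wF"
      then have "word (tab n ?wT) (m + 1) = word (tab n ?wF) (m + 1)" by simp
      then show False using mn p1 by (simp add: word_tab zig_def)
    qed
  qed
  \<comment> \<open>The falling path reaches height \<open>p * (Q - 1)\<close> in the middle of the
    window, which must be at least 1.\<close>
  have Q2: "2 \<le> Q" if "admissible ?wF n"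
  proof -
    have "height ?wF (m + p) = height ?wF m + (if False then int p else - int p)"
      by (rule prefix_first_column) (simp add: zig_def)
    moreover have "1 \<le> height ?wF (m + p)" using that mn by (simp add: admissible_height)
    ultimately have "int p * 1 < int p * Q" using H height_m by simp
    then show ?thesis using p1 by (simp add: mult_less_cancel_left)
  qed
  have rho: "content (f_tab p n2 (tab n ?wF)) i - content (f_tab p n2 (tab n ?wF)) (i + 1) = Q"
    if F: "tab n ?wF \<in> t_class p n"
  proof -
    define v' where "v' k = word (tab n ?wF) (k * p)" for k
    have word: "v' k = ?wF (k * p)" if "1 \<le> k" "k \<le> i + 1" for k
    proof -
      have "k * p \<le> (i + 1) * p" using that by (intro mult_right_mono) auto
      then have "k * p \<le> n" using m1 mn p1 by simp
      then show ?thesis using that p1 by (simp add: v'_def word_tab)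
    qed
    have vi: "\<not> v' i" "v' (i + 1)"
      using word[of i] word[of "i + 1"] i1 p1 m1[symmetric] by (simp_all add: zig_def)
    have below: "v' k = v k" if "1 \<le> k" "k \<le> i - 1" for k
    proof -
      have "k * p \<le> (i - 1) * p" using that by (intro mult_right_mono) auto
      then have "k * p \<le> m" using m1 p1 i1 by (simp add: diff_mult_distrib)
      then show ?thesis using word[of k] that by (simp add: zig_def v_def)
    qed
    have cnt: "count_upto v' (i - 1) = count_upto v (i - 1)" "col2 v' (i - 1) = col2 v (i - 1)"
      by (rule count_upto_cong; simp add: below)+
    have "count_upto v' i = count_upto v' (i - 1)" using vi(1) i' by simp
    moreover have "content (f_tab p n2 (tab n ?wF)) j = word_content v' j" if "j \<in> {1..n2}" for j
    proof -
      have "f_tab p n2 (tab n ?wF) j = tab n2 v' j" using f_tab_eq[OF p3 F n_n2 that] unfolding v'_def .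
      then show ?thesis using content_tab[of j n2 v'] that by (simp add: content_def)
    qed
    ultimately show ?thesis using i_n2 vi cnt by (simp add: word_content_def Q_def height_def)
  qed
  have main: "let \<rho> = (of_int (content (f_tab p n2 (tab n ?wF)) i - content (f_tab p n2 (tab n ?wF)) (i + 1)) :: rat);
                 X = (\<Prod>k = 1..p - 1. (\<rho> + 1) * of_nat p - of_nat k) /
                     (\<Prod>k = 1..p - 1. \<rho> * of_nat p - of_nat k)
             in
             U (f_elem n \<Phi> (tab n ?wT) a) = scale ((\<rho> + 1) / \<rho>) (f_elem n \<Phi> (tab n ?wT) a)
                          + scale ((\<rho>\<^sup>2 - 1) / (X * \<rho>\<^sup>2)) (f_elem n \<Phi> (tab n ?wF) a) \<and>
             U (f_elem n \<Phi> (tab n ?wF) a) = scale ((\<rho> - 1) / \<rho>) (f_elem n \<Phi> (tab n ?wF) a) + scale X (f_elem n \<Phi> (tab n ?wT) a)"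
    if okT: "ok ?wT" and okF: "ok ?wF" and T: "tab n ?wT \<in> t_class p n" and F: "tab n ?wF \<in> t_class p n"
  proof -
    have Q: "2 \<le> Q" using Q2 okF by (simp add: ok_def)
    show ?thesis
      unfolding Let_def rho[OF F] fc.X_def[symmetric] fs U_T[OF okT T] U_F[OF okF F T Q] e_f[OF F] fc.cross_True[OF Q]
      by blast
  qed
  show ?thesis
  proof (cases "v (i + 1) = v i")
    case True
    have t: "?t \<notin> StdPar2 n" unfolding s_tab
    proof (rule act_tab_not_standard)
      show "?\<sigma> (?\<sigma> x) = x" for x using block_swap_involution p1 i1 by blast
      show "?\<sigma> permutes {1..n}" by (rule block_swap_permutes[OF p1 i1 n_i])
      show "m + 1 \<in> {1..n}" "m + p + 1 \<in> {1..n}" using mn p1 by simp_all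
      show "w (m + 1) = w (m + p + 1)" using w_block w_block' True p1 by simp
      show "m + 1 < m + p + 1" using p1 by simp
      show "?\<sigma> (m + p + 1) < ?\<sigma> (m + 1)"
        using p1 unfolding block_swap_cases[OF p1 i1, folded m_def] by simp
    qed
    have zero: "U (f w) = 0"
    proof -
      have "w (m + p) = w (m + p + 1)" using w_block[of "m + p"] w_block'[of "m + p + 1"] True p1 by simp
      then have "layers m ([1..<p] @ [p] @ rev [1..<p]) (f w) = 0"
        using mn p1 by (intro layers_same_column[OF ok]) simp_all
      then show ?thesis using U_f[of w] assms(9) by (simp add: s_tab)
    qed
    \<comment> \<open>In one column the rows differ, so (d) is vacuous here; (c) is
      \<open>zero\<close>.\<close>
    have "row (f_tab p n2 s) i \<noteq> row (f_tab p n2 s) (i + 1)"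
      using i_n2 True by (simp add: f_tab tab_def)
    then show ?thesis using t zero unfolding Let_def U_def[symmetric] by (simp add: s_tab fs)
  next
    case False
    then have v1: "v (i + 1) = (\<not> v i)" by blast
    note w_eq = w_zig[OF v1]
    have col: "column (f_tab p n2 s) i \<noteq> column (f_tab p n2 s) (i + 1)"
      using i_n2 v1 by (simp add: f_tab tab_def)
    show ?thesis
    proof (cases "v i")
      case True
      have wT: "?wT = w" using w_eq True by simp
      have s_T: "tab n ?wT = s" using s_tab wT by simp
      have t: "?t = tab n ?wF" using swap_T unfolding s_T .
      have okT: "ok ?wT" using ok wT by simp
      have T: "tab n ?wT \<in> t_class p n" using assms(9) s_T by simp
      \<comment> \<open>Equal rows mean that the path of \<open>f(s)\<close> has height 1 before
        \<open>i\<close>. Then the off-diagonal coefficient vanishes and \<open>(Q + 1) / Q\<close>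
        is 2.\<close>
      have row: "U (f_elem n \<Phi> s a) = scale 2 (f_elem n \<Phi> s a)"
        if "row (f_tab p n2 s) i = row (f_tab p n2 s) (i + 1)"
      proof -
        have "col1 v i = col2 v (i + 1)" using that i_n2 True v1 by (simp add: f_tab tab_def)
        then have Q_1: "Q = 1" using True v1 by (simp add: Q_def height_def i')
        have "U (f ?wT) = scale ((of_int Q + 1) / of_int Q) (f ?wT)"
          using U_T[OF okT T] unfolding fc.cross_True_1[OF Q_1] by simp
        then show ?thesis unfolding s_T[symmetric] fs by (simp add: Q_1)
      qed
      have std_case: "ok ?wF" "tab n ?wF \<in> t_class p n" if "?t \<in> StdPar2 n"
      proof -
        have "admissible ?wF n" using that unfolding t tab_StdPar2_iff .
        then show "ok ?wF" using ok_height[OF okT] hz(2) by simp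
        show "tab n ?wF \<in> t_class p n" using act_block_swap_class[OF p1 i1 n_i assms(9) that] unfolding t .
      qed
      have su: "(if tab_less n ?t s then s else ?t) = tab n ?wF" if "?t \<in> StdPar2 n"
      proof -
        have "\<not> tab_less n (tab n ?wF) s"
          using not_less[unfolded s_T] std_case(1)[OF that] okT unfolding ok_def by blast
        then show ?thesis unfolding t by (rule if_not_P)
      qed
      show ?thesis
        unfolding Let_def U_def[symmetric]
        using main[OF okT std_case(1) T std_case(2), unfolded Let_def] su row col swap_F by (simp add: s_T)
    next
      case f: False
      have wF: "?wF = w" using w_eq f by simp
      have s_F: "tab n ?wF = s" using s_tab wF by simp
      have t: "?t = tab n ?wT" using swap_F unfolding s_F .
      have okF: "ok ?wF" using ok wF by simp
      have F: "tab n ?wF \<in> t_class p n" using assms(9) s_F by simp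
      \<comment> \<open>The rising path lies above the admissible falling one. So in this case the
        swapped tableau is always standard, and (c) and (d) are vacuous.\<close>
      have admT: "admissible ?wT n" unfolding admissible_height
      proof (intro allI impI)
        fix x assume "x \<le> n"
        then have "1 \<le> height ?wF x" using okF by (simp add: ok_def admissible_height)
        then show "1 \<le> height ?wT x" using hz(1)[of x] by linarith
      qed
      then have okT: "ok ?wT" using ok_height[OF okF] hz(2) by simp
      have t_std: "?t \<in> StdPar2 n" unfolding t tab_StdPar2_iff by (rule admT)
      have T: "tab n ?wT \<in> t_class p n" using act_block_swap_class[OF p1 i1 n_i assms(9) t_std] unfolding t .
      have su: "(if tab_less n ?t s then s else ?t) = tab n ?wF"
      proof -
        have "tab_less n (tab n ?wT) s" using less[OF admT, unfolded s_F] okF unfolding ok_def by blast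
        then show ?thesis unfolding t s_F by (rule if_P)
      qed
      show ?thesis
        unfolding Let_def U_def[symmetric] su swap_F
        using main[OF okT okF T F, unfolded Let_def] t_std swap_F by simp
    qed
  qed
qed

end
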